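(* Let $A$ be unbounded. For any $t\ge 0$ and $x\in\mathbb{R}^n$ one has: (i) $\mathcal{V}(t,x)=V(t,x)$, and this function is continuous; (ii) if either $q>p$, or both of the following conditions (a), (b) hold for the same closed set $\mathcal{T}\subset\mathbb{R}^n$, then $\mathcal{V}(x)=V(x)$: (a) $\mathcal{T}$ is nonempty and closed with compact boundary, $\mathcal{V}(x)=0$ for all $x\in\mathcal{T}$, and $\lim_{x\to\bar x}\mathcal{V}(x)=0$ for all $\bar x\in\partial\mathcal{T}$; (b) for any $x$ with $V(x)<+\infty$ there is some $\varepsilon>0$ such that $\liminf_{s\to+\infty}\mathbf{d}(\xi_x(s,w_0,w))=0$ for any $\varepsilon$-optimal control $(w_0,w)\in\Gamma$ (i.e. any $(w_0,w)\in\Gamma$ with $J(+\infty,x,w_0,w)\le V(x)+\varepsilon$).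
   Context: Notation. $\mathbb{R}_+=[0,+\infty)$; $\mathbf{d}(x)$ is the distance of $x$ from $\mathcal{T}$. A modulus is a function $\omega:\mathbb{R}_+\times\mathbb{R}_+\to\mathbb{R}_+$ such that $\omega(\cdot,R)$ is increasing in a neighborhood of $0$, continuous at $0$, with $\omega(0,R)=0$ for every $R>0$, and $\omega(r,\cdot)$ is increasing for every $r$. Data (standing assumptions). $A\subset\mathbb{R}^m$ is an (unbounded) convex, closed, nontrivial cone containing the origin. $f:\mathbb{R}^n\times A\to\mathbb{R}^n$ and $l:\mathbb{R}^n\times A\to\mathbb{R}$ are continuous; there are integers $q\ge p\ge 1$, $M>0$ and, for every $R>0$, constants $L_R,M_R>0$ and a modulus $\omega(\cdot,R)$ such that, for all $a\in A$ and all $|x|,|x_1|,|x_2|\le R$, $|f(x_1,a)-f(x_2,a)|\le L_R(1+|a|^p)|x_1-x_2|$, $|l(x_1,a)-l(x_2,a)|\le(1+|a|^q)\omega(|x_1-x_2|,R)$, $0\le l(x,a)\le M_R(1+|a|^q)$; and $|f(x,a)|\le M(1+|a|^p)(1+|x|)$ for all $(x,a)$. There are $C_1\ge0$, $C_2>0$ with $l(x,a)\ge C_2|a|^q-C_1$ for all $(x,a)\in\mathbb{R}^n\times A$ (same $q$). For $\Phi\in\{f,l\}$ there is a continuous function $\Phi^\infty$ with $\lim_{\rho\to0^+}\rho^q\Phi(x,\rho^{-1}a)=\Phi^\infty(x,a)$ uniformly on compact subsets of $\mathbb{R}^n\times A$. Original problem. $\mathcal{A}$ is the set of Borel measurable $\alpha:\mathbb{R}_+\to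 A$ belonging to $L^q_{loc}(\mathbb{R}_+,A)$; $y_x(\cdot,\alpha)$ is the solution of $\dot y=f(y,\alpha)$, $y(0)=x$. For $t\in[0,+\infty]$, $\mathcal{J}(t,x,\alpha)=\int_0^t l(y_x(\tau,\alpha),\alpha(\tau))\,d\tau$; $\mathcal{V}(t,x)=\inf_{\alpha\in\mathcal{A}}\mathcal{J}(t,x,\alpha)$ for finite $t$, and $\mathcal{V}(x)=\inf_{\alpha\in\mathcal{A}}\mathcal{J}(+\infty,x,\alpha)\in[0,+\infty]$. Extended problem. For $\Phi\in\{f,l\}$, $\overline{\Phi}(x,w_0,w)=w_0^q\Phi(x,w_0^{-1}w)$ if $w_0\ne0$ and $\overline\Phi(x,0,w)=\Phi^\infty(x,w)$, for $(x,w_0,w)\in\mathbb{R}^n\times\mathbb{R}_+\times A$. $S(A)=\{(w_0,w)\in\mathbb{R}_+\times A:\ w_0^q+|w|^q=1\}$; $\Gamma$ is the set of Borel measurable functions $(w_0,w):\mathbb{R}_+\to S(A)$. For $(w_0,w)\in\Gamma$, $\xi_x(\cdot,w_0,w)$ is the solution of $\xi'(s)=\overline f(\xi(s),w_0(s),w(s))$, $\xi(0)=x$, and for $S\in(0,+\infty]$, $J(S,x,w_0,w)=\int_0^S\overline l(\xi_x(s,w_0,w),w_0(s),w(s))\,ds$. Finally, $V(t,x)$ is the infimum of $J(S,x,w_0,w)$ over all $(w_0,w)\in\Gamma$ and $S>0$ such that $\int_0^S w_0^q(s)\,ds=t$, and $V(x)=\inf_{(w_0,w)\in\Gamma}J(+\infty,x,w_0,w)\in[0,+\infty]$.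 *)

theory Defs
  imports "HOL-Analysis.Analysis"
begin

text \<open>Functions on \<open>[0, \<infinity>)\<close> are represented by functions on \<^typ>\<open>real\<close> of which only the values
  on \<^term>\<open>{0..} :: real set\<close> are ever used.\<close>

text \<open>\<open>\<omega> r R\<close>; ``increasing'' is non-strict, as forced by \<open>\<omega> 0 R = 0\<close> for all \<open>R > 0\<close>.\<close>

definition modulus :: "(real \<Rightarrow> real \<Rightarrow> real) \<Rightarrow> bool" where
  "modulus \<omega> \<longleftrightarrow>
     (\<forall>r\<ge>0. \<forall>R\<ge>0. 0 \<le> \<omega> r R) \<and>
     (\<forall>R>0. (\<exists>\<delta>>0. mono_on {0..\<delta>} (\<lambda>r. \<omega> r R)) \<and>
            continuous (at 0 within {0..}) (\<lambda>r. \<omega> r R) \<and>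
            \<omega> 0 R = 0) \<and>
     (\<forall>r\<ge>0. mono_on {0..} (\<omega> r))"

text \<open>Caratheodory solutions of \<open>y' = g(s, y)\<close>, \<open>y(0) = x\<close> on \<open>[0, \<infinity>)\<close>: locally absolutely
  continuous and satisfying the equation almost everywhere, i.e. satisfying the integral
  equation with a locally Lebesgue integrable right-hand side.\<close>

definition ode_solution ::
    "(real \<Rightarrow> 'x \<Rightarrow> 'x) \<Rightarrow> 'x \<Rightarrow> (real \<Rightarrow> 'x::euclidean_space) \<Rightarrow> bool" where
  "ode_solution g x y \<longleftrightarrow>
     continuous_on {0..} y \<and>
     (\<forall>t\<ge>0. set_integrable lborel {0..t} (\<lambda>s. g s (y s)) \<and>
            y t = x + (LINT s:{0..t}|lborel. g s (y s)))"

subsection \<open>The original problem\<close>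

definition controls :: "nat \<Rightarrow> 'a::euclidean_space set \<Rightarrow> (real \<Rightarrow> 'a) set" where
  "controls q A =
     {\<alpha>. \<alpha> \<in> borel_measurable (restrict_space borel {0..}) \<and> (\<forall>s\<ge>0. \<alpha> s \<in> A) \<and>
         (\<forall>T\<ge>0. set_integrable lborel {0..T} (\<lambda>s. norm (\<alpha> s) ^ q))}"

text \<open>For the data and controls considered here the solution exists and is unique on
  \<open>[0, \<infinity>)\<close>; Hilbert choice only leaves the irrelevant values at negative times unspecified.
  The same applies to \<open>ext_traj\<close> below.\<close>

definition traj ::
    "('x \<Rightarrow> 'a \<Rightarrow> 'x::euclidean_space) \<Rightarrow> 'x \<Rightarrow> (real \<Rightarrow> 'a) \<Rightarrow> real \<Rightarrow> 'x" where
  "traj f x \<alpha> = (SOME y. ode_solution (\<lambda>s z. f z (\<alpha> s)) x y)"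

text \<open>The running costs are nonnegative, so the costs are integrals with values in \<open>[0, \<infinity>]\<close>.\<close>

definition cost ::
    "('x \<Rightarrow> 'a \<Rightarrow> 'x::euclidean_space) \<Rightarrow> ('x \<Rightarrow> 'a \<Rightarrow> real) \<Rightarrow>
     ereal \<Rightarrow> 'x \<Rightarrow> (real \<Rightarrow> 'a) \<Rightarrow> ennreal" where
  "cost f l t x \<alpha> =
     (\<integral>\<^sup>+\<tau>\<in>{\<tau>. 0 \<le> \<tau> \<and> ereal \<tau> \<le> t}. ennreal (l (traj f x \<alpha> \<tau>) (\<alpha> \<tau>)) \<partial>lborel)"

definition value_fin ::
    "nat \<Rightarrow> 'a::euclidean_space set \<Rightarrow> ('x \<Rightarrow> 'a \<Rightarrow> 'x::euclidean_space) \<Rightarrow>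
     ('x \<Rightarrow> 'a \<Rightarrow> real) \<Rightarrow> real \<Rightarrow> 'x \<Rightarrow> ennreal" where
  "value_fin q A f l t x = (INF \<alpha>\<in>controls q A. cost f l (ereal t) x \<alpha>)"

definition value_inf ::
    "nat \<Rightarrow> 'a::euclidean_space set \<Rightarrow> ('x \<Rightarrow> 'a \<Rightarrow> 'x::euclidean_space) \<Rightarrow>
     ('x \<Rightarrow> 'a \<Rightarrow> real) \<Rightarrow> 'x \<Rightarrow> ennreal" where
  "value_inf q A f l x = (INF \<alpha>\<in>controls q A. cost f l \<infinity> x \<alpha>)"

subsection \<open>The extended problem\<close>

definition recession_limit ::
    "nat \<Rightarrow> 'a::euclidean_space set \<Rightarrow> ('x::euclidean_space \<Rightarrow> 'a \<Rightarrow> 'b::euclidean_space) \<Rightarrow>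
     ('x \<Rightarrow> 'a \<Rightarrow> 'b) \<Rightarrow> bool" where
  "recession_limit q A \<Phi> \<Phi>inf \<longleftrightarrow>
     continuous_on (UNIV \<times> A) (\<lambda>(x, a). \<Phi>inf x a) \<and>
     (\<forall>K. compact K \<and> K \<subseteq> UNIV \<times> A \<longrightarrow>
        uniform_limit K (\<lambda>\<rho> (x, a). \<rho> ^ q *\<^sub>R \<Phi> x (inverse \<rho> *\<^sub>R a))
          (\<lambda>(x, a). \<Phi>inf x a) (at_right 0))"

definition extend ::
    "nat \<Rightarrow> ('x \<Rightarrow> 'a::real_vector \<Rightarrow> 'b::real_vector) \<Rightarrow> ('x \<Rightarrow> 'a \<Rightarrow> 'b) \<Rightarrow>
     'x \<Rightarrow> real \<Rightarrow> 'a \<Rightarrow> 'b" where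
  "extend q \<Phi> \<Phi>inf x w\<^sub>0 w =
     (if w\<^sub>0 \<noteq> 0 then w\<^sub>0 ^ q *\<^sub>R \<Phi> x (inverse w\<^sub>0 *\<^sub>R w) else \<Phi>inf x w)"

definition ext_control_set :: "nat \<Rightarrow> 'a::real_normed_vector set \<Rightarrow> (real \<times> 'a) set" where
  "ext_control_set q A = {(w\<^sub>0, w). 0 \<le> w\<^sub>0 \<and> w \<in> A \<and> w\<^sub>0 ^ q + norm w ^ q = 1}"

definition ext_controls ::
    "nat \<Rightarrow> 'a::euclidean_space set \<Rightarrow> ((real \<Rightarrow> real) \<times> (real \<Rightarrow> 'a)) set" where
  "ext_controls q A =
     {(w\<^sub>0, w). (\<lambda>s. (w\<^sub>0 s, w s)) \<in> borel_measurable (restrict_space borel {0..}) \<and>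
               (\<forall>s\<ge>0. (w\<^sub>0 s, w s) \<in> ext_control_set q A)}"

text \<open>In the following, \<open>F\<close> and \<open>L\<close> are the extended dynamics and running cost
  \<open>extend q f finf\<close> and \<open>extend q l linf\<close>.\<close>

definition ext_traj ::
    "('x \<Rightarrow> real \<Rightarrow> 'a \<Rightarrow> 'x::euclidean_space) \<Rightarrow> 'x \<Rightarrow> (real \<Rightarrow> real) \<Rightarrow> (real \<Rightarrow> 'a) \<Rightarrow>
     real \<Rightarrow> 'x" where
  "ext_traj F x w\<^sub>0 w = (SOME \<xi>. ode_solution (\<lambda>s z. F z (w\<^sub>0 s) (w s)) x \<xi>)"

definition ext_cost ::
    "('x \<Rightarrow> real \<Rightarrow> 'a \<Rightarrow> 'x::euclidean_space) \<Rightarrow> ('x \<Rightarrow> real \<Rightarrow> 'a \<Rightarrow> real) \<Rightarrow>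
     ereal \<Rightarrow> 'x \<Rightarrow> (real \<Rightarrow> real) \<Rightarrow> (real \<Rightarrow> 'a) \<Rightarrow> ennreal" where
  "ext_cost F L S x w\<^sub>0 w =
     (\<integral>\<^sup>+s\<in>{s. 0 \<le> s \<and> ereal s \<le> S}. ennreal (L (ext_traj F x w\<^sub>0 w s) (w\<^sub>0 s) (w s)) \<partial>lborel)"

definition ext_value_fin ::
    "nat \<Rightarrow> 'a::euclidean_space set \<Rightarrow> ('x \<Rightarrow> real \<Rightarrow> 'a \<Rightarrow> 'x::euclidean_space) \<Rightarrow>
     ('x \<Rightarrow> real \<Rightarrow> 'a \<Rightarrow> real) \<Rightarrow> real \<Rightarrow> 'x \<Rightarrow> ennreal" where
  "ext_value_fin q A F L t x =
     (INF (w\<^sub>0, w, S)\<in>{(w\<^sub>0, w, S). (w\<^sub>0, w) \<in> ext_controls q A \<and> 0 < S \<and>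
                                 (LINT s:{0..S}|lborel. w\<^sub>0 s ^ q) = t}.
        ext_cost F L (ereal S) x w\<^sub>0 w)"

definition ext_value_inf ::
    "nat \<Rightarrow> 'a::euclidean_space set \<Rightarrow> ('x \<Rightarrow> real \<Rightarrow> 'a \<Rightarrow> 'x::euclidean_space) \<Rightarrow>
     ('x \<Rightarrow> real \<Rightarrow> 'a \<Rightarrow> real) \<Rightarrow> 'x \<Rightarrow> ennreal" where
  "ext_value_inf q A F L x =
     (INF (w\<^sub>0, w)\<in>ext_controls q A. ext_cost F L \<infinity> x w\<^sub>0 w)"

definition vanishing_target ::
    "'x::euclidean_space set \<Rightarrow> ('x \<Rightarrow> ennreal) \<Rightarrow> bool" where
  "vanishing_target T V \<longleftrightarrow>
     T \<noteq> {} \<and> closed T \<and> compact (frontier T) \<and>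
     (\<forall>x\<in>T. V x = 0) \<and>
     (\<forall>x\<in>frontier T. (V \<longlongrightarrow> 0) (at x))"

definition near_optimal_approach ::
    "nat \<Rightarrow> 'a::euclidean_space set \<Rightarrow> ('x \<Rightarrow> real \<Rightarrow> 'a \<Rightarrow> 'x::euclidean_space) \<Rightarrow>
     ('x \<Rightarrow> real \<Rightarrow> 'a \<Rightarrow> real) \<Rightarrow> 'x set \<Rightarrow> bool" where
  "near_optimal_approach q A F L T \<longleftrightarrow>
     (\<forall>x. ext_value_inf q A F L x < \<infinity> \<longrightarrow>
        (\<exists>\<epsilon>>0::real. \<forall>(w\<^sub>0, w)\<in>ext_controls q A.
           ext_cost F L \<infinity> x w\<^sub>0 w \<le> ext_value_inf q A F L x + ennreal \<epsilon> \<longrightarrow>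
           Liminf at_top (\<lambda>s. ereal (infdist (ext_traj F x w\<^sub>0 w s) T)) = 0))"

end

theory Submission
  imports Defs
begin

text \<open>For \<open>\<phi>(s) = \<integral>\<^sub>0\<^sup>s g\<close> and \<open>\<sigma>(t) = inf {s. t \<le> \<phi>(s)}\<close> the equivalence \<open>\<sigma>(t) \<le> s \<longleftrightarrow> t \<le> \<phi>(s)\<close> says
  that \<open>\<sigma>\<close> pushes Lebesgue measure on \<open>[0, \<infinity>)\<close> forward to \<open>g ds\<close>. This single change of variables
  transports solutions and costs: with \<open>g = 1 + |\<alpha>|\<^sup>q\<close> from ordinary to extended controls, and with
  \<open>g = w\<^sub>0\<^sup>q\<close> back again when \<open>w\<^sub>0 > 0\<close>. Raising \<open>w\<^sub>0\<close> to a small \<open>\<rho> > 0\<close> and shrinking \<open>w\<close> accordingly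
  changes trajectory and cost little on a bounded horizon and can only lengthen the elapsed time, and
  the finite-horizon value increases with time, so the two finite-horizon values agree. Coercivity
  bounds the extended horizon of near-optimal controls, hence their trajectories depend uniformly on
  the data and the value is continuous.

  On the infinite horizon a finite extended cost forces \<open>\<integral> w\<^sub>0\<^sup>q = \<infinity>\<close> by coercivity. If \<open>p < q\<close>, the
  extended dynamics vanish where \<open>w\<^sub>0 = 0\<close>, so this set can be cut out at no extra cost. In the other
  case a near-optimal extended control is followed until it is close to the target, perturbed up to
  that time so that \<open>w\<^sub>0 > 0\<close>, and completed by an ordinary control of small cost.\<close>

subsection \<open>Change of time\<close>

text \<open>The two problems differ only where \<open>w\<^sub>0 = 0\<close>: there the state may
  move while ordinary time stands still, which in general no ordinary control reproduces exactly.
  The perturbation to \<open>w\<^sub>0 > 0\<close> has an error governed by Gronwall, growing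
  exponentially with the horizon, so it is available on bounded horizons only. This is why the
  infinite horizon asks either for dynamics that vanish at \<open>w\<^sub>0 = 0\<close> or for a
  target near which the remaining cost is small. The perturbation also destroys the constraint that
  the elapsed time be exactly \<open>t\<close>; raising \<open>w\<^sub>0\<close> makes that error
  one-sided, and the nonnegativity of \<open>l\<close> absorbs it. The stability estimates are made
  on the extended side because its controls take values in a bounded set, so that all constants are
  uniform in the control; for ordinary controls the weights depend on the size of
  \<open>\<alpha>\<close>.\<close>

lemma measure_eqI_atMost:
  fixes M N :: "real measure"
  assumes "sets M = sets borel" "sets N = sets borel"
    and "\<And>s. emeasure M {..s} = emeasure N {..s}" and "\<And>s. emeasure M {..s} \<noteq> \<infinity>"
  shows "M = N"
proof (rule measure_eqI_generator_eq[where E="range atMost" and \<Omega>=UNIV and A="\<lambda>n. {..real n}"])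
  show "Int_stable (range (atMost :: real \<Rightarrow> real set))"
    by (auto simp: Int_stable_def)
  have "sets borel = sigma_sets UNIV (range (atMost :: real \<Rightarrow> real set))"
    by (simp add: borel_eq_atMost)
  then show "sets M = sigma_sets UNIV (range atMost)" "sets N = sigma_sets UNIV (range atMost)"
    using assms by auto
  show "(\<Union>i. {..real i}) = UNIV"
    by (auto intro: real_arch_simple)
qed (use assms in auto)

lemma continuous_on_atLeast_if_atLeastAtMost:
  fixes h :: "real \<Rightarrow> 'b::topological_space"
  assumes "\<And>T. a \<le> T \<Longrightarrow> continuous_on {a..T} h"
  shows "continuous_on {a..} h"
  unfolding continuous_on_eq_continuous_within
proof
  fix x assume x: "x \<in> {a..}"
  have "at x within {a..} = at x within {a..x+1}"
    by (rule at_within_nhd[where S="{..<x+1}"]) (use x in auto)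
  moreover have "continuous (at x within {a..x+1}) h"
    using assms[of "x+1"] x by (auto simp: continuous_on_eq_continuous_within)
  ultimately show "continuous (at x within {a..}) h" by simp
qed

lemma continuous_on_LINT:
  fixes h :: "real \<Rightarrow> 'b::euclidean_space"
  assumes "\<And>T. a \<le> T \<Longrightarrow> set_integrable lborel {a..T} h"
  shows "continuous_on {a..} (\<lambda>t. LINT s:{a..t}|lborel. h s)"
proof (rule continuous_on_atLeast_if_atLeastAtMost)
  fix T assume "a \<le> T"
  have "continuous_on {a..T} (\<lambda>t. integral {a..t} h)"
    by (rule indefinite_integral_continuous_1)
      (use set_borel_integral_eq_integral(1)[OF assms] \<open>a \<le> T\<close> in auto)
  then show "continuous_on {a..T} (\<lambda>t. LINT s:{a..t}|lborel. h s)"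
    by (rule continuous_on_eq)
      (use set_borel_integral_eq_integral(2)[OF assms] in auto)
qed

lemma LINT_Icc_self [simp]:
  fixes h :: "real \<Rightarrow> 'b::euclidean_space"
  shows "(LINT s:{a..a}|lborel. h s) = 0"
  unfolding set_lebesgue_integral_def
  by (rule integral_eq_zero_AE) (auto intro: AE_I[where N="{a}"])

text \<open>Local integrability carries measurability with it: the truncations to
  \<open>{0..n}\<close> converge pointwise, each point being eventually constant.\<close>

lemma set_integrable_restrict_measurable:
  fixes h :: "real \<Rightarrow> 'b::euclidean_space"
  assumes "\<And>T. 0 \<le> T \<Longrightarrow> set_integrable lborel {0..T} h"
  shows "h \<in> borel_measurable (restrict_space borel {0..})"
proof -
  have "(\<lambda>s. indicat_real {0..real n} s *\<^sub>R h s) \<in> borel_measurable borel" for n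
    using assms[of "real n"] by (auto simp: set_integrable_def dest: borel_measurable_integrable)
  moreover have "(\<lambda>n. indicat_real {0..real n} s *\<^sub>R h s) \<longlonglongrightarrow> indicat_real {0..} s *\<^sub>R h s" for s
  proof (rule tendsto_eventually)
    show "\<forall>\<^sub>F n in sequentially. indicat_real {0..real n} s *\<^sub>R h s = indicat_real {0..} s *\<^sub>R h s"
      using eventually_ge_at_top[of "nat \<lceil>s\<rceil>"]
      by eventually_elim (auto simp: indicator_def)
  qed
  ultimately have "(\<lambda>s. indicat_real {0..} s *\<^sub>R h s) \<in> borel_measurable borel"
    by (rule borel_measurable_LIMSEQ_metric)
  then show ?thesis by (subst borel_measurable_restrict_space_iff) auto
qed

locale time_change =
  fixes g :: "real \<Rightarrow> real"
  assumes nonneg: "\<And>s. 0 \<le> s \<Longrightarrow> 0 \<le> g s"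
    and loc_integrable: "\<And>s. 0 \<le> s \<Longrightarrow> set_integrable lborel {0..s} g"
    and unbounded: "\<And>B. \<exists>s\<ge>0. B \<le> (LINT u:{0..s}|lborel. g u)"
begin

definition clock :: "real \<Rightarrow> real" where
  "clock s = (LINT u:{0..s}|lborel. g u)"

text \<open>The set is nonempty by \<open>unbounded\<close>. Where \<open>g\<close> vanishes on an
  interval the clock is flat and this generalised inverse jumps, taking the left end of the flat
  piece. It is a right inverse of \<open>clock\<close> on nonnegative times, in general not a left
  inverse.\<close>

definition inv_clock :: "real \<Rightarrow> real" where
  "inv_clock t = Inf {s. 0 \<le> s \<and> t \<le> clock s}"

lemma clock_0 [simp]: "clock 0 = 0"
  by (simp add: clock_def del: atLeastAtMost_singleton)

lemma g_measurable [measurable]: "(\<lambda>s. indicat_real {0..} s * g s) \<in> borel_measurable borel"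
proof -
  have "g \<in> borel_measurable (restrict_space borel {0..})"
    by (rule set_integrable_restrict_measurable) (rule loc_integrable)
  then show ?thesis by (subst (asm) borel_measurable_restrict_space_iff) auto
qed

lemma ennreal_clock:
  assumes "0 \<le> s"
  shows "ennreal (clock s) = (\<integral>\<^sup>+u\<in>{0..s}. ennreal (g u) \<partial>lborel)"
proof -
  have "(\<integral>\<^sup>+u\<in>{0..s}. ennreal (g u) \<partial>lborel)
      = (\<integral>\<^sup>+u. ennreal (indicat_real {0..s} u *\<^sub>R g u) \<partial>lborel)"
    by (rule nn_integral_cong) (simp add: indicator_def)
  also have "\<dots> = ennreal (clock s)"
    unfolding clock_def set_lebesgue_integral_def
  proof (rule nn_integral_eq_integral)
    show "integrable lborel (\<lambda>u. indicat_real {0..s} u *\<^sub>R g u)"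
      using loc_integrable[OF assms] by (simp add: set_integrable_def)
    show "AE u in lborel. 0 \<le> indicat_real {0..s} u *\<^sub>R g u"
      by (rule AE_I2) (simp add: indicator_def nonneg)
  qed
  finally show ?thesis ..
qed

lemma clock_nonneg: "0 \<le> clock s"
  unfolding clock_def set_lebesgue_integral_def
  by (rule Bochner_Integration.integral_nonneg) (auto simp: indicator_def nonneg)

lemma clock_mono:
  assumes "0 \<le> s" "s \<le> s'"
  shows "clock s \<le> clock s'"
  unfolding clock_def set_lebesgue_integral_def
proof (rule integral_mono)
  show "integrable lborel (\<lambda>u. indicat_real {0..s} u *\<^sub>R g u)"
    "integrable lborel (\<lambda>u. indicat_real {0..s'} u *\<^sub>R g u)"
    using loc_integrable[of s] loc_integrable[of s'] assms by (auto simp: set_integrable_def)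
  show "indicat_real {0..s} u *\<^sub>R g u \<le> indicat_real {0..s'} u *\<^sub>R g u" for u
    using assms by (simp add: indicator_def nonneg)
qed

lemma continuous_on_clock: "continuous_on {0..} clock"
  unfolding clock_def by (rule continuous_on_LINT[OF loc_integrable])

text \<open>Continuity of the clock makes the set under the infimum closed, so the infimum is
  attained. This is what makes both inequalities non-strict.\<close>

lemma inv_clock_le_iff:
  assumes "0 \<le> s"
  shows "inv_clock t \<le> s \<longleftrightarrow> t \<le> clock s"
proof -
  define X where "X = {s. 0 \<le> s \<and> t \<le> clock s}"
  have X: "X = {s\<in>{0..}. t \<le> clock s}" by (auto simp: X_def)
  have "closed X" unfolding X
    using continuous_closed_preimage[OF continuous_on_clock closed_atLeast closed_atLeast[of t]]
    by (simp add: Int_def vimage_def)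
  moreover have "X \<noteq> {}" using unbounded[of t] by (auto simp: X_def clock_def)
  moreover have bdd: "bdd_below X" by (auto simp: X_def)
  ultimately have "Inf X \<in> X" by (intro closed_contains_Inf)
  then have "t \<le> clock s" if "Inf X \<le> s"
    using that clock_mono[of "Inf X" s] by (auto simp: X_def)
  moreover have "Inf X \<le> s" if "t \<le> clock s"
    by (rule cInf_lower[OF _ bdd]) (use that assms in \<open>auto simp: X_def\<close>)
  ultimately show ?thesis unfolding inv_clock_def X_def by blast
qed

lemma inv_clock_nonneg [simp]: "0 \<le> inv_clock t"
  unfolding inv_clock_def
  by (rule cInf_greatest) (use unbounded[of t] in \<open>auto simp: clock_def\<close>)

lemma mono_inv_clock: "mono inv_clock"
  by (rule monoI) (meson inv_clock_le_iff inv_clock_nonneg order_refl order_trans)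

lemma inv_clock_measurable [measurable]: "inv_clock \<in> borel_measurable borel"
  by (rule borel_measurable_mono[OF mono_inv_clock])

lemma clock_inv_clock:
  assumes "0 \<le> t"
  shows "clock (inv_clock t) = t"
proof -
  have "t \<le> clock (inv_clock t)"
    using inv_clock_le_iff[of "inv_clock t" t] by simp
  then obtain s where "0 \<le> s" "s \<le> inv_clock t" "clock s = t"
    using IVT'[of clock 0 t "inv_clock t"] assms continuous_on_subset[OF continuous_on_clock]
    by auto
  then show ?thesis using inv_clock_le_iff[of s t] by auto
qed

text \<open>The equivalence \<open>inv_clock t \<le> s \<longleftrightarrow> t \<le> clock s\<close> identifies the two distribution
  functions, so no differentiability of the clock is involved.\<close>

lemma distr_inv_clock:
  "distr (density lborel (indicator {0..})) borel inv_clock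
    = density lborel (\<lambda>s. ennreal (indicat_real {0..} s * g s))"
proof (rule measure_eqI_atMost)
  fix s :: real
  have "emeasure (distr (density lborel (indicator {0..})) borel inv_clock) {..s}
      = emeasure (density lborel (indicator {0..})) (inv_clock -` {..s})"
    by (subst emeasure_distr) auto
  also have "inv_clock -` {..s} = (if 0 \<le> s then {..clock s} else {})"
  proof (cases "0 \<le> s")
    case True
    then show ?thesis using inv_clock_le_iff[of s] by auto
  next
    case False
    then have "\<not> inv_clock t \<le> s" for t using inv_clock_nonneg[of t] by linarith
    then show ?thesis using False by auto
  qed
  also have "emeasure (density lborel (indicator {0..})) \<dots> = (if 0 \<le> s then ennreal (clock s) else 0)"
  proof -
    have "emeasure (density lborel (indicator {0..})) {..clock s} = emeasure lborel ({0..} \<inter> {..clock s})"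
      by (subst emeasure_density) (auto simp: indicator_inter_arith[symmetric])
    also have "{0..} \<inter> {..clock s} = {0..clock s}" by auto
    finally show ?thesis using clock_nonneg[of s] by simp
  qed
  finally have 1: "emeasure (distr (density lborel (indicator {0..})) borel inv_clock) {..s}
    = (if 0 \<le> s then ennreal (clock s) else 0)" .
  have "emeasure (density lborel (\<lambda>s. ennreal (indicat_real {0..} s * g s))) {..s}
      = (\<integral>\<^sup>+u\<in>{..s}. ennreal (indicat_real {0..} u * g u) \<partial>lborel)"
    by (subst emeasure_density) auto
  also have "\<dots> = (\<integral>\<^sup>+u\<in>{0..s}. ennreal (g u) \<partial>lborel)"
    by (auto intro!: nn_integral_cong simp: indicator_def)
  also have "\<dots> = (if 0 \<le> s then ennreal (clock s) else 0)"
    by (auto simp: ennreal_clock)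
  finally have 2: "emeasure (density lborel (\<lambda>s. ennreal (indicat_real {0..} s * g s))) {..s}
    = (if 0 \<le> s then ennreal (clock s) else 0)" .
  show "emeasure (distr (density lborel (indicator {0..})) borel inv_clock) {..s}
      = emeasure (density lborel (\<lambda>s. ennreal (indicat_real {0..} s * g s))) {..s}"
    using 1 2 by simp
  show "emeasure (distr (density lborel (indicator {0..})) borel inv_clock) {..s} \<noteq> \<infinity>"
    using 1 by simp
qed auto

lemma nn_integral_time_change:
  assumes h: "h \<in> borel_measurable (restrict_space borel {0..})"
  shows "(\<integral>\<^sup>+t\<in>{0..}. h (inv_clock t) \<partial>lborel) = (\<integral>\<^sup>+s\<in>{0..}. ennreal (g s) * h s \<partial>lborel)"
proof -
  have h' [measurable]: "(\<lambda>s. h s * indicator {0..} s) \<in> borel_measurable borel"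
    using h by (subst (asm) borel_measurable_restrict_space_iff_ennreal) auto
  have "(\<integral>\<^sup>+t\<in>{0..}. h (inv_clock t) \<partial>lborel)
      = (\<integral>\<^sup>+t. indicator {0..} t * (h (inv_clock t) * indicator {0..} (inv_clock t)) \<partial>lborel)"
    by (auto intro!: nn_integral_cong simp: indicator_def)
  also have "\<dots> = (\<integral>\<^sup>+s. h s * indicator {0..} s
      \<partial>distr (density lborel (indicator {0..})) borel inv_clock)"
    by (subst nn_integral_distr, simp, simp add: h', subst nn_integral_density)
      (use measurable_compose[OF inv_clock_measurable h'] in auto)
  also have "\<dots> = (\<integral>\<^sup>+s. ennreal (indicat_real {0..} s * g s) * (h s * indicator {0..} s) \<partial>lborel)"
    unfolding distr_inv_clock by (subst nn_integral_density) auto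
  also have "\<dots> = (\<integral>\<^sup>+s\<in>{0..}. ennreal (g s) * h s \<partial>lborel)"
    by (auto intro!: nn_integral_cong simp: indicator_def)
  finally show ?thesis .
qed

text \<open>Since \<open>t \<le> clock s\<close> is the same as \<open>inv_clock t \<le> s\<close>,
  the upper limit can be moved into the integrand as a function of
  \<open>inv_clock t\<close>.\<close>

lemma nn_integral_time_change_Icc:
  assumes h: "h \<in> borel_measurable (restrict_space borel {0..})" and "0 \<le> s"
  shows "(\<integral>\<^sup>+t\<in>{0..clock s}. h (inv_clock t) \<partial>lborel) = (\<integral>\<^sup>+u\<in>{0..s}. ennreal (g u) * h u \<partial>lborel)"
proof -
  have "(\<integral>\<^sup>+t\<in>{0..clock s}. h (inv_clock t) \<partial>lborel)
      = (\<integral>\<^sup>+t\<in>{0..}. (h (inv_clock t) * indicator {..s} (inv_clock t)) \<partial>lborel)"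
    using inv_clock_le_iff[OF \<open>0 \<le> s\<close>] by (auto intro!: nn_integral_cong simp: indicator_def)
  also have "\<dots> = (\<integral>\<^sup>+u\<in>{0..}. ennreal (g u) * (h u * indicator {..s} u) \<partial>lborel)"
    by (rule nn_integral_time_change)
      (intro borel_measurable_times_ennreal h measurable_restrict_space1, simp)
  also have "\<dots> = (\<integral>\<^sup>+u\<in>{0..s}. ennreal (g u) * h u \<partial>lborel)"
    by (auto intro!: nn_integral_cong simp: indicator_def)
  finally show ?thesis .
qed

lemma
  fixes h :: "real \<Rightarrow> 'b::euclidean_space"
  assumes h: "h \<in> borel_measurable (restrict_space borel {0..})" and s: "0 \<le> s"
  shows set_integrable_time_change: "set_integrable lborel {0..clock s} (\<lambda>t. h (inv_clock t))
          \<longleftrightarrow> set_integrable lborel {0..s} (\<lambda>u. g u *\<^sub>R h u)" (is ?int)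
    and LINT_time_change: "(LINT t:{0..clock s}|lborel. h (inv_clock t))
          = (LINT u:{0..s}|lborel. g u *\<^sub>R h u)" (is ?LINT)
proof -
  have h' [measurable]: "(\<lambda>s. indicat_real {0..} s *\<^sub>R h s) \<in> borel_measurable borel"
    using h by (subst (asm) borel_measurable_restrict_space_iff) auto
  \<comment> \<open>Both limits of integration are absorbed into \<open>k\<close>, so that the claim
    on a bounded interval becomes an instance of the push-forward identity on the half-line.\<close>
  define k where "k = (\<lambda>u. indicat_real {..s} u *\<^sub>R (indicat_real {0..} u *\<^sub>R h u))"
  have k [measurable]: "k \<in> borel_measurable borel"
    unfolding k_def by measurable
  have 1: "(\<lambda>t. indicat_real {0..clock s} t *\<^sub>R h (inv_clock t))
      = (\<lambda>t. indicat_real {0..} t *\<^sub>R k (inv_clock t))"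
    using inv_clock_le_iff[OF s] by (auto simp: k_def indicator_def fun_eq_iff)
  have 2: "(\<lambda>u. indicat_real {0..s} u *\<^sub>R (g u *\<^sub>R h u)) = (\<lambda>u. (indicat_real {0..} u * g u) *\<^sub>R k u)"
    by (auto simp: k_def indicator_def fun_eq_iff)
  have i: "density lborel (indicator {0..}) = density lborel (\<lambda>x. ennreal (indicat_real {0..} x))"
    by (auto simp: indicator_def intro!: arg_cong[where f="density lborel"])
  have "integrable lborel (\<lambda>t. indicat_real {0..} t *\<^sub>R k (inv_clock t))
     \<longleftrightarrow> integrable (distr (density lborel (indicator {0..})) borel inv_clock) k"
    by (subst integrable_distr_eq, simp, simp, unfold i, subst integrable_density) auto
  also have "\<dots> \<longleftrightarrow> integrable lborel (\<lambda>u. (indicat_real {0..} u * g u) *\<^sub>R k u)"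
    unfolding distr_inv_clock
    by (subst integrable_density) (use nonneg in \<open>auto split: split_indicator\<close>)
  finally show ?int unfolding set_integrable_def 1 2 .
  have "integral\<^sup>L lborel (\<lambda>t. indicat_real {0..} t *\<^sub>R k (inv_clock t))
     = integral\<^sup>L (distr (density lborel (indicator {0..})) borel inv_clock) k"
    by (subst integral_distr, simp, simp, unfold i, subst integral_density) auto
  also have "\<dots> = integral\<^sup>L lborel (\<lambda>u. (indicat_real {0..} u * g u) *\<^sub>R k u)"
    unfolding distr_inv_clock
    by (subst integral_density) (use nonneg in \<open>auto split: split_indicator\<close>)
  finally show ?LINT unfolding set_lebesgue_integral_def 1 2 .
qed

lemma ode_solution_time_change:
  fixes \<xi> :: "real \<Rightarrow> 'b::euclidean_space"
  assumes sol: "ode_solution (\<lambda>s z. g s *\<^sub>R G s z) x \<xi>"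
    and meas: "(\<lambda>s. G s (\<xi> s)) \<in> borel_measurable (restrict_space borel {0..})"
  shows "ode_solution (\<lambda>t. G (inv_clock t)) x (\<lambda>t. \<xi> (inv_clock t))"
proof -
  have *: "set_integrable lborel {0..t} (\<lambda>t. G (inv_clock t) (\<xi> (inv_clock t)))"
     "\<xi> (inv_clock t) = x + (LINT s:{0..t}|lborel. G (inv_clock s) (\<xi> (inv_clock s)))"
    if "0 \<le> t" for t
    using sol set_integrable_time_change[OF meas, of "inv_clock t"]
      LINT_time_change[OF meas, of "inv_clock t"] clock_inv_clock[OF that]
    by (auto simp: ode_solution_def)
  \<comment> \<open>Continuity is read off the integral equation and not off the composition:
    \<open>inv_clock\<close> may jump, but \<open>\<xi>\<close> is constant across the jump because
    \<open>g\<close> vanishes there.\<close>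
  have "continuous_on {0..} (\<lambda>t. x + (LINT s:{0..t}|lborel. G (inv_clock s) (\<xi> (inv_clock s))))"
    by (intro continuous_intros continuous_on_LINT *)
  then have "continuous_on {0..} (\<lambda>t. \<xi> (inv_clock t))"
    by (rule continuous_on_eq) (use * in auto)
  then show ?thesis using * by (auto simp: ode_solution_def)
qed

end

subsection \<open>Caratheodory solutions\<close>

lemma set_integrable_mult_continuous:
  fixes h :: "real \<Rightarrow> 'b::euclidean_space"
  assumes g: "set_integrable lborel {a..b} (g :: real \<Rightarrow> real)" and h: "continuous_on {a..b} h"
  shows "set_integrable lborel {a..b} (\<lambda>s. g s *\<^sub>R h s)"
proof -
  have "bounded (h ` {a..b})"
    by (rule compact_imp_bounded[OF compact_continuous_image[OF h]]) auto
  then obtain B where B: "\<And>s. s \<in> {a..b} \<Longrightarrow> norm (h s) \<le> B"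
    unfolding bounded_iff by blast
  have h': "(\<lambda>s. indicat_real {a..b} s *\<^sub>R h s) \<in> borel_measurable borel"
    using borel_measurable_continuous_on_indicator[OF _ h] by simp
  have "integrable lborel (\<lambda>s. (indicat_real {a..b} s *\<^sub>R g s) *\<^sub>R (indicat_real {a..b} s *\<^sub>R h s))"
  proof (rule Bochner_Integration.integrable_bound)
    show "integrable lborel (\<lambda>s. B * (indicat_real {a..b} s *\<^sub>R g s))"
      using g by (auto simp: set_integrable_def)
    show "(\<lambda>s. (indicat_real {a..b} s *\<^sub>R g s) *\<^sub>R (indicat_real {a..b} s *\<^sub>R h s)) \<in> borel_measurable lborel"
    proof (rule borel_measurable_scaleR)
      show "(\<lambda>s. indicat_real {a..b} s *\<^sub>R g s) \<in> borel_measurable lborel"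
        using g unfolding set_integrable_def by (rule borel_measurable_integrable)
    qed (use h' in simp)
    have "norm (g s *\<^sub>R h s) \<le> norm (B * g s)" if "s \<in> {a..b}" for s
      using mult_right_mono[OF order_trans[OF B[OF that] abs_ge_self], of "\<bar>g s\<bar>"]
      by (simp add: abs_mult mult.commute)
    then show "AE s in lborel. norm ((indicat_real {a..b} s *\<^sub>R g s) *\<^sub>R (indicat_real {a..b} s *\<^sub>R h s))
        \<le> norm (B * (indicat_real {a..b} s *\<^sub>R g s))"
      by (intro AE_I2) (auto split: split_indicator)
  qed
  then show ?thesis unfolding set_integrable_def
    by (rule Bochner_Integration.integrable_cong[THEN iffD1, rotated -1])
      (auto split: split_indicator)
qed

lemma norm_LINT_le:
  fixes h :: "real \<Rightarrow> 'b::euclidean_space"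
  assumes "set_integrable lborel S h" "set_integrable lborel S k" "\<And>s. s \<in> S \<Longrightarrow> norm (h s) \<le> k s"
  shows "norm (LINT s:S|lborel. h s) \<le> (LINT s:S|lborel. k s)"
  unfolding set_lebesgue_integral_def
  by (rule Bochner_Integration.integral_norm_bound_integral)
    (use assms in \<open>auto simp: set_integrable_def split: split_indicator\<close>)

context time_change
begin

lemma set_integrable_exp_clock:
  "set_integrable lborel {0..s} (\<lambda>u. g u * exp (k * clock u))"
proof (cases "0 \<le> s")
  case True
  have "continuous_on {0..s} (\<lambda>u. exp (k * clock u))"
    by (intro continuous_intros continuous_on_subset[OF continuous_on_clock]) auto
  from set_integrable_mult_continuous[OF loc_integrable[OF True] this] show ?thesis by simp
qed (simp add: set_integrable_def)

text \<open>In clock time the integral is that of \<open>exp (k * t)\<close>, so no chain rule for a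
  clock that is differentiable only almost everywhere is involved. The gain is the factor
  \<open>1 / k\<close>: with \<open>k\<close> twice the growth or Lipschitz constant, one
  integration step costs a factor one half.\<close>

lemma LINT_exp_clock_le:
  assumes "0 < k" "0 \<le> s"
  shows "(LINT u:{0..s}|lborel. g u * exp (k * clock u)) \<le> exp (k * clock s) / k"
proof -
  have "(\<lambda>u. exp (k * clock u)) \<in> borel_measurable (restrict_space borel {0..})"
    by (rule borel_measurable_continuous_on_restrict)
      (intro continuous_intros continuous_on_clock)
  from LINT_time_change[OF this \<open>0 \<le> s\<close>]
  have "(LINT u:{0..s}|lborel. g u * exp (k * clock u))
      = (LINT t:{0..clock s}|lborel. exp (k * clock (inv_clock t)))"
    by simp
  also have "\<dots> = (LINT t:{0..clock s}|lborel. exp (k * t))"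
    by (rule set_lebesgue_integral_cong) (auto simp: clock_inv_clock)
  also have "\<dots> = exp (k * clock s) / k - exp (k * 0) / k"
    unfolding set_lebesgue_integral_def real_scaleR_def mult.commute[of "indicat_real _ _"]
    using assms
    by (intro integral_FTC_Icc_real clock_nonneg) (auto intro!: derivative_eq_intros)
  also have "\<dots> \<le> exp (k * clock s) / k" using assms by simp
  finally show ?thesis .
qed

text \<open>Weighted maximum argument: let \<open>m\<close> be the maximum of \<open>u\<close> times
  \<open>exp (- 2 * K * clock)\<close>. The weight makes the integral term at the maximiser at most
  \<open>m / 2\<close>, which is absorbed on the left and gives \<open>m \<le> 2 * a\<close>. The
  two factors 2 are the price for avoiding the sharp form.\<close>

lemma gronwall:
  assumes u: "continuous_on {0..T} u" "\<And>s. s \<in> {0..T} \<Longrightarrow> 0 \<le> u s"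
    and "0 < K" "0 \<le> a"
    and le: "\<And>t. t \<in> {0..T} \<Longrightarrow> u t \<le> a + K * (LINT s:{0..t}|lborel. g s * u s)"
    and t: "t \<in> {0..T}"
  shows "u t \<le> 2 * a * exp (2 * K * clock t)"
proof -
  define v where "v s = u s * exp (- (2 * K * clock s))" for s
  have "continuous_on {0..T} v" unfolding v_def
    by (intro continuous_intros u continuous_on_subset[OF continuous_on_clock]) auto
  then obtain t0 where t0: "t0 \<in> {0..T}" and max: "\<And>s. s \<in> {0..T} \<Longrightarrow> v s \<le> v t0"
    using continuous_attains_sup[of "{0..T}" v] t by fastforce
  define m where "m = v t0"
  have m: "0 \<le> m" using u(2)[OF t0] by (simp add: m_def v_def)
  have um: "u s \<le> m * exp (2 * K * clock s)" if "s \<in> {0..T}" for s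
    using max[OF that] by (simp add: m_def v_def exp_minus field_simps)
  have cu: "continuous_on {0..t0} u" using u(1) by (rule continuous_on_subset) (use t0 in auto)
  have int: "set_integrable lborel {0..t0} g" using loc_integrable t0 by auto
  have "(LINT s:{0..t0}|lborel. g s * u s)
      \<le> (LINT s:{0..t0}|lborel. m * (g s * exp (2 * K * clock s)))"
  proof (rule set_integral_mono)
    show "set_integrable lborel {0..t0} (\<lambda>s. g s * u s)"
      using set_integrable_mult_continuous[OF int cu] by simp
    show "set_integrable lborel {0..t0} (\<lambda>s. m * (g s * exp (2 * K * clock s)))"
      using set_integrable_exp_clock by simp
    fix s assume "s \<in> {0..t0}"
    then have "g s * u s \<le> g s * (m * exp (2 * K * clock s))"
      using t0 by (intro mult_left_mono um nonneg) auto
    then show "g s * u s \<le> m * (g s * exp (2 * K * clock s))" by (simp add: mult_ac)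
  qed
  also have "\<dots> = m * (LINT s:{0..t0}|lborel. g s * exp (2 * K * clock s))" by simp
  also have "\<dots> \<le> m * (exp (2 * K * clock t0) / (2 * K))"
    using LINT_exp_clock_le[of "2 * K" t0] t0 \<open>0 < K\<close> m by (intro mult_left_mono) auto
  finally have "K * (LINT s:{0..t0}|lborel. g s * u s) \<le> K * (m * (exp (2 * K * clock t0) / (2 * K)))"
    using \<open>0 < K\<close> by (intro mult_left_mono) auto
  also have "\<dots> = m / 2 * exp (2 * K * clock t0)" using \<open>0 < K\<close> by (simp add: field_simps)
  finally have "u t0 \<le> a + m / 2 * exp (2 * K * clock t0)" using le[OF t0] by linarith
  then have "u t0 * exp (- (2 * K * clock t0))
      \<le> (a + m / 2 * exp (2 * K * clock t0)) * exp (- (2 * K * clock t0))"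
    by (rule mult_right_mono) simp
  then have "m \<le> a * exp (- (2 * K * clock t0)) + m / 2"
    by (simp add: m_def v_def exp_minus field_simps)
  moreover have "a * exp (- (2 * K * clock t0)) \<le> a * 1"
    using \<open>0 \<le> a\<close> \<open>0 < K\<close> clock_nonneg[of t0] by (intro mult_left_mono) auto
  ultimately have "m \<le> 2 * a" by simp
  then have "m * exp (2 * K * clock t) \<le> 2 * a * exp (2 * K * clock t)"
    by (rule mult_right_mono) simp
  with um[OF t] show ?thesis by linarith
qed

end

text \<open>Growth and Lipschitz bounds carry the weight \<open>g\<close>, so all estimates are in clock time; the locale
  covers ordinary controls with \<open>g = 1 + |\<alpha>|\<^sup>q\<close> and extended ones with \<open>g = 1\<close>.\<close>

locale caratheodory = time_change +
  fixes G :: "real \<Rightarrow> 'x::euclidean_space \<Rightarrow> 'x" and c :: real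
  assumes car_measurable: "\<And>y. continuous_on {0..} y \<Longrightarrow>
      (\<lambda>s. G s (y s)) \<in> borel_measurable (restrict_space borel {0..})"
    and c_pos: "0 < c"
    and car_growth: "\<And>s z. 0 \<le> s \<Longrightarrow> norm (G s z) \<le> c * g s * (1 + norm z)"
    and car_lipschitz: "\<And>R. 0 < R \<Longrightarrow> \<exists>K>0. \<forall>s\<ge>0. \<forall>z\<^sub>1 z\<^sub>2. norm z\<^sub>1 \<le> R \<longrightarrow> norm z\<^sub>2 \<le> R \<longrightarrow>
      norm (G s z\<^sub>1 - G s z\<^sub>2) \<le> K * g s * norm (z\<^sub>1 - z\<^sub>2)"
begin

lemma set_integrable_G:
  assumes y: "continuous_on {0..} y"
  shows "set_integrable lborel {0..T} (\<lambda>s. G s (y s))"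
proof (cases "0 \<le> T")
  case True
  have "continuous_on {0..T} (\<lambda>s. c * (1 + norm (y s)))"
    by (intro continuous_intros continuous_on_subset[OF y]) auto
  from set_integrable_mult_continuous[OF loc_integrable[OF True] this]
  have int: "set_integrable lborel {0..T} (\<lambda>s. g s * (c * (1 + norm (y s))))" by simp
  have m [measurable]: "(\<lambda>s. indicat_real {0..} s *\<^sub>R G s (y s)) \<in> borel_measurable borel"
    using car_measurable[OF y] by (subst (asm) borel_measurable_restrict_space_iff) auto
  have "(\<lambda>s. indicat_real {0..T} s *\<^sub>R (indicat_real {0..} s *\<^sub>R G s (y s))) \<in> borel_measurable borel"
    by measurable
  also have "(\<lambda>s. indicat_real {0..T} s *\<^sub>R (indicat_real {0..} s *\<^sub>R G s (y s)))
      = (\<lambda>s. indicat_real {0..T} s *\<^sub>R G s (y s))"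
    by (auto simp: fun_eq_iff split: split_indicator)
  finally have m': "(\<lambda>s. indicat_real {0..T} s *\<^sub>R G s (y s)) \<in> borel_measurable lborel" by simp
  have *: "norm (G s (y s)) \<le> norm (g s * (c * (1 + norm (y s))))" if "0 \<le> s" for s
    using car_growth[OF that, of "y s"] abs_ge_self[of "g s * (c * (1 + norm (y s)))"]
    by (simp add: mult_ac)
  show ?thesis
    using int unfolding set_integrable_def
    by (rule Bochner_Integration.integrable_bound[OF _ m']) (use * in \<open>auto split: split_indicator\<close>)
qed (simp add: set_integrable_def)

lemma set_integrable_G_Icc:
  assumes y: "continuous_on {0..T} y"
  shows "set_integrable lborel {0..T} (\<lambda>s. G s (y s))"
proof -
  \<comment> \<open>Measurability of \<open>G\<close> along a curve is assumed for curves on the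
    whole half-line, so \<open>y\<close> is frozen at its end values.\<close>
  define z where "z s = y (min T (max 0 s))" for s
  have "set_integrable lborel {0..T} (\<lambda>s. G s (z s))" if "0 \<le> T"
  proof (rule set_integrable_G)
    show "continuous_on {0..} z" unfolding z_def
      by (rule continuous_on_compose2[OF y]) (use that in \<open>auto intro!: continuous_intros\<close>)
  qed
  moreover have "set_integrable lborel {0..T} (\<lambda>s. G s (z s))
      \<longleftrightarrow> set_integrable lborel {0..T} (\<lambda>s. G s (y s))"
    by (rule set_integrable_cong) (auto simp: z_def)
  ultimately show ?thesis by (cases "0 \<le> T") (auto simp: set_integrable_def)
qed

text \<open>The growth bound is linear in \<open>1 + norm y\<close>, so Gronwall is applied to this
  quantity. The equation is needed on \<open>{0..T}\<close> only.\<close>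

lemma solution_bound:
  assumes y: "continuous_on {0..T} y"
    and le: "\<And>t. t \<in> {0..T} \<Longrightarrow> y t = x + (LINT s:{0..t}|lborel. G s (y s))"
    and t: "t \<in> {0..T}"
  shows "1 + norm (y t) \<le> 2 * (1 + norm x) * exp (2 * c * clock t)"
proof -
  have "1 + norm (y t) \<le> (1 + norm x) + c * (LINT s:{0..t}|lborel. g s * (1 + norm (y s)))"
    if t: "t \<in> {0..T}" for t
  proof -
    have yt: "continuous_on {0..t} y" using y by (rule continuous_on_subset) (use t in auto)
    have "continuous_on {0..t} (\<lambda>s. 1 + norm (y s))" by (intro continuous_intros yt)
    from set_integrable_mult_continuous[OF loc_integrable this] t
    have int: "set_integrable lborel {0..t} (\<lambda>s. g s * (1 + norm (y s)))" by auto
    have "norm (LINT s:{0..t}|lborel. G s (y s)) \<le> (LINT s:{0..t}|lborel. c * (g s * (1 + norm (y s))))"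
      using int car_growth by (intro norm_LINT_le set_integrable_G_Icc[OF yt]) (auto simp: mult_ac)
    then have "norm (LINT s:{0..t}|lborel. G s (y s)) \<le> c * (LINT s:{0..t}|lborel. g s * (1 + norm (y s)))"
      by simp
    then show ?thesis
      using le[OF t] norm_triangle_ineq[of x "LINT s:{0..t}|lborel. G s (y s)"] by simp
  qed
  moreover have "continuous_on {0..T} (\<lambda>t. 1 + norm (y t))" by (intro continuous_intros y)
  ultimately show ?thesis using c_pos t by (intro gronwall[of T]) auto
qed

lemma solution_unique:
  assumes y: "ode_solution G x y" and z: "ode_solution G x z" and "0 \<le> t"
  shows "y t = z t"
proof -
  have cont: "continuous_on {0..t} y" "continuous_on {0..t} z"
    using y z by (auto simp: ode_solution_def elim!: continuous_on_subset)
  have "bounded (y ` {0..t} \<union> z ` {0..t})"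
    using cont by (auto intro!: compact_imp_bounded compact_continuous_image)
  then obtain R where R: "R > 0" "\<And>s. s \<in> {0..t} \<Longrightarrow> norm (y s) \<le> R" "\<And>s. s \<in> {0..t} \<Longrightarrow> norm (z s) \<le> R"
    unfolding bounded_pos by auto
  obtain K where K: "K > 0" "\<And>s z\<^sub>1 z\<^sub>2. 0 \<le> s \<Longrightarrow> norm z\<^sub>1 \<le> R \<Longrightarrow> norm z\<^sub>2 \<le> R \<Longrightarrow>
      norm (G s z\<^sub>1 - G s z\<^sub>2) \<le> K * g s * norm (z\<^sub>1 - z\<^sub>2)"
    using car_lipschitz[OF \<open>R > 0\<close>] by blast
  have "norm (y r - z r) \<le> 0 + K * (LINT s:{0..r}|lborel. g s * norm (y s - z s))"
    if r: "r \<in> {0..t}" for r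
  proof -
    have yi: "set_integrable lborel {0..r} (\<lambda>s. G s (y s))" "set_integrable lborel {0..r} (\<lambda>s. G s (z s))"
      using y z r by (auto simp: ode_solution_def)
    have "continuous_on {0..r} (\<lambda>s. norm (y s - z s))"
      by (intro continuous_intros continuous_on_subset[OF cont(1)] continuous_on_subset[OF cont(2)])
        (use r in auto)
    from set_integrable_mult_continuous[OF loc_integrable this] r
    have int: "set_integrable lborel {0..r} (\<lambda>s. g s * norm (y s - z s))" by auto
    have "y r - z r = (LINT s:{0..r}|lborel. G s (y s)) - (LINT s:{0..r}|lborel. G s (z s))"
      using y z r unfolding ode_solution_def by (metis add_diff_cancel_left atLeastAtMost_iff)
    also have "\<dots> = (LINT s:{0..r}|lborel. G s (y s) - G s (z s))"
      using yi by simp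
    finally have "norm (y r - z r) = norm (LINT s:{0..r}|lborel. G s (y s) - G s (z s))" by simp
    also have "\<dots> \<le> (LINT s:{0..r}|lborel. K * (g s * norm (y s - z s)))"
      using int yi K(2) R(2,3) r by (intro norm_LINT_le set_integral_diff) (auto simp: mult_ac)
    finally show ?thesis by simp
  qed
  moreover have "continuous_on {0..t} (\<lambda>s. norm (y s - z s))" by (intro continuous_intros cont)
  ultimately have "norm (y t - z t) \<le> 2 * 0 * exp (2 * K * clock t)"
    using K(1) \<open>0 \<le> t\<close> by (intro gronwall[of t]) auto
  then show ?thesis by simp
qed

text \<open>Picard iteration. The Lipschitz constant is only local, so the iterates are first
  confined by a bound \<open>\<beta>\<close> independent of \<open>n\<close>; on each
  \<open>{0..T}\<close> they then contract in an exponentially weighted norm, which gives a global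
  solution without gluing local ones.\<close>

lemma solution_exists: "\<exists>y. ode_solution G x y"
proof -
  define P where "P y t = x + (LINT s:{0..t}|lborel. G s (y s))" for y :: "real \<Rightarrow> 'x" and t
  define Y where "Y n = (P ^^ n) (\<lambda>_. x)" for n
  have Y_0: "Y 0 = (\<lambda>_. x)" and Y_Suc: "Y (Suc n) = P (Y n)" for n
    by (auto simp: Y_def)
  \<comment> \<open>The choice makes the bound \<open>\<beta>\<close> invariant under the Picard
    map: \<open>1 + norm x\<close> takes at most half of \<open>\<beta> t\<close>, and the doubled
    exponent leaves exactly the other half to the integral term.\<close>
  define B where "B = 2 * (1 + norm x)"
  define \<beta> where "\<beta> t = B * exp (2 * c * clock t)" for t
  have \<beta>_mono: "\<beta> s \<le> \<beta> t" if "0 \<le> s" "s \<le> t" for s t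
    unfolding \<beta>_def B_def using clock_mono[OF that] c_pos by (intro mult_left_mono) auto
  have exp1: "1 \<le> exp (2 * c * clock t)" for t
    using clock_nonneg[of t] c_pos by simp
  have \<beta>_ge: "2 * (1 + norm x) \<le> \<beta> t" for t
    using mult_left_mono[OF exp1[of t], of "2 * (1 + norm x)"] by (simp add: \<beta>_def B_def)
  have P_cont: "continuous_on {0..} (P y)" if "continuous_on {0..} y" for y
    unfolding P_def by (intro continuous_intros continuous_on_LINT set_integrable_G that)
  have Y_cont: "continuous_on {0..} (Y n)" for n
    by (induction n) (auto simp: Y_0 Y_Suc intro!: P_cont)
  have Y_bound: "1 + norm (Y n t) \<le> \<beta> t" if "0 \<le> t" for n t
    using that
  proof (induction n arbitrary: t)
    case 0
    have "1 + norm x \<le> 2 * (1 + norm x)" by simp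
    then show ?case using \<beta>_ge[of t] unfolding Y_0 by (rule order_trans)
  next
    case (Suc n)
    have "norm (LINT s:{0..t}|lborel. G s (Y n s)) \<le> (LINT s:{0..t}|lborel. c * B * (g s * exp (2 * c * clock s)))"
    proof (rule norm_LINT_le)
      show "set_integrable lborel {0..t} (\<lambda>s. G s (Y n s))"
        by (rule set_integrable_G[OF Y_cont])
      show "set_integrable lborel {0..t} (\<lambda>s. c * B * (g s * exp (2 * c * clock s)))"
        using set_integrable_exp_clock by simp
      fix s assume "s \<in> {0..t}"
      then have s: "0 \<le> s" by simp
      have "norm (G s (Y n s)) \<le> c * g s * (1 + norm (Y n s))" by (rule car_growth[OF s])
      also have "\<dots> \<le> c * g s * \<beta> s"
        using Suc.IH[OF s] nonneg[OF s] c_pos by (intro mult_left_mono) auto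
      finally show "norm (G s (Y n s)) \<le> c * B * (g s * exp (2 * c * clock s))"
        by (simp add: \<beta>_def mult_ac)
    qed
    also have "\<dots> = c * B * (LINT s:{0..t}|lborel. g s * exp (2 * c * clock s))" by simp
    also have "\<dots> \<le> c * B * (exp (2 * c * clock t) / (2 * c))"
      using LINT_exp_clock_le[of "2 * c" t] c_pos Suc.prems
      by (intro mult_left_mono) (auto simp: B_def)
    also have "\<dots> = \<beta> t / 2" using c_pos by (simp add: \<beta>_def)
    finally have "norm (Y (Suc n) t) \<le> norm x + \<beta> t / 2"
      unfolding Y_Suc P_def by (meson add_left_mono norm_triangle_ineq order_trans)
    then have "1 + norm (Y (Suc n) t) \<le> \<beta> t" using \<beta>_ge[of t] by simp
    then show ?case .
  qed
  have unif: "uniformly_convergent_on {0..T} Y" if "0 \<le> T" for T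
  proof -
    have "0 < \<beta> T" unfolding \<beta>_def B_def by (auto intro!: mult_pos_pos add_pos_nonneg)
    from car_lipschitz[OF this] obtain K where K: "K > 0" "\<And>s z\<^sub>1 z\<^sub>2. 0 \<le> s \<Longrightarrow> norm z\<^sub>1 \<le> \<beta> T \<Longrightarrow> norm z\<^sub>2 \<le> \<beta> T \<Longrightarrow>
        norm (G s z\<^sub>1 - G s z\<^sub>2) \<le> K * g s * norm (z\<^sub>1 - z\<^sub>2)"
      by blast
    have Y_le: "norm (Y n t) \<le> \<beta> T" if "t \<in> {0..T}" for n t
      using Y_bound[of t n] \<beta>_mono[of t T] that by simp
    \<comment> \<open>With the weight \<open>exp (2 * K * clock t)\<close> every Picard step halves
      the distance of consecutive iterates, for the constant \<open>K\<close> valid on the ball of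
      radius \<open>\<beta> T\<close>.\<close>
    have diff: "norm (Y (Suc n) t - Y n t) \<le> 2 * \<beta> T * (1/2) ^ n * exp (2 * K * clock t)"
      if "t \<in> {0..T}" for n t
      using that
    proof (induction n arbitrary: t)
      case 0
      have "norm (Y (Suc 0) t - Y 0 t) \<le> 2 * \<beta> T * 1"
        using Y_le[OF 0, of "Suc 0"] Y_le[OF 0, of 0] norm_triangle_ineq4[of "Y (Suc 0) t" "Y 0 t"] by linarith
      also have "\<dots> \<le> 2 * \<beta> T * exp (2 * K * clock t)"
        using \<open>0 < \<beta> T\<close> K(1) clock_nonneg[of t] by (intro mult_left_mono) auto
      finally show ?case by simp
    next
      case (Suc n)
      define D where "D = 2 * \<beta> T * (1/2) ^ n"
      have "0 \<le> D" using \<open>0 < \<beta> T\<close> by (simp add: D_def)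
      have "Y (Suc (Suc n)) t - Y (Suc n) t
          = (LINT s:{0..t}|lborel. G s (Y (Suc n) s) - G s (Y n s))"
        unfolding Y_Suc[of "Suc n"] Y_Suc[of n] P_def[of "Y (Suc n)" t, unfolded Y_Suc] P_def[of "Y n" t]
        using set_integrable_G[OF Y_cont[of "Suc n"]] set_integrable_G[OF Y_cont[of n]]
        by (simp add: Y_Suc)
      also have "norm \<dots> \<le> (LINT s:{0..t}|lborel. K * D * (g s * exp (2 * K * clock s)))"
      proof (rule norm_LINT_le)
        show "set_integrable lborel {0..t} (\<lambda>s. G s (Y (Suc n) s) - G s (Y n s))"
          by (intro set_integral_diff set_integrable_G Y_cont)
        show "set_integrable lborel {0..t} (\<lambda>s. K * D * (g s * exp (2 * K * clock s)))"
          using set_integrable_exp_clock by simp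
        fix s assume s: "s \<in> {0..t}"
        then have sT: "s \<in> {0..T}" using Suc.prems by auto
        have "norm (G s (Y (Suc n) s) - G s (Y n s)) \<le> K * g s * norm (Y (Suc n) s - Y n s)"
          using s by (intro K(2) Y_le sT) auto
        also have "\<dots> \<le> K * g s * (D * exp (2 * K * clock s))"
          unfolding D_def using s K(1) nonneg by (intro mult_left_mono Suc.IH sT) auto
        finally show "norm (G s (Y (Suc n) s) - G s (Y n s)) \<le> K * D * (g s * exp (2 * K * clock s))"
          by (simp add: mult_ac)
      qed
      also have "\<dots> = K * D * (LINT s:{0..t}|lborel. g s * exp (2 * K * clock s))" by simp
      also have "\<dots> \<le> K * D * (exp (2 * K * clock t) / (2 * K))"
        using LINT_exp_clock_le[of "2 * K" t] K(1) Suc.prems \<open>0 \<le> D\<close>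
        by (intro mult_left_mono) auto
      also have "\<dots> = D / 2 * exp (2 * K * clock t)" using K(1) by simp
      finally show ?case by (simp add: D_def)
    qed
    have "uniformly_convergent_on {0..T} (\<lambda>n t. \<Sum>i<n. Y (Suc i) t - Y i t)"
    proof (rule Weierstrass_m_test')
      show "norm (Y (Suc n) t - Y n t) \<le> 2 * \<beta> T * exp (2 * K * clock T) * (1/2) ^ n"
        if "t \<in> {0..T}" for n t
      proof -
        have "2 * \<beta> T * (1/2) ^ n * exp (2 * K * clock t) \<le> 2 * \<beta> T * (1/2) ^ n * exp (2 * K * clock T)"
          using \<open>0 < \<beta> T\<close> K(1) clock_mono[of t T] that by (intro mult_left_mono) auto
        with diff[OF that, of n] show ?thesis by (simp add: mult_ac)
      qed
      show "summable (\<lambda>n. 2 * \<beta> T * exp (2 * K * clock T) * (1/2) ^ n)"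
        by (intro summable_mult summable_geometric) simp
    qed
    moreover have "(\<Sum>i<n. Y (Suc i) t - Y i t) = Y n t - x" for n t
      using sum_lessThan_telescope[of "\<lambda>i. Y i t" n] by (simp add: Y_0)
    ultimately have "uniformly_convergent_on {0..T} (\<lambda>n t. Y n t - x)" by simp
    then obtain h where "uniform_limit {0..T} (\<lambda>n t. Y n t - x) h sequentially"
      by (auto simp: uniformly_convergent_on_def)
    then have "uniform_limit {0..T} (\<lambda>n t. (Y n t - x) + x) (\<lambda>t. h t + x) sequentially"
      by (intro uniform_limit_intros)
    then show ?thesis by (auto simp: uniformly_convergent_on_def)
  qed
  \<comment> \<open>Defined as a pointwise limit, so that one and the same \<open>y\<close> serves
    all horizons \<open>T\<close>.\<close>
  define y where "y t = lim (\<lambda>n. Y n t)" for t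
  have ulim: "uniform_limit {0..T} Y y sequentially" if "0 \<le> T" for T
    using unif[OF that] unfolding uniformly_convergent_uniform_limit_iff y_def .
  have lim: "(\<lambda>n. Y n t) \<longlonglongrightarrow> y t" if "0 \<le> t" for t
    using tendsto_uniform_limitI[OF ulim[OF that], of t] that by simp
  have y_cont: "continuous_on {0..} y"
  proof (rule continuous_on_atLeast_if_atLeastAtMost)
    fix T :: real assume "0 \<le> T"
    show "continuous_on {0..T} y"
      by (rule uniform_limit_theorem[OF _ ulim[OF \<open>0 \<le> T\<close>]])
        (auto intro!: always_eventually continuous_on_subset[OF Y_cont])
  qed
  have y_bound: "norm (y t) \<le> \<beta> t" if "0 \<le> t" for t
  proof (rule LIMSEQ_le_const2[OF tendsto_norm[OF lim[OF that]]])
    have "norm (Y n t) \<le> \<beta> t" for n using Y_bound[OF that, of n] by simp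
    then show "\<exists>N. \<forall>n\<ge>N. norm (Y n t) \<le> \<beta> t" by blast
  qed
  have G_lim: "(\<lambda>n. G s (Y n s)) \<longlonglongrightarrow> G s (y s)" if s: "0 \<le> s" for s
  proof -
    have "0 < \<beta> s" unfolding \<beta>_def B_def by (auto intro!: mult_pos_pos add_pos_nonneg)
    from car_lipschitz[OF this] obtain K where K: "K > 0" "\<And>z\<^sub>1 z\<^sub>2. norm z\<^sub>1 \<le> \<beta> s \<Longrightarrow> norm z\<^sub>2 \<le> \<beta> s \<Longrightarrow>
        norm (G s z\<^sub>1 - G s z\<^sub>2) \<le> K * g s * norm (z\<^sub>1 - z\<^sub>2)"
      using s by blast
    have "(\<lambda>n. K * g s * norm (Y n s - y s)) \<longlonglongrightarrow> K * g s * norm (y s - y s)"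
      by (intro tendsto_intros lim s)
    then have l0: "(\<lambda>n. K * g s * norm (Y n s - y s)) \<longlonglongrightarrow> 0" by simp
    have "norm (Y n s) \<le> \<beta> s" for n using Y_bound[OF s, of n] by simp
    then have "\<forall>n. norm (G s (Y n s) - G s (y s)) \<le> K * g s * norm (Y n s - y s)"
      using y_bound[OF s] by (intro allI K(2))
    then have "(\<lambda>n. G s (Y n s) - G s (y s)) \<longlonglongrightarrow> 0"
      by (intro Lim_null_comparison[OF always_eventually l0])
    then show ?thesis by (simp add: LIM_zero_iff)
  qed
  have "y t = x + (LINT s:{0..t}|lborel. G s (y s))" if t: "0 \<le> t" for t
  proof -
    have "(\<lambda>n. LINT s:{0..t}|lborel. G s (Y n s)) \<longlonglongrightarrow> (LINT s:{0..t}|lborel. G s (y s))"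
      unfolding set_lebesgue_integral_def
    proof (rule integral_dominated_convergence)
      show "integrable lborel (\<lambda>s. indicat_real {0..t} s *\<^sub>R (c * \<beta> t * g s))"
        using loc_integrable[OF t] unfolding set_integrable_def[symmetric] by simp
      show "(\<lambda>s. indicat_real {0..t} s *\<^sub>R G s (y s)) \<in> borel_measurable lborel"
        "\<And>n. (\<lambda>s. indicat_real {0..t} s *\<^sub>R G s (Y n s)) \<in> borel_measurable lborel"
        using set_integrable_G[OF y_cont] set_integrable_G[OF Y_cont]
        unfolding set_integrable_def by (meson borel_measurable_integrable)+
      show "AE s in lborel. (\<lambda>n. indicat_real {0..t} s *\<^sub>R G s (Y n s))
          \<longlonglongrightarrow> indicat_real {0..t} s *\<^sub>R G s (y s)"
        using G_lim by (intro AE_I2) (auto split: split_indicator)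
      fix n
      have "norm (G s (Y n s)) \<le> c * \<beta> t * g s" if s: "s \<in> {0..t}" for s
      proof -
        have "norm (G s (Y n s)) \<le> c * g s * (1 + norm (Y n s))" by (rule car_growth) (use s in auto)
        also have "\<dots> \<le> c * g s * \<beta> t"
          using Y_bound[of s n] \<beta>_mono[of s t] nonneg[of s] c_pos s by (intro mult_left_mono) auto
        finally show ?thesis by (simp add: mult_ac)
      qed
      then show "AE s in lborel. norm (indicat_real {0..t} s *\<^sub>R G s (Y n s))
          \<le> indicat_real {0..t} s *\<^sub>R (c * \<beta> t * g s)"
        by (intro AE_I2) (auto split: split_indicator)
    qed
    then have "(\<lambda>n. Y (Suc n) t) \<longlonglongrightarrow> x + (LINT s:{0..t}|lborel. G s (y s))"
      unfolding Y_Suc P_def by (intro tendsto_intros)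
    with LIMSEQ_Suc[OF lim[OF t]] show ?thesis by (rule LIMSEQ_unique)
  qed
  with y_cont set_integrable_G[OF y_cont] show ?thesis
    unfolding ode_solution_def by blast
qed

end

subsection \<open>The extended data\<close>

lemma ode_solution_cong:
  assumes "\<And>s z. 0 \<le> s \<Longrightarrow> g s z = h s z"
  shows "ode_solution g x y \<longleftrightarrow> ode_solution h x y"
proof -
  have "set_integrable lborel {0..t} (\<lambda>s. g s (y s)) \<longleftrightarrow> set_integrable lborel {0..t} (\<lambda>s. h s (y s))" for t
    by (rule set_integrable_cong) (auto simp: assms)
  moreover have "(LINT s:{0..t}|lborel. g s (y s)) = (LINT s:{0..t}|lborel. h s (y s))" for t
    by (rule set_lebesgue_integral_cong) (auto simp: assms)
  ultimately show ?thesis unfolding ode_solution_def by simp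
qed

lemma measurable_continuous_on_compose:
  assumes "continuous_on X h" "k \<in> borel_measurable N" "k ` space N \<subseteq> X"
  shows "(\<lambda>s. h (k s)) \<in> borel_measurable N"
  using measurable_compose[OF measurable_restrict_space2[of k N X borel]
      borel_measurable_continuous_on_restrict[OF assms(1)]] assms(2,3)
  by auto

lemma ext_controls_iff:
  "(w\<^sub>0, w) \<in> ext_controls q A \<longleftrightarrow>
     w\<^sub>0 \<in> borel_measurable (restrict_space borel {0..}) \<and>
     w \<in> borel_measurable (restrict_space borel {0..}) \<and>
     (\<forall>s\<ge>0. (w\<^sub>0 s, w s) \<in> ext_control_set q A)"
proof -
  have "fst \<in> borel_measurable borel" "snd \<in> borel_measurable borel"
    by (auto intro!: borel_measurable_continuous_onI continuous_intros)
  then show ?thesis unfolding ext_controls_def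
    by (auto dest: measurable_compose[OF _ \<open>fst \<in> _\<close>] measurable_compose[OF _ \<open>snd \<in> _\<close>])
qed

lemma set_integrable_bounded_Icc:
  fixes h :: "real \<Rightarrow> 'b::euclidean_space"
  assumes h: "h \<in> borel_measurable (restrict_space borel {0..})"
    and B: "\<And>s. 0 \<le> s \<Longrightarrow> norm (h s) \<le> B"
  shows "set_integrable lborel {0..T} h"
proof -
  have "(\<lambda>s. indicat_real {0..} s *\<^sub>R h s) \<in> borel_measurable borel"
    using h by (subst (asm) borel_measurable_restrict_space_iff) auto
  then have "(\<lambda>s. indicat_real {0..T} s *\<^sub>R (indicat_real {0..} s *\<^sub>R h s)) \<in> borel_measurable lborel"
    by measurable
  also have "(\<lambda>s. indicat_real {0..T} s *\<^sub>R (indicat_real {0..} s *\<^sub>R h s))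
      = (\<lambda>s. indicat_real {0..T} s *\<^sub>R h s)"
    by (auto simp: fun_eq_iff split: split_indicator)
  finally have m: "(\<lambda>s. indicat_real {0..T} s *\<^sub>R h s) \<in> borel_measurable lborel" .
  have "set_integrable lborel {0..T} (\<lambda>_. B)"
    by (intro borel_integrable_atLeastAtMost') auto
  then show ?thesis unfolding set_integrable_def
  proof (rule Bochner_Integration.integrable_bound[OF _ m])
    have "norm (indicat_real {0..T} s *\<^sub>R h s) \<le> norm (indicat_real {0..T} s *\<^sub>R B)" for s
      using order_trans[OF B abs_ge_self, of s] by (auto split: split_indicator)
    then show "AE s in lborel. norm (indicat_real {0..T} s *\<^sub>R h s) \<le> norm (indicat_real {0..T} s *\<^sub>R B)"
      by simp
  qed
qed

text \<open>A positive sequence tending to \<open>w\<^sub>0\<close>, along which non-strict bounds on \<open>f\<close> and \<open>l\<close> pass to their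
  extensions.\<close>

definition level_seq :: "real \<Rightarrow> nat \<Rightarrow> real" where
  "level_seq w\<^sub>0 n = (if w\<^sub>0 = 0 then inverse (real (Suc n)) else w\<^sub>0)"

lemma level_seq_LIMSEQ: "level_seq w\<^sub>0 \<longlonglongrightarrow> w\<^sub>0"
  unfolding level_seq_def using LIMSEQ_inverse_real_of_nat by (cases "w\<^sub>0 = 0") auto

lemma level_seq_pos: "0 \<le> w\<^sub>0 \<Longrightarrow> 0 < level_seq w\<^sub>0 n"
  unfolding level_seq_def by auto

lemma level_seq_le_1: "w\<^sub>0 \<le> 1 \<Longrightarrow> level_seq w\<^sub>0 n \<le> 1"
  unfolding level_seq_def by (auto simp: inverse_le_1_iff)

lemma extend_LIMSEQ:
  assumes "recession_limit q A \<Phi> \<Phi>inf" "w \<in> A"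
  shows "(\<lambda>n. level_seq w\<^sub>0 n ^ q *\<^sub>R \<Phi> x (inverse (level_seq w\<^sub>0 n) *\<^sub>R w))
    \<longlonglongrightarrow> extend q \<Phi> \<Phi>inf x w\<^sub>0 w"
proof (cases "w\<^sub>0 = 0")
  case True
  have "\<And>K. compact K \<and> K \<subseteq> UNIV \<times> A \<Longrightarrow>
      uniform_limit K (\<lambda>\<rho> (x, a). \<rho> ^ q *\<^sub>R \<Phi> x (inverse \<rho> *\<^sub>R a)) (\<lambda>(x, a). \<Phi>inf x a) (at_right 0)"
    using assms(1) by (simp only: recession_limit_def)
  \<comment> \<open>Pointwise convergence is enough here, so the compact set is a single
    point.\<close>
  from this[of "{(x, w)}"]
  have "uniform_limit {(x, w)} (\<lambda>\<rho> (x, a). \<rho> ^ q *\<^sub>R \<Phi> x (inverse \<rho> *\<^sub>R a))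
      (\<lambda>(x, a). \<Phi>inf x a) (at_right 0)"
    using assms(2) by simp
  from tendsto_uniform_limitI[OF this, of "(x, w)"]
  have "((\<lambda>\<rho>. \<rho> ^ q *\<^sub>R \<Phi> x (inverse \<rho> *\<^sub>R w)) \<longlongrightarrow> \<Phi>inf x w) (at_right 0)" by simp
  moreover have "filterlim (level_seq w\<^sub>0) (at_right 0) sequentially"
    using level_seq_LIMSEQ[of w\<^sub>0] level_seq_pos[of w\<^sub>0] True
    by (intro tendsto_imp_filterlim_at_right) auto
  ultimately have "((\<lambda>n. (\<lambda>\<rho>. \<rho> ^ q *\<^sub>R \<Phi> x (inverse \<rho> *\<^sub>R w)) (level_seq w\<^sub>0 n)) \<longlongrightarrow> \<Phi>inf x w) sequentially"
    by (rule filterlim_compose)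
  then show ?thesis using True by (simp add: extend_def)
qed (simp add: extend_def level_seq_def)

lemma LINT_const_1: "0 \<le> s \<Longrightarrow> (LINT u:{0..s::real}|lborel. (1::real)) = s"
  by (simp add: set_lebesgue_integral_def)

lemma time_change_1: "time_change (\<lambda>_. 1)"
proof
  show "set_integrable lborel {0..s} (\<lambda>_. 1 :: real)" for s :: real
    by (intro borel_integrable_atLeastAtMost') auto
  show "\<exists>s\<ge>0. B \<le> (LINT u:{0..s::real}|lborel. (1::real))" for B :: real
  proof (intro exI conjI)
    show "0 \<le> max 0 B" by simp
    show "B \<le> (LINT u:{0..max 0 B}|lborel. (1::real))" using LINT_const_1[of "max 0 B"] by simp
  qed
qed simp

lemma clock_1: "0 \<le> s \<Longrightarrow> time_change.clock (\<lambda>_. 1) s = s"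
  by (simp add: time_change.clock_def[OF time_change_1] set_lebesgue_integral_def)

section \<open>Growth, Lipschitz and coercivity bounds for the extended data\<close>

locale control_data =
  fixes A :: "'a::euclidean_space set"
    and f finf :: "'x::euclidean_space \<Rightarrow> 'a \<Rightarrow> 'x"
    and l linf :: "'x \<Rightarrow> 'a \<Rightarrow> real"
    and p q :: nat
    and M C\<^sub>1 C\<^sub>2 :: real
    and Lip Bnd :: "real \<Rightarrow> real"
    and \<omega> :: "real \<Rightarrow> real \<Rightarrow> real"
  assumes A: "closed A" "cone A" "0 \<in> A" "A \<noteq> {0}"
    and f_cont: "continuous_on (UNIV \<times> A) (\<lambda>(x, a). f x a)"
    and l_cont: "continuous_on (UNIV \<times> A) (\<lambda>(x, a). l x a)"
    and pq: "1 \<le> p" "p \<le> q"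
    and pos: "0 < M" "\<And>R. 0 < R \<Longrightarrow> 0 < Lip R" "\<And>R. 0 < R \<Longrightarrow> 0 < Bnd R"
    and \<omega>: "modulus \<omega>"
    and f_lip: "\<And>R a x\<^sub>1 x\<^sub>2. 0 < R \<Longrightarrow> a \<in> A \<Longrightarrow> norm x\<^sub>1 \<le> R \<Longrightarrow> norm x\<^sub>2 \<le> R \<Longrightarrow>
      norm (f x\<^sub>1 a - f x\<^sub>2 a) \<le> Lip R * (1 + norm a ^ p) * norm (x\<^sub>1 - x\<^sub>2)"
    and l_mod: "\<And>R a x\<^sub>1 x\<^sub>2. 0 < R \<Longrightarrow> a \<in> A \<Longrightarrow> norm x\<^sub>1 \<le> R \<Longrightarrow> norm x\<^sub>2 \<le> R \<Longrightarrow>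
      \<bar>l x\<^sub>1 a - l x\<^sub>2 a\<bar> \<le> (1 + norm a ^ q) * \<omega> (norm (x\<^sub>1 - x\<^sub>2)) R"
    and l_bnd: "\<And>R a x. 0 < R \<Longrightarrow> a \<in> A \<Longrightarrow> norm x \<le> R \<Longrightarrow>
      0 \<le> l x a \<and> l x a \<le> Bnd R * (1 + norm a ^ q)"
    and f_growth: "\<And>x a. a \<in> A \<Longrightarrow> norm (f x a) \<le> M * (1 + norm a ^ p) * (1 + norm x)"
    and C: "0 \<le> C\<^sub>1" "0 < C\<^sub>2"
    and l_coercive: "\<And>x a. a \<in> A \<Longrightarrow> C\<^sub>2 * norm a ^ q - C\<^sub>1 \<le> l x a"
    and finf: "recession_limit q A f finf"
    and linf: "recession_limit q A l linf"
begin

abbreviation "F \<equiv> extend q f finf"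
abbreviation "L \<equiv> extend q l linf"
abbreviation "\<Gamma> \<equiv> ext_controls q A"
abbreviation "J \<equiv> ext_cost F L"
abbreviation "\<xi> \<equiv> ext_traj F"

lemma q_pos: "0 < q" using pq by simp

lemma scale_in_A: "a \<in> A \<Longrightarrow> 0 \<le> c \<Longrightarrow> c *\<^sub>R a \<in> A"
  using mem_cone[OF A(2)] by blast

lemma l_nonneg: "a \<in> A \<Longrightarrow> 0 \<le> l x a"
  using l_bnd[of "norm x + 1" a x] by (simp add: add_nonneg_pos)

lemma control_setD:
  assumes "(w\<^sub>0, w) \<in> ext_control_set q A"
  shows "0 \<le> w\<^sub>0" "w \<in> A" "w\<^sub>0 ^ q + norm w ^ q = 1" "w\<^sub>0 \<le> 1" "norm w \<le> 1"
    "w\<^sub>0 ^ q \<le> 1" "norm w ^ q \<le> 1"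
proof -
  show *: "0 \<le> w\<^sub>0" "w \<in> A" "w\<^sub>0 ^ q + norm w ^ q = 1"
    using assms by (auto simp: ext_control_set_def)
  moreover have "0 \<le> w\<^sub>0 ^ q" "0 \<le> norm w ^ q" using * by auto
  with *(3) show "w\<^sub>0 ^ q \<le> 1" "norm w ^ q \<le> 1" by linarith+
  ultimately show "w\<^sub>0 \<le> 1" "norm w \<le> 1"
    using q_pos power_le_one_iff[of w\<^sub>0 q] power_le_one_iff[of "norm w" q] by auto
qed

text \<open>This is the reason for the normalisation of extended controls: rescaling turns the
  weight of order \<open>q\<close> into \<open>r ^ q + norm a ^ q\<close>, which is 1 on the control
  set.\<close>

lemma scaled_q_weight:
  assumes "0 < r"
  shows "r ^ q * (1 + norm (inverse r *\<^sub>R a) ^ q) = r ^ q + norm a ^ q"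
  using assms by (simp add: power_mult_distrib field_simps)

text \<open>Here \<open>p \<le> q\<close> enters: the leftover power \<open>r ^ (q - p)\<close> is
  at most 1. The bound 2 is the factor in front of \<open>M\<close> and \<open>Lip R\<close> in all
  later estimates.\<close>

lemma scaled_p_weight:
  assumes "0 < r" "r \<le> 1" "norm a \<le> 1"
  shows "r ^ q * (1 + norm (inverse r *\<^sub>R a) ^ p) \<le> 2"
proof -
  have "r ^ q * norm (inverse r *\<^sub>R a) ^ p = r ^ (q - p) * norm a ^ p"
    using assms pq by (simp add: power_mult_distrib power_diff field_simps)
  also have "\<dots> \<le> 1 * 1"
    using assms by (intro mult_mono power_le_one) auto
  finally have "r ^ q * norm (inverse r *\<^sub>R a) ^ p \<le> 1" by simp
  moreover have "r ^ q \<le> 1" using assms by (intro power_le_one) auto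
  ultimately show ?thesis by (simp add: algebra_simps)
qed

text \<open>Lets the single clock with density \<open>1 + norm \<alpha> ^ q\<close> control the
  dynamics, whose weight has order \<open>p\<close>, as well as the cost.\<close>

lemma p_weight_le:
  fixes r :: real
  assumes "0 \<le> r"
  shows "1 + r ^ p \<le> 2 * (1 + r ^ q)"
proof (cases "r \<le> 1")
  case True
  then have "r ^ p \<le> 1" using assms by (intro power_le_one) auto
  then show ?thesis using zero_le_power[OF assms, of q] by simp
next
  case False
  then have "r ^ p \<le> r ^ q" using pq by (intro power_increasing) auto
  then show ?thesis using zero_le_power[OF assms, of q] by simp
qed

lemmas F_LIMSEQ = extend_LIMSEQ[OF finf]
lemmas L_LIMSEQ = extend_LIMSEQ[OF linf]

lemma weight_LIMSEQ:
  assumes "(w\<^sub>0, w) \<in> ext_control_set q A"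
  shows "(\<lambda>n. level_seq w\<^sub>0 n ^ q + norm w ^ q) \<longlonglongrightarrow> 1"
  using tendsto_add[OF tendsto_power[OF level_seq_LIMSEQ[of w\<^sub>0], of q] tendsto_const[of "norm w ^ q"]]
    control_setD(3)[OF assms] by simp

lemma F_growth:
  assumes w: "(w\<^sub>0, w) \<in> ext_control_set q A"
  shows "norm (F z w\<^sub>0 w) \<le> 2 * M * (1 + norm z)"
proof (rule LIMSEQ_le_const2[OF tendsto_norm[OF F_LIMSEQ[OF control_setD(2)[OF w]]]], intro exI allI impI)
  fix n
  define r where "r = level_seq w\<^sub>0 n"
  have r: "0 < r" "r \<le> 1" using level_seq_pos level_seq_le_1 control_setD[OF w] by (auto simp: r_def)
  have "norm (r ^ q *\<^sub>R f z (inverse r *\<^sub>R w)) = r ^ q * norm (f z (inverse r *\<^sub>R w))"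
    using r by simp
  also have "\<dots> \<le> r ^ q * (M * (1 + norm (inverse r *\<^sub>R w) ^ p) * (1 + norm z))"
    using r control_setD[OF w] by (intro mult_left_mono f_growth scale_in_A) auto
  also have "\<dots> = (r ^ q * (1 + norm (inverse r *\<^sub>R w) ^ p)) * (M * (1 + norm z))" by (simp add: mult_ac)
  also have "\<dots> \<le> 2 * (M * (1 + norm z))"
    using r control_setD[OF w] pos(1) by (intro mult_right_mono scaled_p_weight) auto
  finally show "norm (r ^ q *\<^sub>R f z (inverse r *\<^sub>R w)) \<le> 2 * M * (1 + norm z)" by simp
qed

lemma F_lipschitz:
  assumes w: "(w\<^sub>0, w) \<in> ext_control_set q A" and R: "0 < R" "norm z\<^sub>1 \<le> R" "norm z\<^sub>2 \<le> R"
  shows "norm (F z\<^sub>1 w\<^sub>0 w - F z\<^sub>2 w\<^sub>0 w) \<le> 2 * Lip R * norm (z\<^sub>1 - z\<^sub>2)"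
proof (rule LIMSEQ_le_const2[OF tendsto_norm[OF tendsto_diff[OF F_LIMSEQ[OF control_setD(2)[OF w]]
      F_LIMSEQ[OF control_setD(2)[OF w]]]]], intro exI allI impI)
  fix n
  define r where "r = level_seq w\<^sub>0 n"
  have r: "0 < r" "r \<le> 1" using level_seq_pos level_seq_le_1 control_setD[OF w] by (auto simp: r_def)
  have "norm (r ^ q *\<^sub>R f z\<^sub>1 (inverse r *\<^sub>R w) - r ^ q *\<^sub>R f z\<^sub>2 (inverse r *\<^sub>R w))
      = r ^ q * norm (f z\<^sub>1 (inverse r *\<^sub>R w) - f z\<^sub>2 (inverse r *\<^sub>R w))"
    unfolding scaleR_diff_right[symmetric] norm_scaleR using r by simp
  also have "\<dots> \<le> r ^ q * (Lip R * (1 + norm (inverse r *\<^sub>R w) ^ p) * norm (z\<^sub>1 - z\<^sub>2))"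
    using r control_setD[OF w] R by (intro mult_left_mono f_lip scale_in_A) auto
  also have "\<dots> = (r ^ q * (1 + norm (inverse r *\<^sub>R w) ^ p)) * (Lip R * norm (z\<^sub>1 - z\<^sub>2))" by (simp add: mult_ac)
  also have "\<dots> \<le> 2 * (Lip R * norm (z\<^sub>1 - z\<^sub>2))"
    using r control_setD[OF w] pos(2)[OF R(1)] by (intro mult_right_mono scaled_p_weight) auto
  finally show "norm (r ^ q *\<^sub>R f z\<^sub>1 (inverse r *\<^sub>R w) - r ^ q *\<^sub>R f z\<^sub>2 (inverse r *\<^sub>R w))
    \<le> 2 * Lip R * norm (z\<^sub>1 - z\<^sub>2)" by simp
qed

text \<open>Along \<open>level_seq\<close> the weight in \<open>l_mod\<close> tends to 1, so the
  modulus survives without a factor.\<close>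

lemma L_modulus:
  assumes w: "(w\<^sub>0, w) \<in> ext_control_set q A" and R: "0 < R" "norm z\<^sub>1 \<le> R" "norm z\<^sub>2 \<le> R"
  shows "\<bar>L z\<^sub>1 w\<^sub>0 w - L z\<^sub>2 w\<^sub>0 w\<bar> \<le> \<omega> (norm (z\<^sub>1 - z\<^sub>2)) R"
proof (rule LIMSEQ_le)
  show "(\<lambda>n. \<bar>level_seq w\<^sub>0 n ^ q *\<^sub>R l z\<^sub>1 (inverse (level_seq w\<^sub>0 n) *\<^sub>R w)
      - level_seq w\<^sub>0 n ^ q *\<^sub>R l z\<^sub>2 (inverse (level_seq w\<^sub>0 n) *\<^sub>R w)\<bar>) \<longlonglongrightarrow> \<bar>L z\<^sub>1 w\<^sub>0 w - L z\<^sub>2 w\<^sub>0 w\<bar>"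
    by (intro tendsto_rabs tendsto_diff L_LIMSEQ control_setD(2)[OF w])
  show "(\<lambda>n. (level_seq w\<^sub>0 n ^ q + norm w ^ q) * \<omega> (norm (z\<^sub>1 - z\<^sub>2)) R) \<longlonglongrightarrow> \<omega> (norm (z\<^sub>1 - z\<^sub>2)) R"
    using tendsto_mult_right[OF weight_LIMSEQ[OF w]] by simp
  show "\<exists>N. \<forall>n\<ge>N. \<bar>level_seq w\<^sub>0 n ^ q *\<^sub>R l z\<^sub>1 (inverse (level_seq w\<^sub>0 n) *\<^sub>R w)
      - level_seq w\<^sub>0 n ^ q *\<^sub>R l z\<^sub>2 (inverse (level_seq w\<^sub>0 n) *\<^sub>R w)\<bar>
      \<le> (level_seq w\<^sub>0 n ^ q + norm w ^ q) * \<omega> (norm (z\<^sub>1 - z\<^sub>2)) R"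
  proof (intro exI allI impI)
    fix n
    define r where "r = level_seq w\<^sub>0 n"
    have r: "0 < r" using level_seq_pos control_setD[OF w] by (auto simp: r_def)
    have "\<bar>r ^ q *\<^sub>R l z\<^sub>1 (inverse r *\<^sub>R w) - r ^ q *\<^sub>R l z\<^sub>2 (inverse r *\<^sub>R w)\<bar>
        = r ^ q * \<bar>l z\<^sub>1 (inverse r *\<^sub>R w) - l z\<^sub>2 (inverse r *\<^sub>R w)\<bar>"
      unfolding scaleR_diff_right[symmetric] using r by (simp add: abs_mult)
    also have "\<dots> \<le> r ^ q * ((1 + norm (inverse r *\<^sub>R w) ^ q) * \<omega> (norm (z\<^sub>1 - z\<^sub>2)) R)"
      using r control_setD[OF w] R by (intro mult_left_mono l_mod scale_in_A) auto
    also have "\<dots> = (r ^ q + norm w ^ q) * \<omega> (norm (z\<^sub>1 - z\<^sub>2)) R"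
      unfolding scaled_q_weight[OF r, symmetric] by (simp add: mult_ac)
    finally show "\<bar>r ^ q *\<^sub>R l z\<^sub>1 (inverse r *\<^sub>R w) - r ^ q *\<^sub>R l z\<^sub>2 (inverse r *\<^sub>R w)\<bar>
        \<le> (r ^ q + norm w ^ q) * \<omega> (norm (z\<^sub>1 - z\<^sub>2)) R" .
  qed
qed

lemma L_nonneg:
  assumes w: "(w\<^sub>0, w) \<in> ext_control_set q A"
  shows "0 \<le> L z w\<^sub>0 w"
proof (rule LIMSEQ_le_const[OF L_LIMSEQ[OF control_setD(2)[OF w]]], intro exI allI impI)
  fix n
  have "0 < level_seq w\<^sub>0 n" using level_seq_pos control_setD[OF w] by auto
  then show "0 \<le> level_seq w\<^sub>0 n ^ q *\<^sub>R l z (inverse (level_seq w\<^sub>0 n) *\<^sub>R w)"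
    using control_setD[OF w] by (auto intro!: mult_nonneg_nonneg l_nonneg scale_in_A)
qed

lemma L_bound:
  assumes w: "(w\<^sub>0, w) \<in> ext_control_set q A" and R: "0 < R" "norm z \<le> R"
  shows "L z w\<^sub>0 w \<le> Bnd R"
proof (rule LIMSEQ_le[OF L_LIMSEQ[OF control_setD(2)[OF w]]])
  show "(\<lambda>n. Bnd R * (level_seq w\<^sub>0 n ^ q + norm w ^ q)) \<longlonglongrightarrow> Bnd R"
    using tendsto_mult_left[OF weight_LIMSEQ[OF w]] by simp
  have "r ^ q *\<^sub>R l z (inverse r *\<^sub>R w) \<le> Bnd R * (r ^ q + norm w ^ q)" if r: "0 < r" for r
  proof -
    have "r ^ q *\<^sub>R l z (inverse r *\<^sub>R w) \<le> r ^ q * (Bnd R * (1 + norm (inverse r *\<^sub>R w) ^ q))"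
      using r control_setD[OF w] R l_bnd[OF R(1) scale_in_A R(2)]
      by (auto intro!: mult_left_mono)
    also have "\<dots> = Bnd R * (r ^ q + norm w ^ q)"
      unfolding scaled_q_weight[OF r, symmetric] by (simp add: mult_ac)
    finally show ?thesis .
  qed
  then show "\<exists>N. \<forall>n\<ge>N. level_seq w\<^sub>0 n ^ q *\<^sub>R l z (inverse (level_seq w\<^sub>0 n) *\<^sub>R w)
      \<le> Bnd R * (level_seq w\<^sub>0 n ^ q + norm w ^ q)"
    using level_seq_pos control_setD[OF w] by blast
qed

text \<open>Substituting \<open>norm w ^ q = 1 - w\<^sub>0 ^ q\<close> turns coercivity in the
  control into a positive lower bound for running cost plus a multiple of the rate of ordinary time.
  Integrated, it bounds the extended horizon by cost and elapsed time.\<close>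

lemma L_coercive:
  assumes w: "(w\<^sub>0, w) \<in> ext_control_set q A"
  shows "C\<^sub>2 \<le> L z w\<^sub>0 w + (C\<^sub>1 + C\<^sub>2) * w\<^sub>0 ^ q"
proof -
  have "C\<^sub>2 * norm w ^ q - C\<^sub>1 * w\<^sub>0 ^ q \<le> L z w\<^sub>0 w"
  proof (rule LIMSEQ_le[OF _ L_LIMSEQ[OF control_setD(2)[OF w]]])
    show "(\<lambda>n. C\<^sub>2 * norm w ^ q - C\<^sub>1 * level_seq w\<^sub>0 n ^ q) \<longlonglongrightarrow> C\<^sub>2 * norm w ^ q - C\<^sub>1 * w\<^sub>0 ^ q"
      by (intro tendsto_intros level_seq_LIMSEQ)
    have "C\<^sub>2 * norm w ^ q - C\<^sub>1 * r ^ q \<le> r ^ q *\<^sub>R l z (inverse r *\<^sub>R w)" if r: "0 < r" for r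
    proof -
      have "r ^ q * (C\<^sub>2 * norm (inverse r *\<^sub>R w) ^ q - C\<^sub>1) \<le> r ^ q * l z (inverse r *\<^sub>R w)"
        using r control_setD[OF w] by (intro mult_left_mono l_coercive scale_in_A) auto
      moreover have "r ^ q * (C\<^sub>2 * norm (inverse r *\<^sub>R w) ^ q - C\<^sub>1) = C\<^sub>2 * norm w ^ q - C\<^sub>1 * r ^ q"
        using r by (simp add: power_mult_distrib field_simps)
      ultimately show ?thesis by simp
    qed
    then show "\<exists>N. \<forall>n\<ge>N. C\<^sub>2 * norm w ^ q - C\<^sub>1 * level_seq w\<^sub>0 n ^ q
        \<le> level_seq w\<^sub>0 n ^ q *\<^sub>R l z (inverse (level_seq w\<^sub>0 n) *\<^sub>R w)"
      using level_seq_pos control_setD[OF w] by blast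
  qed
  moreover have "norm w ^ q = 1 - w\<^sub>0 ^ q" using control_setD(3)[OF w] by simp
  ultimately show ?thesis by (simp add: algebra_simps)
qed

section \<open>Measurability and well-posedness of the controlled equations\<close>

lemma control_measurable:
  fixes \<Phi> :: "'x \<Rightarrow> 'a \<Rightarrow> 'b::euclidean_space"
  assumes "continuous_on (UNIV \<times> A) (\<lambda>(x, a). \<Phi> x a)" "continuous_on {0..} y"
    and "\<alpha> \<in> borel_measurable (restrict_space borel {0..})" "\<And>s. 0 \<le> s \<Longrightarrow> \<alpha> s \<in> A"
  shows "(\<lambda>s. \<Phi> (y s) (\<alpha> s)) \<in> borel_measurable (restrict_space borel {0..})"
proof -
  have "(\<lambda>s. (\<lambda>(x, a). \<Phi> x a) (y s, \<alpha> s)) \<in> borel_measurable (restrict_space borel {0..})"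
    by (intro measurable_continuous_on_compose[OF assms(1)] borel_measurable_Pair assms(3)
        borel_measurable_continuous_on_restrict[OF assms(2)])
      (use assms(4) in \<open>auto simp: space_restrict_space\<close>)
  then show ?thesis by simp
qed

lemma extend_measurable:
  fixes \<Phi> \<Phi>inf :: "'x \<Rightarrow> 'a \<Rightarrow> 'b::euclidean_space"
  assumes \<Phi>: "continuous_on (UNIV \<times> A) (\<lambda>(x, a). \<Phi> x a)" "recession_limit q A \<Phi> \<Phi>inf"
    and y: "continuous_on {0..} y" and w: "(w\<^sub>0, w) \<in> \<Gamma>"
  shows "(\<lambda>s. extend q \<Phi> \<Phi>inf (y s) (w\<^sub>0 s) (w s)) \<in> borel_measurable (restrict_space borel {0..})"
proof -
  have [measurable]: "w\<^sub>0 \<in> borel_measurable (restrict_space borel {0..})"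
    and w_meas [measurable]: "w \<in> borel_measurable (restrict_space borel {0..})"
    and wA: "\<And>s. 0 \<le> s \<Longrightarrow> (w\<^sub>0 s, w s) \<in> ext_control_set q A"
    using w by (auto simp: ext_controls_iff)
  have wA': "w s \<in> A" "0 \<le> w\<^sub>0 s" if "0 \<le> s" for s using control_setD[OF wA[OF that]] by auto
  have [measurable]: "(\<lambda>s. \<Phi>inf (y s) (w s)) \<in> borel_measurable (restrict_space borel {0..})"
  proof (rule control_measurable[OF _ y w_meas wA'(1)])
    show "continuous_on (UNIV \<times> A) (\<lambda>(x, a). \<Phi>inf x a)"
      using \<Phi>(2) by (simp only: recession_limit_def)
  qed
  \<comment> \<open>Where \<open>w\<^sub>0 s = 0\<close> the convention \<open>inverse 0 = 0\<close>
    makes the argument 0, a point of the cone; hence this branch stays inside the domain of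
    continuity even where \<open>extend\<close> does not use it.\<close>
  have [measurable]: "(\<lambda>s. \<Phi> (y s) (inverse (w\<^sub>0 s) *\<^sub>R w s)) \<in> borel_measurable (restrict_space borel {0..})"
  proof (rule control_measurable[OF \<Phi>(1) y])
    show "(\<lambda>s. inverse (w\<^sub>0 s) *\<^sub>R w s) \<in> borel_measurable (restrict_space borel {0..})"
      by measurable
  qed (intro scale_in_A wA' positive_imp_inverse_positive; simp add: wA')
  show ?thesis unfolding extend_def by measurable
qed

lemmas F_measurable = extend_measurable[OF f_cont finf]
lemmas L_measurable = extend_measurable[OF l_cont linf]

text \<open>The weight is 1 and the constants \<open>2 * M\<close> and \<open>2 * Lip R\<close> do
  not depend on the control, so extended time itself is the clock of all later Gronwall
  estimates.\<close>

lemma caratheodory_ext: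
  assumes w: "(w\<^sub>0, w) \<in> \<Gamma>"
  shows "caratheodory (\<lambda>_. 1) (\<lambda>s z. F z (w\<^sub>0 s) (w s)) (2 * M)"
proof -
  interpret time_change "\<lambda>_. 1" by (rule time_change_1)
  have wA: "\<And>s. 0 \<le> s \<Longrightarrow> (w\<^sub>0 s, w s) \<in> ext_control_set q A"
    using w by (auto simp: ext_controls_iff)
  show ?thesis
  proof
    show "\<exists>K>0. \<forall>s\<ge>0. \<forall>z\<^sub>1 z\<^sub>2. norm z\<^sub>1 \<le> R \<longrightarrow> norm z\<^sub>2 \<le> R \<longrightarrow>
      norm (F z\<^sub>1 (w\<^sub>0 s) (w s) - F z\<^sub>2 (w\<^sub>0 s) (w s)) \<le> K * 1 * norm (z\<^sub>1 - z\<^sub>2)" if "0 < R" for R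
      using pos(2)[OF that] F_lipschitz[OF wA that] by (intro exI[of _ "2 * Lip R"]) auto
    show "(\<lambda>s. F (y s) (w\<^sub>0 s) (w s)) \<in> borel_measurable (restrict_space borel {0..})"
      if "continuous_on {0..} y" for y
      using that w by (rule F_measurable)
    show "norm (F z (w\<^sub>0 s) (w s)) \<le> 2 * M * 1 * (1 + norm z)" if "0 \<le> s" for s z
      using F_growth[OF wA[OF that], of z] by simp
  qed (use pos(1) in simp)
qed

lemma caratheodory_orig:
  assumes \<alpha>: "\<alpha> \<in> controls q A"
  shows "caratheodory (\<lambda>s. 1 + norm (\<alpha> s) ^ q) (\<lambda>s z. f z (\<alpha> s)) (2 * M)"
proof -
  have \<alpha>': "\<alpha> \<in> borel_measurable (restrict_space borel {0..})" "\<And>s. 0 \<le> s \<Longrightarrow> \<alpha> s \<in> A"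
    and int: "\<And>T. 0 \<le> T \<Longrightarrow> set_integrable lborel {0..T} (\<lambda>s. norm (\<alpha> s) ^ q)"
    using \<alpha> by (auto simp: controls_def)
  interpret one: time_change "\<lambda>_. 1" by (rule time_change_1)
  show ?thesis
  proof
    show int': "set_integrable lborel {0..s} (\<lambda>s. 1 + norm (\<alpha> s) ^ q)" if "0 \<le> s" for s
      using one.loc_integrable[OF that] int[OF that] by (rule set_integral_add)
    show "\<exists>s\<ge>0. B \<le> (LINT u:{0..s}|lborel. 1 + norm (\<alpha> u) ^ q)" for B
    proof -
      obtain s where s: "s \<ge> 0" "B \<le> (LINT u:{0..s::real}|lborel. (1::real))"
        using one.unbounded[of B] by blast
      note s(2)
      also have "(LINT u:{0..s::real}|lborel. (1::real)) \<le> (LINT u:{0..s}|lborel. 1 + norm (\<alpha> u) ^ q)"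
        by (intro set_integral_mono one.loc_integrable[OF s(1)] int'[OF s(1)]) simp
      finally show ?thesis using s(1) by blast
    qed
    show "(\<lambda>s. f (y s) (\<alpha> s)) \<in> borel_measurable (restrict_space borel {0..})"
      if "continuous_on {0..} y" for y
      using f_cont that \<alpha>' by (rule control_measurable)
    show "norm (f z (\<alpha> s)) \<le> 2 * M * (1 + norm (\<alpha> s) ^ q) * (1 + norm z)" if "0 \<le> s" for s z
    proof -
      have "norm (f z (\<alpha> s)) \<le> M * (1 + norm (\<alpha> s) ^ p) * (1 + norm z)"
        using \<alpha>'(2) that by (intro f_growth) auto
      also have "\<dots> \<le> M * (2 * (1 + norm (\<alpha> s) ^ q)) * (1 + norm z)"
        using pos(1) by (intro mult_left_mono mult_right_mono p_weight_le) auto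
      finally show ?thesis by (simp add: mult_ac)
    qed
    show "\<exists>K>0. \<forall>s\<ge>0. \<forall>z\<^sub>1 z\<^sub>2. norm z\<^sub>1 \<le> R \<longrightarrow> norm z\<^sub>2 \<le> R \<longrightarrow>
      norm (f z\<^sub>1 (\<alpha> s) - f z\<^sub>2 (\<alpha> s)) \<le> K * (1 + norm (\<alpha> s) ^ q) * norm (z\<^sub>1 - z\<^sub>2)" if R: "0 < R" for R
    proof (intro exI[of _ "2 * Lip R"] conjI allI impI)
      fix s :: real and z\<^sub>1 z\<^sub>2 :: 'x assume *: "0 \<le> s" "norm z\<^sub>1 \<le> R" "norm z\<^sub>2 \<le> R"
      have "norm (f z\<^sub>1 (\<alpha> s) - f z\<^sub>2 (\<alpha> s)) \<le> Lip R * (1 + norm (\<alpha> s) ^ p) * norm (z\<^sub>1 - z\<^sub>2)"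
        using \<alpha>'(2) * R by (intro f_lip) auto
      also have "\<dots> \<le> Lip R * (2 * (1 + norm (\<alpha> s) ^ q)) * norm (z\<^sub>1 - z\<^sub>2)"
        using pos(2)[OF R] by (intro mult_left_mono mult_right_mono p_weight_le) auto
      finally show "norm (f z\<^sub>1 (\<alpha> s) - f z\<^sub>2 (\<alpha> s)) \<le> 2 * Lip R * (1 + norm (\<alpha> s) ^ q) * norm (z\<^sub>1 - z\<^sub>2)"
        by (simp add: mult_ac)
    qed (use pos(2)[OF R] in simp)
  qed (use pos(1) in auto)
qed

section \<open>Trajectories, their bounds and the cost integrals\<close>

lemma ext_traj_solution:
  "(w\<^sub>0, w) \<in> \<Gamma> \<Longrightarrow> ode_solution (\<lambda>s z. F z (w\<^sub>0 s) (w s)) x (\<xi> x w\<^sub>0 w)"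
  unfolding ext_traj_def by (rule someI_ex[OF caratheodory.solution_exists[OF caratheodory_ext]])

text \<open>Identifies the chosen trajectory with solutions obtained by change of time or by
  concatenation.\<close>

lemma ext_traj_eqI:
  "(w\<^sub>0, w) \<in> \<Gamma> \<Longrightarrow> ode_solution (\<lambda>s z. F z (w\<^sub>0 s) (w s)) x y \<Longrightarrow> 0 \<le> s \<Longrightarrow> \<xi> x w\<^sub>0 w s = y s"
  by (rule caratheodory.solution_unique[OF caratheodory_ext ext_traj_solution])

lemma traj_solution:
  "\<alpha> \<in> controls q A \<Longrightarrow> ode_solution (\<lambda>s z. f z (\<alpha> s)) x (traj f x \<alpha>)"
  unfolding traj_def by (rule someI_ex[OF caratheodory.solution_exists[OF caratheodory_orig]])

lemma traj_eqI:
  "\<alpha> \<in> controls q A \<Longrightarrow> ode_solution (\<lambda>s z. f z (\<alpha> s)) x y \<Longrightarrow> 0 \<le> s \<Longrightarrow> traj f x \<alpha> s = y s"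
  by (rule caratheodory.solution_unique[OF caratheodory_orig traj_solution])

lemma continuous_on_ext_traj: "(w\<^sub>0, w) \<in> \<Gamma> \<Longrightarrow> continuous_on {0..} (\<xi> x w\<^sub>0 w)"
  using ext_traj_solution by (auto simp: ode_solution_def)

lemma continuous_on_traj: "\<alpha> \<in> controls q A \<Longrightarrow> continuous_on {0..} (traj f x \<alpha>)"
  using traj_solution by (auto simp: ode_solution_def)

text \<open>Uniform over all extended controls; the exponent \<open>4 * M\<close> is Gronwall's
  factor 2 times the growth constant \<open>2 * M\<close>.\<close>

lemma ext_traj_bound:
  assumes w: "(w\<^sub>0, w) \<in> \<Gamma>" and "0 \<le> s"
  shows "norm (\<xi> x w\<^sub>0 w s) \<le> 2 * (1 + norm x) * exp (4 * M * s)"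
proof -
  interpret caratheodory "\<lambda>_. 1" "\<lambda>s z. F z (w\<^sub>0 s) (w s)" "2 * M" by (rule caratheodory_ext[OF w])
  have sol: "ode_solution (\<lambda>s z. F z (w\<^sub>0 s) (w s)) x (\<xi> x w\<^sub>0 w)" by (rule ext_traj_solution[OF w])
  have "1 + norm (\<xi> x w\<^sub>0 w s) \<le> 2 * (1 + norm x) * exp (2 * (2 * M) * clock s)"
  proof (rule solution_bound)
    show "continuous_on {0..s} (\<xi> x w\<^sub>0 w)"
      by (rule continuous_on_subset[OF continuous_on_ext_traj[OF w]]) auto
  qed (use sol \<open>0 \<le> s\<close> in \<open>auto simp: ode_solution_def\<close>)
  then show ?thesis using clock_1[OF \<open>0 \<le> s\<close>] by simp
qed

lemma cost_fin: "cost f l (ereal t) x \<alpha> = (\<integral>\<^sup>+\<tau>\<in>{0..t}. ennreal (l (traj f x \<alpha> \<tau>) (\<alpha> \<tau>)) \<partial>lborel)"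
  unfolding cost_def by (simp add: atLeastAtMost_def atLeast_def atMost_def Int_def)

lemma cost_inf: "cost f l \<infinity> x \<alpha> = (\<integral>\<^sup>+\<tau>\<in>{0..}. ennreal (l (traj f x \<alpha> \<tau>) (\<alpha> \<tau>)) \<partial>lborel)"
  unfolding cost_def by (simp add: atLeast_def)

lemma J_fin: "J (ereal S) x w\<^sub>0 w = (\<integral>\<^sup>+s\<in>{0..S}. ennreal (L (\<xi> x w\<^sub>0 w s) (w\<^sub>0 s) (w s)) \<partial>lborel)"
  unfolding ext_cost_def by (simp add: atLeastAtMost_def atLeast_def atMost_def Int_def)

lemma J_inf: "J \<infinity> x w\<^sub>0 w = (\<integral>\<^sup>+s\<in>{0..}. ennreal (L (\<xi> x w\<^sub>0 w s) (w\<^sub>0 s) (w s)) \<partial>lborel)"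
  unfolding ext_cost_def by (simp add: atLeast_def)

end

subsection \<open>Ordinary and extended controls\<close>

context control_data
begin

lemma J_measurable:
  assumes "(w\<^sub>0, w) \<in> \<Gamma>"
  shows "(\<lambda>s. ennreal (L (\<xi> x w\<^sub>0 w s) (w\<^sub>0 s) (w s))) \<in> borel_measurable (restrict_space borel {0..})"
  using L_measurable[OF continuous_on_ext_traj[OF assms] assms] by measurable

lemma comp_inv_clock_measurable:
  assumes "time_change g" "h \<in> borel_measurable (restrict_space borel {0..})"
  shows "(\<lambda>t. h (time_change.inv_clock g t)) \<in> borel_measurable (restrict_space borel {0..})"
proof -
  interpret time_change g by fact
  have "inv_clock \<in> measurable borel (restrict_space borel {0..})"
    by (rule measurable_restrict_space2) auto
  from measurable_compose[OF this assms(2)] show ?thesis by (rule measurable_restrict_space1)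
qed

text \<open>The graph completion of an ordinary control: \<open>s = \<integral> (1 + |\<alpha>|\<^sup>q)\<close> becomes the new time.\<close>

lemma ext_control_of_control:
  assumes \<alpha>: "\<alpha> \<in> controls q A"
  obtains w\<^sub>0 w S where "(w\<^sub>0, w) \<in> \<Gamma>" "\<And>s. 0 < w\<^sub>0 s" "J \<infinity> x w\<^sub>0 w = cost f l \<infinity> x \<alpha>"
    "\<And>t. 0 \<le> t \<Longrightarrow> t \<le> S t" "\<And>t. 0 \<le> t \<Longrightarrow> (LINT s:{0..S t}|lborel. w\<^sub>0 s ^ q) = t"
    "\<And>t. 0 \<le> t \<Longrightarrow> J (ereal (S t)) x w\<^sub>0 w = cost f l (ereal t) x \<alpha>"
proof -
  define g where "g s = 1 + norm (\<alpha> s) ^ q" for s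
  \<comment> \<open>Writing \<open>\<alpha> = v / v\<^sub>0\<close>, the normalisation reads
    \<open>v\<^sub>0 ^ q * (1 + norm \<alpha> ^ q) = 1\<close>, which determines
    \<open>v\<^sub>0\<close>.\<close>
  define v\<^sub>0 where "v\<^sub>0 s = root q (inverse (g s))" for s
  define v where "v s = v\<^sub>0 s *\<^sub>R \<alpha> s" for s
  have \<alpha>_meas: "\<alpha> \<in> borel_measurable (restrict_space borel {0..})"
    and \<alpha>A: "\<And>s. 0 \<le> s \<Longrightarrow> \<alpha> s \<in> A"
    using \<alpha> by (auto simp: controls_def)
  interpret caratheodory g "\<lambda>s z. f z (\<alpha> s)" "2 * M"
    unfolding g_def by (rule caratheodory_orig[OF \<alpha>])
  have g1: "1 \<le> g s" for s by (simp add: g_def)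
  then have g_pos: "0 < g s" for s using less_le_trans zero_less_one by blast
  have v0_pos: "0 < v\<^sub>0 s" for s using g_pos[of s] q_pos by (simp add: v\<^sub>0_def)
  have v0_pow: "v\<^sub>0 s ^ q = inverse (g s)" for s
    using g_pos[of s] q_pos by (simp add: v\<^sub>0_def)
  have "v\<^sub>0 s ^ q + norm (v s) ^ q = v\<^sub>0 s ^ q * g s" for s
    using v0_pos[of s] by (simp add: v_def g_def power_mult_distrib distrib_left)
  then have one: "v\<^sub>0 s ^ q + norm (v s) ^ q = 1" for s
    using g_pos[of s] by (simp add: v0_pow)
  have v_set: "(v\<^sub>0 s, v s) \<in> ext_control_set q A" if "0 \<le> s" for s
    unfolding ext_control_set_def using one[of s] v0_pos[of s] scale_in_A[OF \<alpha>A[OF that]]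
    by (simp add: v_def less_imp_le)
  have [measurable]: "g \<in> borel_measurable (restrict_space borel {0..})"
    unfolding g_def using \<alpha>_meas by measurable
  have v0_meas [measurable]: "v\<^sub>0 \<in> borel_measurable (restrict_space borel {0..})"
    unfolding v\<^sub>0_def
    by (rule measurable_compose[OF _ borel_measurable_continuous_onI[OF continuous_on_real_root]])
      (auto intro: continuous_intros)
  have v_meas: "v \<in> borel_measurable (restrict_space borel {0..})"
    unfolding v_def using \<alpha>_meas by measurable
  have v_ctrl: "(v\<^sub>0, v) \<in> \<Gamma>"
    using v0_meas v_meas v_set by (simp add: ext_controls_iff)
  define w\<^sub>0 where "w\<^sub>0 t = v\<^sub>0 (inv_clock t)" for t
  define w where "w t = v (inv_clock t)" for t
  have w_ctrl: "(w\<^sub>0, w) \<in> \<Gamma>"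
    unfolding ext_controls_iff w\<^sub>0_def w_def
    using comp_inv_clock_measurable[OF time_change_axioms v0_meas]
      comp_inv_clock_measurable[OF time_change_axioms v_meas] v_set by auto
  define y where "y = traj f x \<alpha>"
  have y_cont: "continuous_on {0..} y" unfolding y_def by (rule continuous_on_traj[OF \<alpha>])
  \<comment> \<open>Since \<open>g\<close> is the inverse of \<open>v\<^sub>0 ^ q\<close>, it
    cancels the homogeneity factor of the extension; this puts the original equation and cost into
    the form with density \<open>g\<close> that the change of time expects.\<close>
  have ext: "g s *\<^sub>R extend q \<Phi> \<Phi>inf z (v\<^sub>0 s) (v s) = \<Phi> z (\<alpha> s)" for \<Phi> \<Phi>inf :: "'x \<Rightarrow> 'a \<Rightarrow> 'b::euclidean_space" and s z
    using v0_pos[of s] g_pos[of s] by (simp add: extend_def v0_pow v_def)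
  have "ode_solution (\<lambda>s z. g s *\<^sub>R F z (v\<^sub>0 s) (v s)) x y"
    unfolding ext y_def by (rule traj_solution[OF \<alpha>])
  from ode_solution_time_change[OF this F_measurable[OF y_cont v_ctrl]]
  have "ode_solution (\<lambda>s z. F z (w\<^sub>0 s) (w s)) x (\<lambda>t. y (inv_clock t))"
    by (simp add: w\<^sub>0_def w_def)
  note traj = ext_traj_eqI[OF w_ctrl this]
  have Lm: "(\<lambda>s. ennreal (L (y s) (v\<^sub>0 s) (v s))) \<in> borel_measurable (restrict_space borel {0..})"
    using L_measurable[OF y_cont v_ctrl] by measurable
  have gL: "ennreal (g s) * ennreal (L (y s) (v\<^sub>0 s) (v s)) = ennreal (l (y s) (\<alpha> s))" if "0 \<le> s" for s
    using ext[of s l linf "y s"] L_nonneg[OF v_set[OF that]] g_pos[of s] by (simp flip: ennreal_mult)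
  show thesis
  proof (rule that[of w\<^sub>0 w clock])
    show "(w\<^sub>0, w) \<in> \<Gamma>" by (rule w_ctrl)
    show "0 < w\<^sub>0 s" for s by (simp add: w\<^sub>0_def v0_pos)
    have "J \<infinity> x w\<^sub>0 w = (\<integral>\<^sup>+t\<in>{0..}. ennreal (L (y (inv_clock t)) (v\<^sub>0 (inv_clock t)) (v (inv_clock t))) \<partial>lborel)"
      unfolding J_inf by (rule nn_integral_cong) (auto simp: traj w\<^sub>0_def w_def split: split_indicator)
    also have "\<dots> = (\<integral>\<^sup>+s\<in>{0..}. ennreal (g s) * ennreal (L (y s) (v\<^sub>0 s) (v s)) \<partial>lborel)"
      by (rule nn_integral_time_change[OF Lm])
    also have "\<dots> = cost f l \<infinity> x \<alpha>"
      unfolding cost_inf by (rule nn_integral_cong) (auto simp: gL y_def[symmetric] split: split_indicator)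
    finally show "J \<infinity> x w\<^sub>0 w = cost f l \<infinity> x \<alpha>" .
    fix t :: real assume t: "0 \<le> t"
    interpret one: time_change "\<lambda>_. 1" by (rule time_change_1)
    have "(LINT u:{0..t}|lborel. (1::real)) \<le> clock t"
      unfolding clock_def using t g1 by (intro set_integral_mono one.loc_integrable loc_integrable)
    then show "t \<le> clock t" using LINT_const_1[OF t] by simp
    have "(LINT s:{0..clock t}|lborel. v\<^sub>0 (inv_clock s) ^ q) = (LINT u:{0..t}|lborel. g u *\<^sub>R v\<^sub>0 u ^ q)"
      by (rule LINT_time_change[OF _ t]) measurable
    also have "\<dots> = (LINT u:{0..t}|lborel. 1)"
      using g_pos by (intro set_lebesgue_integral_cong) (auto simp: v0_pow less_imp_neq[symmetric])
    finally show "(LINT s:{0..clock t}|lborel. w\<^sub>0 s ^ q) = t"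
      using LINT_const_1[OF t] by (simp add: w\<^sub>0_def)
    have "J (ereal (clock t)) x w\<^sub>0 w
        = (\<integral>\<^sup>+t\<in>{0..clock t}. ennreal (L (y (inv_clock t)) (v\<^sub>0 (inv_clock t)) (v (inv_clock t))) \<partial>lborel)"
      unfolding J_fin by (rule nn_integral_cong) (auto simp: traj w\<^sub>0_def w_def split: split_indicator)
    also have "\<dots> = (\<integral>\<^sup>+s\<in>{0..t}. ennreal (g s) * ennreal (L (y s) (v\<^sub>0 s) (v s)) \<partial>lborel)"
      by (rule nn_integral_time_change_Icc[OF Lm t])
    also have "\<dots> = cost f l (ereal t) x \<alpha>"
      unfolding cost_fin by (rule nn_integral_cong) (auto simp: gL y_def[symmetric] split: split_indicator)
    finally show "J (ereal (clock t)) x w\<^sub>0 w = cost f l (ereal t) x \<alpha>" .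
  qed
qed

text \<open>Conversely \<open>t = \<integral> w\<^sub>0\<^sup>q\<close> is ordinary time. Where \<open>w\<^sub>0\<close> vanishes the clock stands still, which
  is harmless when the extended dynamics vanish there as well; the cost spent there is saved.\<close>

lemma control_of_ext_control:
  assumes w: "(w\<^sub>0, w) \<in> \<Gamma>"
    and impulse: "\<And>s z. 0 \<le> s \<Longrightarrow> w\<^sub>0 s = 0 \<Longrightarrow> F z 0 (w s) = 0"
    and unbdd: "\<And>B. \<exists>s\<ge>0. B \<le> (LINT u:{0..s}|lborel. w\<^sub>0 u ^ q)"
  obtains \<alpha> where "\<alpha> \<in> controls q A" "cost f l \<infinity> x \<alpha> \<le> J \<infinity> x w\<^sub>0 w"
    "\<And>S. 0 \<le> S \<Longrightarrow> cost f l (ereal (LINT u:{0..S}|lborel. w\<^sub>0 u ^ q)) x \<alpha> \<le> J (ereal S) x w\<^sub>0 w"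
proof -
  define g where "g s = w\<^sub>0 s ^ q" for s
  \<comment> \<open>Where \<open>w\<^sub>0 s = 0\<close> this is the admissible value 0. The
    ordinary times that \<open>inv_clock\<close> sends to such instants form a null set, because the
    push-forward has density \<open>g = 0\<close> there.\<close>
  define c where "c s = inverse (w\<^sub>0 s) *\<^sub>R w s" for s
  have w0_meas [measurable]: "w\<^sub>0 \<in> borel_measurable (restrict_space borel {0..})"
    and w_meas [measurable]: "w \<in> borel_measurable (restrict_space borel {0..})"
    and w_set: "\<And>s. 0 \<le> s \<Longrightarrow> (w\<^sub>0 s, w s) \<in> ext_control_set q A"
    using w by (auto simp: ext_controls_iff)
  note wD = control_setD[OF w_set]
  have g_meas: "g \<in> borel_measurable (restrict_space borel {0..})"
    unfolding g_def by measurable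
  interpret time_change g
  proof
    show "0 \<le> g s" if "0 \<le> s" for s using wD(1)[OF that] by (simp add: g_def)
    show "set_integrable lborel {0..s} g" for s
      by (rule set_integrable_bounded_Icc[OF g_meas, where B=1]) (use wD in \<open>simp add: g_def\<close>)
    show "\<exists>s\<ge>0. B \<le> (LINT u:{0..s}|lborel. g u)" for B
      unfolding g_def by (rule unbdd)
  qed
  have c_meas: "c \<in> borel_measurable (restrict_space borel {0..})" unfolding c_def by measurable
  have cA: "c s \<in> A" if "0 \<le> s" for s
    unfolding c_def using wD(1,2)[OF that] by (intro scale_in_A) auto
  define \<alpha> where "\<alpha> t = c (inv_clock t)" for t
  have \<alpha>: "\<alpha> \<in> controls q A"
    unfolding controls_def
  proof (intro CollectI conjI allI impI)
    show "\<alpha> \<in> borel_measurable (restrict_space borel {0..})"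
      unfolding \<alpha>_def by (rule comp_inv_clock_measurable[OF time_change_axioms c_meas])
    show "\<alpha> s \<in> A" for s unfolding \<alpha>_def by (simp add: cA)
    fix T :: real assume T: "0 \<le> T"
    have nc: "(\<lambda>s. norm (c s) ^ q) \<in> borel_measurable (restrict_space borel {0..})"
      using c_meas by measurable
    \<comment> \<open>The product is \<open>norm (w s) ^ q\<close> where
      \<open>w\<^sub>0 s > 0\<close> and 0 elsewhere. In the new time this makes
      \<open>\<alpha>\<close> locally integrable to the power \<open>q\<close>, although
      \<open>c\<close> itself may be unbounded.\<close>
    have "norm (g s *\<^sub>R norm (c s) ^ q) \<le> 1" if "0 \<le> s" for s
      using wD(1,7)[OF that] q_pos
      by (cases "w\<^sub>0 s = 0") (auto simp: g_def c_def power_mult_distrib abs_mult zero_power power_inverse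
          simp flip: mult.assoc)
    then have "set_integrable lborel {0..inv_clock T} (\<lambda>s. g s *\<^sub>R norm (c s) ^ q)"
      using g_meas nc by (intro set_integrable_bounded_Icc) auto
    then show "set_integrable lborel {0..T} (\<lambda>s. norm (\<alpha> s) ^ q)"
      using set_integrable_time_change[OF nc inv_clock_nonneg, of T] clock_inv_clock[OF T]
      by (simp add: \<alpha>_def)
  qed
  define y where "y = \<xi> x w\<^sub>0 w"
  have y_cont: "continuous_on {0..} y" unfolding y_def by (rule continuous_on_ext_traj[OF w])
  have "ode_solution (\<lambda>s z. g s *\<^sub>R f z (c s)) x y"
  proof (subst ode_solution_cong)
    show "g s *\<^sub>R f z (c s) = F z (w\<^sub>0 s) (w s)" if "0 \<le> s" for s z
      using impulse[OF that, of z] q_pos by (cases "w\<^sub>0 s = 0") (auto simp: g_def c_def extend_def)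
    show "ode_solution (\<lambda>s z. F z (w\<^sub>0 s) (w s)) x y" unfolding y_def by (rule ext_traj_solution[OF w])
  qed
  from ode_solution_time_change[OF this control_measurable[OF f_cont y_cont c_meas cA]]
  have "ode_solution (\<lambda>t z. f z (\<alpha> t)) x (\<lambda>t. y (inv_clock t))"
    by (simp add: \<alpha>_def)
  note traj = traj_eqI[OF \<alpha> this]
  have lm: "(\<lambda>s. ennreal (l (y s) (c s))) \<in> borel_measurable (restrict_space borel {0..})"
    using control_measurable[OF l_cont y_cont c_meas cA] by measurable
  have gl: "ennreal (g s) * ennreal (l (y s) (c s)) \<le> ennreal (L (y s) (w\<^sub>0 s) (w s))" if "0 \<le> s" for s
    using l_nonneg[OF cA[OF that]] wD(1)[OF that] q_pos
    by (cases "w\<^sub>0 s = 0") (auto simp: g_def c_def extend_def zero_power simp flip: ennreal_mult)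
  show thesis
  proof (rule that[of \<alpha>])
    show "\<alpha> \<in> controls q A" by (rule \<alpha>)
    have "cost f l \<infinity> x \<alpha> = (\<integral>\<^sup>+t\<in>{0..}. ennreal (l (y (inv_clock t)) (c (inv_clock t))) \<partial>lborel)"
      unfolding cost_inf by (rule nn_integral_cong) (auto simp: traj \<alpha>_def split: split_indicator)
    also have "\<dots> = (\<integral>\<^sup>+s\<in>{0..}. ennreal (g s) * ennreal (l (y s) (c s)) \<partial>lborel)"
      by (rule nn_integral_time_change[OF lm])
    also have "\<dots> \<le> J \<infinity> x w\<^sub>0 w"
      unfolding J_inf by (rule nn_integral_mono) (auto simp: gl y_def[symmetric] split: split_indicator)
    finally show "cost f l \<infinity> x \<alpha> \<le> J \<infinity> x w\<^sub>0 w" .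
    fix S :: real assume S: "0 \<le> S"
    have "cost f l (ereal (clock S)) x \<alpha>
        = (\<integral>\<^sup>+t\<in>{0..clock S}. ennreal (l (y (inv_clock t)) (c (inv_clock t))) \<partial>lborel)"
      unfolding cost_fin by (rule nn_integral_cong) (auto simp: traj \<alpha>_def split: split_indicator)
    also have "\<dots> = (\<integral>\<^sup>+s\<in>{0..S}. ennreal (g s) * ennreal (l (y s) (c s)) \<partial>lborel)"
      by (rule nn_integral_time_change_Icc[OF lm S])
    also have "\<dots> \<le> J (ereal S) x w\<^sub>0 w"
      unfolding J_fin by (rule nn_integral_mono) (auto simp: gl y_def[symmetric] split: split_indicator)
    finally show "cost f l (ereal (LINT u:{0..S}|lborel. w\<^sub>0 u ^ q)) x \<alpha> \<le> J (ereal S) x w\<^sub>0 w"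
      by (simp add: clock_def g_def)
  qed
qed

end

subsection \<open>Concatenation, stability and approximation\<close>

lemma LINT_concat:
  fixes a b :: "real \<Rightarrow> 'b::euclidean_space"
  assumes a: "set_integrable lborel {0..S} a" and b: "set_integrable lborel {0..h} b"
    and S: "0 \<le> S" and h: "0 \<le> h"
  shows "set_integrable lborel {0..S + h} (\<lambda>s. if s \<le> S then a s else b (s - S))"
    and "(LINT s:{0..S + h}|lborel. if s \<le> S then a s else b (s - S))
      = (LINT s:{0..S}|lborel. a s) + (LINT s:{0..h}|lborel. b s)"
proof -
  \<comment> \<open>At the junction \<open>s = S\<close> the first branch applies, so the shifted
    second piece must lose its value at 0; subtracting a multiple of the indicator of a point does
    this without changing the integral.\<close>
  have "has_bochner_integral lborel (indicat_real {0::real}) (measure lborel {0::real})"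
    by (rule has_bochner_integral_real_indicator) auto
  from has_bochner_integral_scaleR_left[OF this, of "b 0"]
  have "has_bochner_integral lborel (\<lambda>s::real. indicat_real {0} s *\<^sub>R b 0) 0" by simp
  with b have "has_bochner_integral lborel
      (\<lambda>s. indicat_real {0..h} s *\<^sub>R b s - indicat_real {0} s *\<^sub>R b 0) ((LINT s:{0..h}|lborel. b s) - 0)"
    unfolding set_lebesgue_integral_def set_integrable_def
    by (intro has_bochner_integral_diff) (auto intro: has_bochner_integral_integrable)
  then have "has_bochner_integral lborel
      (\<lambda>s. indicat_real {0..h} (- S + 1 * s) *\<^sub>R b (- S + 1 * s) - indicat_real {0} (- S + 1 * s) *\<^sub>R b 0)
      ((LINT s:{0..h}|lborel. b s) /\<^sub>R \<bar>1\<bar>)"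
    by (subst lborel_has_bochner_integral_real_affine_iff[where c=1 and t="- S", symmetric]) auto
  moreover have "has_bochner_integral lborel (\<lambda>s. indicat_real {0..S} s *\<^sub>R a s) (LINT s:{0..S}|lborel. a s)"
    using a unfolding set_lebesgue_integral_def set_integrable_def by (rule has_bochner_integral_integrable)
  ultimately have "has_bochner_integral lborel (\<lambda>s. indicat_real {0..S} s *\<^sub>R a s
        + (indicat_real {0..h} (- S + 1 * s) *\<^sub>R b (- S + 1 * s) - indicat_real {0} (- S + 1 * s) *\<^sub>R b 0))
      ((LINT s:{0..S}|lborel. a s) + (LINT s:{0..h}|lborel. b s) /\<^sub>R \<bar>1\<bar>)"
    by (intro has_bochner_integral_add)
  also have "(\<lambda>s. indicat_real {0..S} s *\<^sub>R a s
        + (indicat_real {0..h} (- S + 1 * s) *\<^sub>R b (- S + 1 * s) - indicat_real {0} (- S + 1 * s) *\<^sub>R b 0))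
      = (\<lambda>s. indicat_real {0..S + h} s *\<^sub>R (if s \<le> S then a s else b (s - S)))"
    using S h by (auto simp: fun_eq_iff indicator_def)
  finally have *: "has_bochner_integral lborel
      (\<lambda>s. indicat_real {0..S + h} s *\<^sub>R (if s \<le> S then a s else b (s - S)))
      ((LINT s:{0..S}|lborel. a s) + (LINT s:{0..h}|lborel. b s))" by simp
  show "set_integrable lborel {0..S + h} (\<lambda>s. if s \<le> S then a s else b (s - S))"
    "(LINT s:{0..S + h}|lborel. if s \<le> S then a s else b (s - S))
      = (LINT s:{0..S}|lborel. a s) + (LINT s:{0..h}|lborel. b s)"
    using * unfolding set_integrable_def set_lebesgue_integral_def has_bochner_integral_iff
    by blast+
qed

text \<open>The length \<open>h\<close> of the second piece is an extended real, so that
  concatenation on bounded horizons and on the half-line is one statement.\<close>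

lemma nn_integral_concat:
  fixes a b :: "real \<Rightarrow> ennreal"
  assumes a: "a \<in> borel_measurable (restrict_space borel {0..})"
    and b: "b \<in> borel_measurable (restrict_space borel {0..})"
    and S: "0 \<le> S" and h: "0 \<le> h"
  shows "(\<integral>\<^sup>+s\<in>{s. 0 \<le> s \<and> ereal s \<le> ereal S + h}. (if s \<le> S then a s else b (s - S)) \<partial>lborel)
    = (\<integral>\<^sup>+s\<in>{s. 0 \<le> s \<and> ereal s \<le> ereal S}. a s \<partial>lborel)
      + (\<integral>\<^sup>+s\<in>{s. 0 \<le> s \<and> ereal s \<le> h}. b s \<partial>lborel)"
proof -
  have [measurable]: "(\<lambda>s. a s * indicator {0..} s) \<in> borel_measurable borel"
    "(\<lambda>s. b s * indicator {0..} s) \<in> borel_measurable borel"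
    using a b by (auto simp: borel_measurable_restrict_space_iff_ennreal)
  define H where "H = {s. 0 \<le> s \<and> ereal s \<le> h}"
  have shift: "ereal s \<le> ereal S + h \<longleftrightarrow> ereal (s - S) \<le> h" for s
    by (cases h) auto
  have a1: "(\<lambda>s. a s * indicator {0..S} s) \<in> borel_measurable borel"
  proof -
    have "(\<lambda>s. (a s * indicator {0..} s) * indicator {..S} s) \<in> borel_measurable borel" by measurable
    also have "(\<lambda>s. (a s * indicator {0..} s) * indicator {..S} s) = (\<lambda>s. a s * indicator {0..S} s)"
      by (auto simp: fun_eq_iff split: split_indicator)
    finally show ?thesis .
  qed
  \<comment> \<open>The point 0 is removed because the junction belongs to the first piece; this
    changes \<open>b\<close> on a null set only.\<close>
  define B where "B s = (b s * indicator {0..} s) * indicator ({s. ereal s \<le> h} - {0}) s" for s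
  have B_meas [measurable]: "B \<in> borel_measurable borel" unfolding B_def by measurable
  have "(\<integral>\<^sup>+s\<in>{s. 0 \<le> s \<and> ereal s \<le> ereal S + h}. (if s \<le> S then a s else b (s - S)) \<partial>lborel)
      = (\<integral>\<^sup>+s. a s * indicator {0..S} s + B (- S + 1 * s) \<partial>lborel)"
  proof (rule nn_integral_cong)
    fix s :: real
    have "ereal s \<le> ereal S + h" if "s \<le> S"
      using that h by (intro add_increasing2) auto
    then show "(if s \<le> S then a s else b (s - S)) * indicator {s. 0 \<le> s \<and> ereal s \<le> ereal S + h} s
        = a s * indicator {0..S} s + B (- S + 1 * s)"
      using S shift[of s] by (auto simp: B_def indicator_def)
  qed
  also have "\<dots> = (\<integral>\<^sup>+s. a s * indicator {0..S} s \<partial>lborel) + (\<integral>\<^sup>+s. B (- S + 1 * s) \<partial>lborel)"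
    by (rule nn_integral_add) (use a1 in auto)
  also have "(\<integral>\<^sup>+s. B (- S + 1 * s) \<partial>lborel) = (\<integral>\<^sup>+s. B s \<partial>lborel)"
    using nn_integral_real_affine[OF B_meas, of 1 "- S"] by simp
  also have "\<dots> = (\<integral>\<^sup>+s\<in>H. b s \<partial>lborel)"
  proof (rule nn_integral_cong_AE)
    show "AE s in lborel. B s = b s * indicator H s"
      using AE_lborel_singleton[of 0]
      by eventually_elim (auto simp: B_def H_def indicator_def)
  qed
  also have "(\<integral>\<^sup>+s. a s * indicator {0..S} s \<partial>lborel) = (\<integral>\<^sup>+s\<in>{s. 0 \<le> s \<and> ereal s \<le> ereal S}. a s \<partial>lborel)"
    by (rule nn_integral_cong) (auto simp: indicator_def)
  finally show ?thesis unfolding H_def .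
qed

lemma modulus_small:
  assumes "modulus \<omega>" "0 < R" "0 < \<epsilon>"
  obtains d where "0 < d" "\<And>r. 0 \<le> r \<Longrightarrow> r < d \<Longrightarrow> \<omega> r R \<le> \<epsilon>"
proof -
  have c: "continuous (at 0 within {0..}) (\<lambda>r. \<omega> r R)" and z: "\<omega> 0 R = 0"
    using assms(1,2) unfolding modulus_def by blast+
  from c[unfolded continuous_within_eps_delta, rule_format, OF \<open>0 < \<epsilon>\<close>] obtain d where
    "0 < d" "\<And>r. r \<in> {0..} \<Longrightarrow> dist r 0 < d \<Longrightarrow> dist (\<omega> r R) (\<omega> 0 R) < \<epsilon>" by blast
  then show thesis
    using z by (intro that[of d]) (force simp: dist_real_def)+
qed

context control_data
begin

text \<open>The dynamics and the cost depend on time only through the control, so the second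
  control, restarted at the end point of the first piece, continues the trajectory.\<close>

lemma ext_control_concat:
  assumes u: "(u\<^sub>0, u) \<in> \<Gamma>" and v: "(v\<^sub>0, v) \<in> \<Gamma>" and S: "0 \<le> S"
    and w\<^sub>0: "w\<^sub>0 = (\<lambda>s. if s \<le> S then u\<^sub>0 s else v\<^sub>0 (s - S))"
    and w: "w = (\<lambda>s. if s \<le> S then u s else v (s - S))"
  shows "(w\<^sub>0, w) \<in> \<Gamma>"
    and "0 \<le> h \<Longrightarrow> J (ereal S + h) x w\<^sub>0 w = J (ereal S) x u\<^sub>0 u + J h (\<xi> x u\<^sub>0 u S) v\<^sub>0 v"
proof -
  have um: "u\<^sub>0 \<in> borel_measurable (restrict_space borel {0..})"
     "u \<in> borel_measurable (restrict_space borel {0..})"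
    and vm: "v\<^sub>0 \<in> borel_measurable (restrict_space borel {0..})"
     "v \<in> borel_measurable (restrict_space borel {0..})"
    and us: "\<And>s. 0 \<le> s \<Longrightarrow> (u\<^sub>0 s, u s) \<in> ext_control_set q A"
    and vs: "\<And>s. 0 \<le> s \<Longrightarrow> (v\<^sub>0 s, v s) \<in> ext_control_set q A"
    using u v by (auto simp: ext_controls_iff)
  have meas: "(\<lambda>s. if s \<le> S then a s else b (s - S)) \<in> borel_measurable (restrict_space borel {0..})"
    if [measurable]: "a \<in> borel_measurable (restrict_space borel {0..})"
      and b: "b \<in> borel_measurable (restrict_space borel {0..})"
    for a b :: "real \<Rightarrow> 'c::euclidean_space"
  proof -
    \<comment> \<open>Truncating the shift at 0 keeps the argument in the half-line, where
      \<open>b\<close> is known to be measurable; for \<open>s > S\<close> nothing changes.\<close>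
    have "(\<lambda>s. max 0 (s - S)) \<in> measurable borel (restrict_space borel {0..})"
      by (rule measurable_restrict_space2) auto
    from measurable_compose[OF this b]
    have [measurable]: "(\<lambda>s. b (max 0 (s - S))) \<in> borel_measurable (restrict_space borel {0..})"
      by (rule measurable_restrict_space1)
    have [measurable]: "Measurable.pred (restrict_space borel {0..}) (\<lambda>s. s \<le> S)"
      by (rule measurable_restrict_space1) measurable
    have "(\<lambda>s. if s \<le> S then a s else b (max 0 (s - S))) \<in> borel_measurable (restrict_space borel {0..})"
      by measurable
    also have "(\<lambda>s. if s \<le> S then a s else b (max 0 (s - S))) = (\<lambda>s. if s \<le> S then a s else b (s - S))"
      by (auto simp: fun_eq_iff max_def)
    finally show ?thesis .
  qed
  show W: "(w\<^sub>0, w) \<in> \<Gamma>"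
    unfolding ext_controls_iff w\<^sub>0 w using meas[OF um(1) vm(1)] meas[OF um(2) vm(2)] us vs by auto
  define z where "z = \<xi> x u\<^sub>0 u S"
  define y where "y s = (if s \<le> S then \<xi> x u\<^sub>0 u s else \<xi> z v\<^sub>0 v (s - S))" for s
  have su: "ode_solution (\<lambda>s z. F z (u\<^sub>0 s) (u s)) x (\<xi> x u\<^sub>0 u)" by (rule ext_traj_solution[OF u])
  have sv: "ode_solution (\<lambda>s z. F z (v\<^sub>0 s) (v s)) z (\<xi> z v\<^sub>0 v)" by (rule ext_traj_solution[OF v])
  have v0: "\<xi> z v\<^sub>0 v 0 = z"
  proof -
    have "\<xi> z v\<^sub>0 v 0 = z + (LINT s:{0..0}|lborel. F (\<xi> z v\<^sub>0 v s) (v\<^sub>0 s) (v s))"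
      using sv unfolding ode_solution_def by blast
    then show ?thesis by (simp only: LINT_Icc_self add_0_right)
  qed
  have yF: "F (y s) (w\<^sub>0 s) (w s) = (if s \<le> S then F (\<xi> x u\<^sub>0 u s) (u\<^sub>0 s) (u s)
      else F (\<xi> z v\<^sub>0 v (s - S)) (v\<^sub>0 (s - S)) (v (s - S)))" for s
    by (simp add: y_def w\<^sub>0 w)
  have "ode_solution (\<lambda>s z. F z (w\<^sub>0 s) (w s)) x y"
    unfolding ode_solution_def
  proof (intro conjI allI impI)
    have "continuous_on ({0..S} \<union> {S..}) y"
      unfolding y_def
    proof (rule continuous_on_If)
      show "continuous_on {0..S} (\<xi> x u\<^sub>0 u)"
        by (rule continuous_on_subset[OF continuous_on_ext_traj[OF u]]) auto
      show "continuous_on {S..} (\<lambda>s. \<xi> z v\<^sub>0 v (s - S))"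
        by (rule continuous_on_compose2[OF continuous_on_ext_traj[OF v]]) (auto intro!: continuous_intros)
    qed (auto simp: v0 z_def[symmetric])
    also have "{0..S} \<union> {S..} = {0..}" using S by auto
    finally show "continuous_on {0..} y" .
    fix t :: real assume t: "0 \<le> t"
    have "set_integrable lborel {0..t} (\<lambda>s. F (y s) (w\<^sub>0 s) (w s)) \<and>
      y t = x + (LINT s:{0..t}|lborel. F (y s) (w\<^sub>0 s) (w s))"
    proof (cases "t \<le> S")
      case True
      have "set_integrable lborel {0..t} (\<lambda>s. F (y s) (w\<^sub>0 s) (w s))
          \<longleftrightarrow> set_integrable lborel {0..t} (\<lambda>s. F (\<xi> x u\<^sub>0 u s) (u\<^sub>0 s) (u s))"
        using True by (intro set_integrable_cong) (auto simp: yF)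
      moreover have "(LINT s:{0..t}|lborel. F (y s) (w\<^sub>0 s) (w s))
          = (LINT s:{0..t}|lborel. F (\<xi> x u\<^sub>0 u s) (u\<^sub>0 s) (u s))"
        using True by (intro set_lebesgue_integral_cong) (auto simp: yF)
      ultimately show ?thesis using su t True unfolding ode_solution_def by (simp add: y_def)
    next
      case False
      then have h: "0 \<le> t - S" by simp
      have iu: "set_integrable lborel {0..S} (\<lambda>s. F (\<xi> x u\<^sub>0 u s) (u\<^sub>0 s) (u s))"
        and zu: "z = x + (LINT s:{0..S}|lborel. F (\<xi> x u\<^sub>0 u s) (u\<^sub>0 s) (u s))"
        using su S unfolding ode_solution_def z_def by blast+
      have iv: "set_integrable lborel {0..t - S} (\<lambda>s. F (\<xi> z v\<^sub>0 v s) (v\<^sub>0 s) (v s))"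
        and zv: "\<xi> z v\<^sub>0 v (t - S) = z + (LINT s:{0..t - S}|lborel. F (\<xi> z v\<^sub>0 v s) (v\<^sub>0 s) (v s))"
        using sv h unfolding ode_solution_def by blast+
      have "y t = \<xi> z v\<^sub>0 v (t - S)" using False by (simp add: y_def)
      then show ?thesis
        using LINT_concat[OF iu iv S h] zu zv unfolding yF by simp
    qed
    then show "set_integrable lborel {0..t} (\<lambda>s. F (y s) (w\<^sub>0 s) (w s))"
      "y t = x + (LINT s:{0..t}|lborel. F (y s) (w\<^sub>0 s) (w s))" by blast+
  qed
  note traj = ext_traj_eqI[OF W this]
  have yL: "L (y s) (w\<^sub>0 s) (w s) = (if s \<le> S then L (\<xi> x u\<^sub>0 u s) (u\<^sub>0 s) (u s)
      else L (\<xi> z v\<^sub>0 v (s - S)) (v\<^sub>0 (s - S)) (v (s - S)))" for s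
    by (simp add: y_def w\<^sub>0 w)
  show "J (ereal S + h) x w\<^sub>0 w = J (ereal S) x u\<^sub>0 u + J h (\<xi> x u\<^sub>0 u S) v\<^sub>0 v" if h: "0 \<le> h"
  proof -
    have "J (ereal S + h) x w\<^sub>0 w = (\<integral>\<^sup>+s\<in>{s. 0 \<le> s \<and> ereal s \<le> ereal S + h}.
        (if s \<le> S then ennreal (L (\<xi> x u\<^sub>0 u s) (u\<^sub>0 s) (u s))
         else ennreal (L (\<xi> z v\<^sub>0 v (s - S)) (v\<^sub>0 (s - S)) (v (s - S)))) \<partial>lborel)"
      unfolding ext_cost_def
      by (rule nn_integral_cong) (simp add: traj yL split: split_indicator)
    also have "\<dots> = J (ereal S) x u\<^sub>0 u + J h z v\<^sub>0 v"
      unfolding ext_cost_def by (rule nn_integral_concat[OF J_measurable[OF u] J_measurable[OF v] S h])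
    finally show ?thesis unfolding z_def .
  qed
qed

text \<open>The constants depend on \<open>r\<close>, \<open>T\<close> and \<open>\<epsilon>\<close>
  only, since all trajectories up to time \<open>T\<close> stay in one ball of radius
  \<open>R\<close> whatever the control. It serves twice: with one control and two initial points
  for continuity of the value, and with one initial point and two nearby controls for the
  perturbation.\<close>

lemma stability:
  assumes "0 \<le> r" "0 \<le> T" "0 < \<epsilon>"
  obtains \<delta> R where "0 < \<delta>" "0 < R"
    "\<And>x\<^sub>1 x\<^sub>2 u\<^sub>0 u v\<^sub>0 v S. \<lbrakk>norm x\<^sub>1 \<le> r; norm x\<^sub>2 \<le> r; (u\<^sub>0, u) \<in> \<Gamma>; (v\<^sub>0, v) \<in> \<Gamma>; 0 \<le> S; S \<le> T;
        norm (x\<^sub>1 - x\<^sub>2) \<le> \<delta>;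
        \<And>s z. 0 \<le> s \<Longrightarrow> s \<le> S \<Longrightarrow> norm z \<le> R \<Longrightarrow> norm (F z (u\<^sub>0 s) (u s) - F z (v\<^sub>0 s) (v s)) \<le> \<delta>;
        \<And>s z. 0 \<le> s \<Longrightarrow> s \<le> S \<Longrightarrow> norm z \<le> R \<Longrightarrow> \<bar>L z (u\<^sub>0 s) (u s) - L z (v\<^sub>0 s) (v s)\<bar> \<le> \<delta>\<rbrakk> \<Longrightarrow>
      (\<forall>s\<in>{0..S}. norm (\<xi> x\<^sub>1 u\<^sub>0 u s - \<xi> x\<^sub>2 v\<^sub>0 v s) \<le> \<epsilon>) \<and> J (ereal S) x\<^sub>1 u\<^sub>0 u \<le> J (ereal S) x\<^sub>2 v\<^sub>0 v + ennreal \<epsilon>"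
proof -
  interpret time_change "\<lambda>_. 1" by (rule time_change_1)
  define R where "R = 2 * (1 + r) * exp (4 * M * T)"
  have R: "0 < R" using assms by (simp add: R_def)
  define K where "K = 2 * Lip R"
  have K: "0 < K" using pos(2)[OF R] by (simp add: K_def)
  define E where "E = exp (2 * K * T)"
  have E: "0 < E" by (simp add: E_def)
  have half: "0 < \<epsilon> / (2 * (T + 1))" using assms by simp
  obtain d where d: "0 < d" "\<And>r. 0 \<le> r \<Longrightarrow> r < d \<Longrightarrow> \<omega> r R \<le> \<epsilon> / (2 * (T + 1))"
    using modulus_small[OF \<omega> R half] by blast
  \<comment> \<open>Keeping the trajectories closer than \<open>d\<close> brings their distance into
    the range where the modulus is small.\<close>
  define \<epsilon>' where "\<epsilon>' = min \<epsilon> (d / 2)"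
  have \<epsilon>': "0 < \<epsilon>'" "\<epsilon>' \<le> \<epsilon>" "\<epsilon>' < d" using d(1) assms(3) by (auto simp: \<epsilon>'_def min_def)
  \<comment> \<open>The first bound inverts the Gronwall estimate
    \<open>2 * (\<delta> * (1 + T)) * E\<close>, where \<open>1 + T\<close> collects the initial
    error and the error of the dynamics accumulated over time at most \<open>T\<close>. The second
    allots half of the running-cost error \<open>\<epsilon> / (T + 1)\<close> to the change of
    control, the other half going to the modulus.\<close>
  define \<delta> where "\<delta> = min (\<epsilon>' / (2 * (1 + T) * E)) (\<epsilon> / (2 * (T + 1)))"
  have \<delta>: "0 < \<delta>" "\<delta> \<le> \<epsilon>' / (2 * (1 + T) * E)" "\<delta> \<le> \<epsilon> / (2 * (T + 1))"
    using half E \<epsilon>' assms by (auto simp: \<delta>_def)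
  show thesis
  proof (rule that[of \<delta> R])
    show "0 < \<delta>" "0 < R" by fact+
    fix x\<^sub>1 x\<^sub>2 :: 'x and u\<^sub>0 u v\<^sub>0 v and S :: real
    assume x: "norm x\<^sub>1 \<le> r" "norm x\<^sub>2 \<le> r" and u: "(u\<^sub>0, u) \<in> \<Gamma>" and v: "(v\<^sub>0, v) \<in> \<Gamma>"
      and S: "0 \<le> S" "S \<le> T" and xd: "norm (x\<^sub>1 - x\<^sub>2) \<le> \<delta>"
      and Fd: "\<And>s z. 0 \<le> s \<Longrightarrow> s \<le> S \<Longrightarrow> norm z \<le> R \<Longrightarrow> norm (F z (u\<^sub>0 s) (u s) - F z (v\<^sub>0 s) (v s)) \<le> \<delta>"
      and Ld: "\<And>s z. 0 \<le> s \<Longrightarrow> s \<le> S \<Longrightarrow> norm z \<le> R \<Longrightarrow> \<bar>L z (u\<^sub>0 s) (u s) - L z (v\<^sub>0 s) (v s)\<bar> \<le> \<delta>"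
    define y where "y = \<xi> x\<^sub>1 u\<^sub>0 u"
    define z where "z = \<xi> x\<^sub>2 v\<^sub>0 v"
    have us: "\<And>s. 0 \<le> s \<Longrightarrow> (u\<^sub>0 s, u s) \<in> ext_control_set q A"
      and vs: "\<And>s. 0 \<le> s \<Longrightarrow> (v\<^sub>0 s, v s) \<in> ext_control_set q A"
      using u v by (auto simp: ext_controls_iff)
    have bound: "2 * (1 + norm x) * exp (4 * M * s) \<le> R" if "norm x \<le> r" "s \<in> {0..S}" for x :: 'x and s
      unfolding R_def using that S pos(1) assms(1) by (intro mult_mono) auto
    have yR: "norm (y s) \<le> R" and zR: "norm (z s) \<le> R" if "s \<in> {0..S}" for s
      using ext_traj_bound[OF u, of s x\<^sub>1] ext_traj_bound[OF v, of s x\<^sub>2] bound[OF x(1) that] bound[OF x(2) that] that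
      by (auto simp: y_def z_def)
    have sy: "ode_solution (\<lambda>s z. F z (u\<^sub>0 s) (u s)) x\<^sub>1 y" unfolding y_def by (rule ext_traj_solution[OF u])
    have sz: "ode_solution (\<lambda>s z. F z (v\<^sub>0 s) (v s)) x\<^sub>2 z" unfolding z_def by (rule ext_traj_solution[OF v])
    have cont: "continuous_on {0..S} (\<lambda>s. norm (y s - z s))"
      unfolding y_def z_def
      by (intro continuous_intros continuous_on_subset[OF continuous_on_ext_traj[OF u]]
          continuous_on_subset[OF continuous_on_ext_traj[OF v]]) auto
    have step: "norm (y t - z t) \<le> \<delta> * (1 + T) + K * (LINT s:{0..t}|lborel. 1 * norm (y s - z s))"
      if t: "t \<in> {0..S}" for t
    proof -
      have iy: "set_integrable lborel {0..t} (\<lambda>s. F (y s) (u\<^sub>0 s) (u s))"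
        and ey: "y t = x\<^sub>1 + (LINT s:{0..t}|lborel. F (y s) (u\<^sub>0 s) (u s))"
        using sy t by (auto simp: ode_solution_def)
      have iz: "set_integrable lborel {0..t} (\<lambda>s. F (z s) (v\<^sub>0 s) (v s))"
        and ez: "z t = x\<^sub>2 + (LINT s:{0..t}|lborel. F (z s) (v\<^sub>0 s) (v s))"
        using sz t by (auto simp: ode_solution_def)
      have n: "set_integrable lborel {0..t} (\<lambda>s. norm (y s - z s))"
        by (rule borel_integrable_atLeastAtMost') (use cont t in \<open>auto elim: continuous_on_subset\<close>)
      have c: "set_integrable lborel {0..t} (\<lambda>s. \<delta>)"
        by (rule borel_integrable_atLeastAtMost') auto
      have "norm (LINT s:{0..t}|lborel. F (y s) (u\<^sub>0 s) (u s) - F (z s) (v\<^sub>0 s) (v s))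
          \<le> (LINT s:{0..t}|lborel. K * norm (y s - z s) + \<delta>)"
      proof (rule norm_LINT_le)
        show "set_integrable lborel {0..t} (\<lambda>s. F (y s) (u\<^sub>0 s) (u s) - F (z s) (v\<^sub>0 s) (v s))"
          using iy iz by (rule set_integral_diff)
        show "set_integrable lborel {0..t} (\<lambda>s. K * norm (y s - z s) + \<delta>)"
          using n c by (intro set_integral_add) auto
        fix s assume "s \<in> {0..t}"
        then have s: "s \<in> {0..S}" "0 \<le> s" "s \<le> S" using t by auto
        have "norm (F (y s) (u\<^sub>0 s) (u s) - F (z s) (u\<^sub>0 s) (u s)) \<le> K * norm (y s - z s)"
          unfolding K_def by (rule F_lipschitz[OF us[OF s(2)] R yR[OF s(1)] zR[OF s(1)]])
        moreover have "norm (F (z s) (u\<^sub>0 s) (u s) - F (z s) (v\<^sub>0 s) (v s)) \<le> \<delta>"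
          by (rule Fd[OF s(2,3) zR[OF s(1)]])
        ultimately show "norm (F (y s) (u\<^sub>0 s) (u s) - F (z s) (v\<^sub>0 s) (v s)) \<le> K * norm (y s - z s) + \<delta>"
          by (rule norm_diff_triangle_le)
      qed
      also have "\<dots> = K * (LINT s:{0..t}|lborel. norm (y s - z s)) + (LINT s:{0..t}|lborel. \<delta>)"
        using n c by (subst set_integral_add) auto
      also have "(LINT s:{0..t}|lborel. \<delta>) = t * \<delta>"
        using t by (simp add: set_lebesgue_integral_def)
      also have "t * \<delta> \<le> T * \<delta>" using t S \<delta>(1) by (intro mult_right_mono) auto
      finally have "norm (LINT s:{0..t}|lborel. F (y s) (u\<^sub>0 s) (u s) - F (z s) (v\<^sub>0 s) (v s))
          \<le> K * (LINT s:{0..t}|lborel. norm (y s - z s)) + T * \<delta>" by simp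
      moreover have "y t - z t = (x\<^sub>1 - x\<^sub>2) + (LINT s:{0..t}|lborel. F (y s) (u\<^sub>0 s) (u s) - F (z s) (v\<^sub>0 s) (v s))"
        using ey ez iy iz by simp
      ultimately have "norm (y t - z t) \<le> \<delta> + (K * (LINT s:{0..t}|lborel. norm (y s - z s)) + T * \<delta>)"
        using xd norm_triangle_mono[OF xd] by simp
      then show ?thesis by (simp add: algebra_simps)
    qed
    have close: "norm (y s - z s) \<le> \<epsilon>'" if s: "s \<in> {0..S}" for s
    proof -
      have "norm (y s - z s) \<le> 2 * (\<delta> * (1 + T)) * exp (2 * K * clock s)"
        using gronwall[OF cont _ K _ step s] \<delta>(1) assms(2) by simp
      also have "clock s = s" using s by (intro clock_1) auto
      also have "2 * (\<delta> * (1 + T)) * exp (2 * K * s) \<le> 2 * (\<delta> * (1 + T)) * E"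
        unfolding E_def using \<delta>(1) assms(2) K s S by (intro mult_left_mono) auto
      also have "\<dots> = \<delta> * (2 * (1 + T) * E)" by simp
      also have "\<dots> \<le> \<epsilon>' / (2 * (1 + T) * E) * (2 * (1 + T) * E)"
        using \<delta>(2) E assms(2) by (intro mult_right_mono) auto
      also have "\<dots> = \<epsilon>'" using E assms(2) by simp
      finally show ?thesis .
    qed
    have cst: "ennreal (L (y s) (u\<^sub>0 s) (u s)) \<le> ennreal (L (z s) (v\<^sub>0 s) (v s)) + ennreal (\<epsilon> / (T + 1))"
      if s: "s \<in> {0..S}" for s
    proof -
      from s have s': "0 \<le> s" "s \<le> S" by auto
      have "\<bar>L (y s) (u\<^sub>0 s) (u s) - L (z s) (u\<^sub>0 s) (u s)\<bar> \<le> \<omega> (norm (y s - z s)) R"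
        by (rule L_modulus[OF us[OF s'(1)] R yR[OF s] zR[OF s]])
      also have "\<dots> \<le> \<epsilon> / (2 * (T + 1))"
        by (rule d(2)) (use close[OF s] \<epsilon>'(3) in auto)
      finally have "L (y s) (u\<^sub>0 s) (u s) \<le> L (z s) (v\<^sub>0 s) (v s) + (\<epsilon> / (2 * (T + 1)) + \<epsilon> / (2 * (T + 1)))"
        using Ld[OF s' zR[OF s]] \<delta>(3) by linarith
      also have "\<epsilon> / (2 * (T + 1)) + \<epsilon> / (2 * (T + 1)) = \<epsilon> / (T + 1)"
      proof -
        have "\<epsilon> / (2 * (T + 1)) = \<epsilon> / (T + 1) / 2" by (simp only: divide_divide_eq_left mult.commute)
        then show ?thesis by (simp only: field_sum_of_halves)
      qed
      finally have "ennreal (L (y s) (u\<^sub>0 s) (u s)) \<le> ennreal (L (z s) (v\<^sub>0 s) (v s) + \<epsilon> / (T + 1))"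
        by (rule ennreal_leI)
      also have "\<dots> = ennreal (L (z s) (v\<^sub>0 s) (v s)) + ennreal (\<epsilon> / (T + 1))"
        using assms by (intro ennreal_plus L_nonneg[OF vs[OF s'(1)]]) auto
      finally show ?thesis .
    qed
    have Lv [measurable]: "(\<lambda>s. ennreal (L (z s) (v\<^sub>0 s) (v s)) * indicator {0..S} s) \<in> borel_measurable borel"
    proof -
      have [measurable]: "(\<lambda>s. ennreal (L (z s) (v\<^sub>0 s) (v s)) * indicator {0..} s) \<in> borel_measurable borel"
        using J_measurable[OF v, of x\<^sub>2]
        by (subst (asm) borel_measurable_restrict_space_iff_ennreal) (auto simp: z_def)
      have "(\<lambda>s. (ennreal (L (z s) (v\<^sub>0 s) (v s)) * indicator {0..} s) * indicator {..S} s) \<in> borel_measurable borel"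
        by measurable
      also have "(\<lambda>s. (ennreal (L (z s) (v\<^sub>0 s) (v s)) * indicator {0..} s) * indicator {..S} s)
         = (\<lambda>s. ennreal (L (z s) (v\<^sub>0 s) (v s)) * indicator {0..S} s)"
        by (auto simp: fun_eq_iff split: split_indicator)
      finally show ?thesis .
    qed
    have "J (ereal S) x\<^sub>1 u\<^sub>0 u \<le> (\<integral>\<^sup>+s. ennreal (L (z s) (v\<^sub>0 s) (v s)) * indicator {0..S} s
        + ennreal (\<epsilon> / (T + 1)) * indicator {0..S} s \<partial>lborel)"
      unfolding J_fin y_def[symmetric]
      by (rule nn_integral_mono) (auto simp: cst split: split_indicator)
    also have "\<dots> = J (ereal S) x\<^sub>2 v\<^sub>0 v + (\<integral>\<^sup>+s. ennreal (\<epsilon> / (T + 1)) * indicator {0..S} s \<partial>lborel)"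
      unfolding J_fin z_def[symmetric] by (rule nn_integral_add) auto
    also have "(\<integral>\<^sup>+s. ennreal (\<epsilon> / (T + 1)) * indicator {0..S} s \<partial>lborel) = ennreal (\<epsilon> / (T + 1) * S)"
    proof -
      have "(\<integral>\<^sup>+s. ennreal (\<epsilon> / (T + 1)) * indicator {0..S} s \<partial>lborel) = ennreal (\<epsilon> / (T + 1)) * ennreal S"
        using S by (simp add: nn_integral_cmult_indicator)
      also have "\<dots> = ennreal (\<epsilon> / (T + 1) * S)"
        using S assms by (intro ennreal_mult[symmetric]) auto
      finally show ?thesis .
    qed
    also have "\<dots> \<le> ennreal \<epsilon>"
    proof (rule ennreal_leI)
      have "\<epsilon> / (T + 1) * S \<le> \<epsilon> / (T + 1) * (T + 1)"
        using S assms by (intro mult_left_mono) auto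
      then show "\<epsilon> / (T + 1) * S \<le> \<epsilon>" using assms(2) by simp
    qed
    finally have "J (ereal S) x\<^sub>1 u\<^sub>0 u \<le> J (ereal S) x\<^sub>2 v\<^sub>0 v + ennreal \<epsilon>" by (simp add: add_left_mono)
    with order_trans[OF close \<epsilon>'(2)] show "(\<forall>s\<in>{0..S}. norm (\<xi> x\<^sub>1 u\<^sub>0 u s - \<xi> x\<^sub>2 v\<^sub>0 v s) \<le> \<epsilon>)
      \<and> J (ereal S) x\<^sub>1 u\<^sub>0 u \<le> J (ereal S) x\<^sub>2 v\<^sub>0 v + ennreal \<epsilon>"
      by (auto simp: y_def z_def)
  qed
qed

text \<open>For small \<open>w\<^sub>0\<close> both values are compared with
  \<open>\<Phi>inf\<close>: two errors of \<open>\<eta> / 3\<close> come from the recession limit,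
  uniform on a compact set, and one from uniform continuity of \<open>\<Phi>inf\<close> there. The
  level 0 is included.\<close>

lemma extend_uniform:
  fixes \<Phi> \<Phi>inf :: "'x \<Rightarrow> 'a \<Rightarrow> 'b::euclidean_space"
  assumes rec: "recession_limit q A \<Phi> \<Phi>inf" and "0 < \<eta>"
  obtains \<rho> d where "0 < \<rho>" "0 < d"
    "\<And>z \<sigma> a \<sigma>' a'. \<lbrakk>norm z \<le> R; (\<sigma>, a) \<in> ext_control_set q A; (\<sigma>', a') \<in> ext_control_set q A;
        \<sigma> < \<rho>; \<sigma>' < \<rho>; norm (a - a') < d\<rbrakk> \<Longrightarrow>
      norm (extend q \<Phi> \<Phi>inf z \<sigma> a - extend q \<Phi> \<Phi>inf z \<sigma>' a') \<le> \<eta>"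
proof -
  define K where "K = cball (0::'x) R \<times> (A \<inter> cball 0 1)"
  have K: "compact K" "K \<subseteq> UNIV \<times> A"
    unfolding K_def using A(1) by (auto intro!: compact_Times closed_Int_compact)
  have cont: "continuous_on (UNIV \<times> A) (\<lambda>(x, a). \<Phi>inf x a)"
    and ulim: "\<And>K. compact K \<and> K \<subseteq> UNIV \<times> A \<Longrightarrow>
      uniform_limit K (\<lambda>\<rho> (x, a). \<rho> ^ q *\<^sub>R \<Phi> x (inverse \<rho> *\<^sub>R a)) (\<lambda>(x, a). \<Phi>inf x a) (at_right 0)"
    using rec by (simp_all only: recession_limit_def)
  have \<eta>3: "0 < \<eta> / 3" using assms(2) by simp
  have "uniformly_continuous_on K (\<lambda>(x, a). \<Phi>inf x a)"
    by (intro compact_uniformly_continuous continuous_on_subset[OF cont] K)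
  from this[unfolded uniformly_continuous_on_def, rule_format, OF \<eta>3] obtain d where d: "0 < d"
    "\<And>x x'. x \<in> K \<Longrightarrow> x' \<in> K \<Longrightarrow> dist x' x < d \<Longrightarrow>
        dist (case x' of (x, a) \<Rightarrow> \<Phi>inf x a) (case x of (x, a) \<Rightarrow> \<Phi>inf x a) < \<eta> / 3" by blast
  have "uniform_limit K (\<lambda>\<rho> (x, a). \<rho> ^ q *\<^sub>R \<Phi> x (inverse \<rho> *\<^sub>R a)) (\<lambda>(x, a). \<Phi>inf x a) (at_right 0)"
    using ulim K by blast
  from uniform_limitD[OF this \<eta>3]
  have "\<forall>\<^sub>F \<rho> in at_right 0. \<forall>x\<in>K. dist (case x of (x, a) \<Rightarrow> \<rho> ^ q *\<^sub>R \<Phi> x (inverse \<rho> *\<^sub>R a))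
      (case x of (x, a) \<Rightarrow> \<Phi>inf x a) < \<eta> / 3"
    by (simp only: case_prod_beta)
  then obtain \<rho> where \<rho>: "0 < \<rho>" "\<And>\<sigma> x. 0 < \<sigma> \<Longrightarrow> \<sigma> < \<rho> \<Longrightarrow> x \<in> K \<Longrightarrow>
      dist (case x of (x, a) \<Rightarrow> \<sigma> ^ q *\<^sub>R \<Phi> x (inverse \<sigma> *\<^sub>R a)) (case x of (x, a) \<Rightarrow> \<Phi>inf x a) < \<eta> / 3"
    unfolding eventually_at_right_field by blast
  have close: "norm (extend q \<Phi> \<Phi>inf z \<sigma> a - \<Phi>inf z a) \<le> \<eta> / 3"
    if "norm z \<le> R" "(\<sigma>, a) \<in> ext_control_set q A" "\<sigma> < \<rho>" for z \<sigma> a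
  proof (cases "\<sigma> = 0")
    case True
    then show ?thesis using \<eta>3 by (simp add: extend_def)
  next
    case False
    then have "0 < \<sigma>" using control_setD(1)[OF that(2)] by simp
    have "(z, a) \<in> K" using that control_setD(2,5)[OF that(2)] by (simp add: K_def)
    from \<rho>(2)[OF \<open>0 < \<sigma>\<close> that(3) this] show ?thesis
      using False by (simp add: extend_def dist_norm)
  qed
  show thesis
  proof (rule that[OF \<rho>(1) d(1)])
    fix z :: 'x and \<sigma> a \<sigma>' a'
    assume z: "norm z \<le> R" and a: "(\<sigma>, a) \<in> ext_control_set q A" and a': "(\<sigma>', a') \<in> ext_control_set q A"
      and \<sigma>: "\<sigma> < \<rho>" "\<sigma>' < \<rho>" and aa': "norm (a - a') < d"
    have "(z, a) \<in> K" "(z, a') \<in> K"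
      using z control_setD(2,5)[OF a] control_setD(2,5)[OF a'] by (simp_all add: K_def)
    moreover have "dist (z, a) (z, a') < d" using aa' by (simp add: dist_Pair_Pair dist_norm)
    ultimately have "norm (\<Phi>inf z a - \<Phi>inf z a') < \<eta> / 3"
      using d(2)[of "(z, a')" "(z, a)"] by (simp add: dist_norm)
    with close[OF z a \<sigma>(1)] close[OF z a' \<sigma>(2)]
    show "norm (extend q \<Phi> \<Phi>inf z \<sigma> a - extend q \<Phi> \<Phi>inf z \<sigma>' a') \<le> \<eta>"
      by norm
  qed
qed

text \<open>The control is altered only where \<open>w\<^sub>0 < \<rho>\<close>, by fixing
  \<open>w\<^sub>0 = \<rho>\<close> and rescaling \<open>w\<close> along its own ray, so that the
  cone is not left. The lower bound \<open>\<rho>\<close> holds on the whole half-line, which keeps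
  the clock unbounded, although the estimates reach only up to \<open>S\<close>.\<close>

lemma approx_by_positive:
  assumes w: "(w\<^sub>0, w) \<in> \<Gamma>" and S: "0 \<le> S" and "0 < \<epsilon>"
  obtains v\<^sub>0 v \<rho> where "(v\<^sub>0, v) \<in> \<Gamma>" "0 < \<rho>" "\<And>s. 0 \<le> s \<Longrightarrow> \<rho> \<le> v\<^sub>0 s" "\<And>s. 0 \<le> s \<Longrightarrow> w\<^sub>0 s \<le> v\<^sub>0 s"
    "norm (\<xi> x v\<^sub>0 v S - \<xi> x w\<^sub>0 w S) \<le> \<epsilon>"
    "J (ereal S) x v\<^sub>0 v \<le> J (ereal S) x w\<^sub>0 w + ennreal \<epsilon>"
proof -
  obtain \<delta> R where \<delta>: "0 < \<delta>" "0 < R" and stab: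
    "\<And>x\<^sub>1 x\<^sub>2 u\<^sub>0 u v\<^sub>0 v S'. \<lbrakk>norm x\<^sub>1 \<le> norm x; norm x\<^sub>2 \<le> norm x; (u\<^sub>0, u) \<in> \<Gamma>; (v\<^sub>0, v) \<in> \<Gamma>; 0 \<le> S'; S' \<le> S;
        norm (x\<^sub>1 - x\<^sub>2) \<le> \<delta>;
        \<And>s z. 0 \<le> s \<Longrightarrow> s \<le> S' \<Longrightarrow> norm z \<le> R \<Longrightarrow> norm (F z (u\<^sub>0 s) (u s) - F z (v\<^sub>0 s) (v s)) \<le> \<delta>;
        \<And>s z. 0 \<le> s \<Longrightarrow> s \<le> S' \<Longrightarrow> norm z \<le> R \<Longrightarrow> \<bar>L z (u\<^sub>0 s) (u s) - L z (v\<^sub>0 s) (v s)\<bar> \<le> \<delta>\<rbrakk> \<Longrightarrow>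
      (\<forall>s\<in>{0..S'}. norm (\<xi> x\<^sub>1 u\<^sub>0 u s - \<xi> x\<^sub>2 v\<^sub>0 v s) \<le> \<epsilon>) \<and> J (ereal S') x\<^sub>1 u\<^sub>0 u \<le> J (ereal S') x\<^sub>2 v\<^sub>0 v + ennreal \<epsilon>"
    using stability[OF norm_ge_zero[of x] S assms(3)] by blast
  obtain \<rho>f df where f': "0 < \<rho>f" "0 < df" "\<And>z \<sigma> a \<sigma>' a'. \<lbrakk>norm z \<le> R; (\<sigma>, a) \<in> ext_control_set q A;
        (\<sigma>', a') \<in> ext_control_set q A; \<sigma> < \<rho>f; \<sigma>' < \<rho>f; norm (a - a') < df\<rbrakk> \<Longrightarrow>
      norm (F z \<sigma> a - F z \<sigma>' a') \<le> \<delta>"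
    using extend_uniform[OF finf \<delta>(1), of R] by blast
  obtain \<rho>l dl where l': "0 < \<rho>l" "0 < dl" "\<And>z \<sigma> a \<sigma>' a'. \<lbrakk>norm z \<le> R; (\<sigma>, a) \<in> ext_control_set q A;
        (\<sigma>', a') \<in> ext_control_set q A; \<sigma> < \<rho>l; \<sigma>' < \<rho>l; norm (a - a') < dl\<rbrakk> \<Longrightarrow>
      norm (L z \<sigma> a - L z \<sigma>' a') \<le> \<delta>"
    using extend_uniform[OF linf \<delta>(1), of R] by blast
  define d where "d = min df dl"
  have d: "0 < d" using f' l' by (simp add: d_def)
  \<comment> \<open>This root is the norm that the normalisation forces on \<open>w\<close> once
    \<open>w\<^sub>0 = \<rho>\<close>; it tends to 1, so a small \<open>\<rho>\<close> makes the
    change of \<open>w\<close> smaller than \<open>d\<close>.\<close>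
  have "((\<lambda>\<rho>. root q (1 - \<rho> ^ q)) \<longlongrightarrow> root q (1 - 0 ^ q)) (at_right 0)"
    by (intro tendsto_intros)
  then have "((\<lambda>\<rho>. root q (1 - \<rho> ^ q)) \<longlongrightarrow> 1) (at_right 0)" using q_pos by (simp add: zero_power)
  then have "\<forall>\<^sub>F \<rho> in at_right 0. 1 - d < root q (1 - \<rho> ^ q)"
    using d by (intro order_tendstoD) auto
  moreover have "\<forall>\<^sub>F \<rho> in at_right 0. \<rho> < min 1 (min \<rho>f \<rho>l) \<and> 0 < (\<rho>::real)"
    unfolding eventually_at_right_field
    using f'(1) l'(1) by (intro exI[of _ "min 1 (min \<rho>f \<rho>l)"]) auto
  ultimately have "\<forall>\<^sub>F \<rho> in at_right 0. 1 - d < root q (1 - \<rho> ^ q) \<and> \<rho> < min 1 (min \<rho>f \<rho>l) \<and> 0 < (\<rho>::real)"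
    by eventually_elim simp
  then obtain \<rho> where \<rho>': "1 - d < root q (1 - \<rho> ^ q) \<and> \<rho> < min 1 (min \<rho>f \<rho>l) \<and> 0 < (\<rho>::real)"
    using eventually_happens trivial_limit_at_right_real by blast
  have wm [measurable]: "w\<^sub>0 \<in> borel_measurable (restrict_space borel {0..})"
     "w \<in> borel_measurable (restrict_space borel {0..})"
    and ws: "\<And>s. 0 \<le> s \<Longrightarrow> (w\<^sub>0 s, w s) \<in> ext_control_set q A"
    using w by (auto simp: ext_controls_iff)
  define b where "b = root q (1 - \<rho> ^ q)"
  have \<rho>: "0 < \<rho>" "\<rho> < 1" "\<rho> < \<rho>f" "\<rho> < \<rho>l" "1 - d < b" using \<rho>' by (auto simp: b_def)
  have \<rho>q: "\<rho> ^ q < 1" using \<rho> q_pos by (simp add: power_less_one_iff)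
  have b: "0 < b" "b ^ q = 1 - \<rho> ^ q" using \<rho>q q_pos by (auto simp: b_def)
  define v\<^sub>0 where "v\<^sub>0 s = (if w\<^sub>0 s < \<rho> then \<rho> else w\<^sub>0 s)" for s
  define v where "v s = (if w\<^sub>0 s < \<rho> then (b * inverse (norm (w s))) *\<^sub>R w s else w s)" for s
  \<comment> \<open>Where \<open>w\<^sub>0\<close> is raised, \<open>w\<close> is nonzero and has
    norm between \<open>b\<close> and 1. Normalising it is therefore legitimate and moves it by at
    most \<open>1 - b\<close>.\<close>
  have small: "b \<le> norm (w s)" if "0 \<le> s" "w\<^sub>0 s < \<rho>" for s
  proof -
    have "w\<^sub>0 s ^ q \<le> \<rho> ^ q" using that control_setD(1)[OF ws] by (intro power_mono) auto
    then have "b ^ q \<le> norm (w s) ^ q" using b(2) control_setD(3)[OF ws[OF that(1)]] by simp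
    then show ?thesis using power_le_imp_le_base[of b "q - 1"] q_pos by simp
  qed
  have vs: "(v\<^sub>0 s, v s) \<in> ext_control_set q A" if "0 \<le> s" for s
  proof (cases "w\<^sub>0 s < \<rho>")
    case True
    have "norm (w s) > 0" by (rule less_le_trans[OF b(1) small[OF that True]])
    then have "norm (v s) = b" using True b by (simp add: v_def)
    moreover have "v s \<in> A"
      using True b control_setD(2)[OF ws[OF that]] by (auto simp: v_def intro!: scale_in_A)
    ultimately show ?thesis using True b \<rho> by (simp add: ext_control_set_def v\<^sub>0_def)
  next
    case False
    then show ?thesis using ws[OF that] by (simp add: v\<^sub>0_def v_def)
  qed
  have v: "(v\<^sub>0, v) \<in> \<Gamma>"
    unfolding ext_controls_iff
  proof (intro conjI allI impI)
    show "v\<^sub>0 \<in> borel_measurable (restrict_space borel {0..})"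
      unfolding v\<^sub>0_def by measurable
    show "v \<in> borel_measurable (restrict_space borel {0..})"
      unfolding v_def by measurable
  qed (rule vs)
  have close: "norm (v s - w s) < d" if "0 \<le> s" "w\<^sub>0 s < \<rho>" for s
  proof -
    have n: "norm (w s) > 0" by (rule less_le_trans[OF b(1) small[OF that]])
    have "v s - w s = (b * inverse (norm (w s)) - 1) *\<^sub>R w s"
      using that by (simp add: v_def scaleR_diff_left)
    then have "norm (v s - w s) = \<bar>b * inverse (norm (w s)) - 1\<bar> * norm (w s)" by simp
    also have "\<dots> = \<bar>(b * inverse (norm (w s)) - 1) * norm (w s)\<bar>" by (simp add: abs_mult)
    also have "(b * inverse (norm (w s)) - 1) * norm (w s) = b - norm (w s)"
      using n by (simp add: algebra_simps)
    finally have "norm (v s - w s) = \<bar>b - norm (w s)\<bar>" .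
    then show ?thesis using small[OF that] control_setD(5)[OF ws[OF that(1)]] \<rho>(5) by simp
  qed
  have "(\<forall>s\<in>{0..S}. norm (\<xi> x v\<^sub>0 v s - \<xi> x w\<^sub>0 w s) \<le> \<epsilon>) \<and> J (ereal S) x v\<^sub>0 v \<le> J (ereal S) x w\<^sub>0 w + ennreal \<epsilon>"
  proof (rule stab[OF order_refl order_refl v w S order_refl])
    show "norm (x - x) \<le> \<delta>" using \<delta> by simp
    fix s :: real and z :: 'x
    assume s: "0 \<le> s" and z: "norm z \<le> R"
    show "norm (F z (v\<^sub>0 s) (v s) - F z (w\<^sub>0 s) (w s)) \<le> \<delta>"
    proof (cases "w\<^sub>0 s < \<rho>")
      case True
      show ?thesis
        by (rule f'(3)[OF z vs[OF s] ws[OF s]]) (use True \<rho> close[OF s True] in \<open>auto simp: v\<^sub>0_def d_def\<close>)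
    qed (use \<delta> in \<open>simp add: v\<^sub>0_def v_def\<close>)
    show "\<bar>L z (v\<^sub>0 s) (v s) - L z (w\<^sub>0 s) (w s)\<bar> \<le> \<delta>"
    proof (cases "w\<^sub>0 s < \<rho>")
      case True
      show ?thesis unfolding real_norm_def[symmetric]
        by (rule l'(3)[OF z vs[OF s] ws[OF s]]) (use True \<rho> close[OF s True] in \<open>auto simp: v\<^sub>0_def d_def\<close>)
    qed (use \<delta> in \<open>simp add: v\<^sub>0_def v_def\<close>)
  qed
  then show thesis
    using S by (intro that[OF v \<rho>(1)]) (auto simp: v\<^sub>0_def)
qed

end

subsection \<open>The value functions\<close>

text \<open>Compactness of the frontier yields a uniform radius \<open>\<delta>\<close> through the
  Lebesgue number of a cover. A point outside \<open>T\<close> but closer than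
  \<open>\<delta>\<close> is joined by a segment to a point of \<open>T\<close>; the segment meets
  the frontier, so the point lies in one of the balls.\<close>

lemma vanishing_target_uniform:
  fixes T :: "'x::euclidean_space set"
  assumes T: "vanishing_target T V" and "0 < \<epsilon>"
  obtains \<delta> where "0 < \<delta>" "\<And>z. infdist z T < \<delta> \<Longrightarrow> V z < ennreal \<epsilon>"
proof -
  have ne: "T \<noteq> {}" and cl: "closed T" and cpt: "compact (frontier T)"
    and V0: "\<And>x. x \<in> T \<Longrightarrow> V x = 0" and lim: "\<And>x. x \<in> frontier T \<Longrightarrow> (V \<longlongrightarrow> 0) (at x)"
    using T by (auto simp: vanishing_target_def)
  define \<G> where "\<G> = {U. open U \<and> (\<forall>x\<in>U. V x < ennreal \<epsilon>)}"
  have sub: "frontier T \<subseteq> \<Union>\<G>"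
  proof
    fix b assume b: "b \<in> frontier T"
    \<comment> \<open>The limit at \<open>b\<close> says nothing about \<open>b\<close> itself;
      there the value is 0 because the closed set \<open>T\<close> contains its frontier.\<close>
    then have "V b < ennreal \<epsilon>" using V0 frontier_subset_closed[OF cl] assms(2) by auto
    moreover have "eventually (\<lambda>x. V x < ennreal \<epsilon>) (at b)"
      using order_tendstoD(2)[OF lim[OF b]] assms(2) by auto
    ultimately have "eventually (\<lambda>x. V x < ennreal \<epsilon>) (nhds b)"
      by (simp add: eventually_nhds_conv_at)
    then show "b \<in> \<Union>\<G>" unfolding eventually_nhds \<G>_def by blast
  qed
  obtain \<delta> where \<delta>: "0 < \<delta>" "\<And>x. x \<in> frontier T \<Longrightarrow> \<exists>G\<in>\<G>. ball x \<delta> \<subseteq> G"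
    using Heine_Borel_lemma[OF cpt sub] by (auto simp: \<G>_def)
  show thesis
  proof (rule that[OF \<delta>(1)])
    fix z assume z: "infdist z T < \<delta>"
    show "V z < ennreal \<epsilon>"
    proof (cases "z \<in> T")
      case True
      then show ?thesis using V0 assms(2) by simp
    next
      case False
      have "\<exists>y\<in>T. dist z y < \<delta>"
      proof (rule ccontr)
        assume "\<not> ?thesis"
        then have "\<delta> \<le> infdist z T"
          unfolding infdist_notempty[OF ne] by (intro cINF_greatest ne) (auto simp: not_less)
        with z show False by simp
      qed
      then obtain y where y: "y \<in> T" "dist z y < \<delta>" by blast
      have "closed_segment z y \<inter> frontier T \<noteq> {}"
        using y(1) False by (intro connected_Int_frontier) auto
      then obtain b where b: "b \<in> closed_segment z y" "b \<in> frontier T" by blast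
      have "dist b z < \<delta>" using segment_bound1[OF b(1)] y(2) by (simp add: dist_norm norm_minus_commute)
      then show ?thesis using \<delta>(2)[OF b(2)] by (auto simp: \<G>_def)
    qed
  qed
qed

context control_data
begin

abbreviation "value_T \<equiv> value_fin q A f l"
abbreviation "ext_value_T \<equiv> ext_value_fin q A F L"
abbreviation "value_oo \<equiv> value_inf q A f l"
abbreviation "ext_value_oo \<equiv> ext_value_inf q A F L"

section \<open>The finite-horizon value: equality of both problems and continuity\<close>

lemma cost_mono: "t \<le> t' \<Longrightarrow> cost f l (ereal t) x \<alpha> \<le> cost f l (ereal t') x \<alpha>"
  unfolding cost_fin by (rule nn_integral_mono) (auto split: split_indicator)

lemma J_mono: "J (ereal S) x w\<^sub>0 w \<le> J \<infinity> x w\<^sub>0 w"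
  unfolding J_fin J_inf by (rule nn_integral_mono) (auto split: split_indicator)

lemma value_T_mono: "t \<le> t' \<Longrightarrow> value_T t x \<le> value_T t' x"
  unfolding value_fin_def by (rule INF_mono) (use cost_mono in blast)

lemma set_integrable_pow_w0:
  assumes w: "(w\<^sub>0, w) \<in> \<Gamma>"
  shows "set_integrable lborel {0..s} (\<lambda>u. w\<^sub>0 u ^ q)"
proof -
  have [measurable]: "w\<^sub>0 \<in> borel_measurable (restrict_space borel {0..})"
    and ws: "\<And>s. 0 \<le> s \<Longrightarrow> (w\<^sub>0 s, w s) \<in> ext_control_set q A"
    using w by (auto simp: ext_controls_iff)
  have m: "(\<lambda>u. w\<^sub>0 u ^ q) \<in> borel_measurable (restrict_space borel {0..})" by measurable
  have "norm (w\<^sub>0 s ^ q) \<le> 1" if "0 \<le> s" for s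
    using control_setD(1,6)[OF ws[OF that]] by simp
  then show ?thesis by (rule set_integrable_bounded_Icc[OF m])
qed

text \<open>Uniform in the control and proportional to \<open>S\<close>: short extended horizons are
  cheap, whatever impulses are used.\<close>

lemma J_bound:
  assumes w: "(w\<^sub>0, w) \<in> \<Gamma>" and "0 \<le> S" "S \<le> T" "norm x \<le> r"
  shows "J (ereal S) x w\<^sub>0 w \<le> ennreal (S * Bnd (2 * (1 + r) * exp (4 * M * T)))"
proof -
  define R where "R = 2 * (1 + r) * exp (4 * M * T)"
  have "0 \<le> r" using assms(4) norm_ge_zero order_trans by blast
  then have R: "0 < R" by (simp add: R_def)
  have ws: "\<And>s. 0 \<le> s \<Longrightarrow> (w\<^sub>0 s, w s) \<in> ext_control_set q A"
    using w by (auto simp: ext_controls_iff)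
  have "L (\<xi> x w\<^sub>0 w s) (w\<^sub>0 s) (w s) \<le> Bnd R" if "s \<in> {0..S}" for s
  proof (rule L_bound[OF ws R])
    show "0 \<le> s" using that by simp
    have "norm (\<xi> x w\<^sub>0 w s) \<le> 2 * (1 + norm x) * exp (4 * M * s)"
      using that by (intro ext_traj_bound[OF w]) simp
    also have "\<dots> \<le> R" unfolding R_def
      using that assms \<open>0 \<le> r\<close> pos(1) by (intro mult_mono) auto
    finally show "norm (\<xi> x w\<^sub>0 w s) \<le> R" .
  qed
  then have "J (ereal S) x w\<^sub>0 w \<le> (\<integral>\<^sup>+s. ennreal (Bnd R) * indicator {0..S} s \<partial>lborel)"
    unfolding J_fin by (intro nn_integral_mono) (auto simp: ennreal_leI split: split_indicator)
  also have "\<dots> = ennreal (Bnd R) * ennreal S"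
    using assms(2) by (simp add: nn_integral_cmult_indicator)
  also have "\<dots> = ennreal (S * Bnd R)"
    using assms(2) pos(3)[OF R] by (subst ennreal_mult[symmetric]) (auto simp: mult.commute)
  finally show ?thesis unfolding R_def .
qed

text \<open>The integrated form of \<open>L_coercive\<close>. Both terms stand on the right because
  the cost may be infinite.\<close>

lemma J_coercive:
  assumes w: "(w\<^sub>0, w) \<in> \<Gamma>" and S: "0 \<le> S"
  shows "ennreal (C\<^sub>2 * S) \<le> J (ereal S) x w\<^sub>0 w + ennreal ((C\<^sub>1 + C\<^sub>2) * (LINT s:{0..S}|lborel. w\<^sub>0 s ^ q))"
proof -
  have ws: "\<And>s. 0 \<le> s \<Longrightarrow> (w\<^sub>0 s, w s) \<in> ext_control_set q A"
    using w by (auto simp: ext_controls_iff)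
  have Jm: "(\<lambda>s. ennreal (L (\<xi> x w\<^sub>0 w s) (w\<^sub>0 s) (w s)) * indicator {0..} s) \<in> borel_measurable borel"
    using J_measurable[OF w, of x] by (subst (asm) borel_measurable_restrict_space_iff_ennreal) auto
  have int: "integrable lborel (\<lambda>s. indicat_real {0..S} s *\<^sub>R ((C\<^sub>1 + C\<^sub>2) * w\<^sub>0 s ^ q))"
    using set_integrable_pow_w0[OF w, of S] unfolding set_integrable_def[symmetric] by simp
  have eq: "(\<integral>\<^sup>+s. ennreal (indicat_real {0..S} s *\<^sub>R ((C\<^sub>1 + C\<^sub>2) * w\<^sub>0 s ^ q)) \<partial>lborel)
      = ennreal ((C\<^sub>1 + C\<^sub>2) * (LINT s:{0..S}|lborel. w\<^sub>0 s ^ q))"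
  proof (subst nn_integral_eq_integral[OF int])
    show "AE s in lborel. 0 \<le> indicat_real {0..S} s *\<^sub>R ((C\<^sub>1 + C\<^sub>2) * w\<^sub>0 s ^ q)"
      using C control_setD(1)[OF ws] by (intro AE_I2) (auto split: split_indicator)
    show "ennreal (LINT s|lborel. indicat_real {0..S} s *\<^sub>R ((C\<^sub>1 + C\<^sub>2) * w\<^sub>0 s ^ q))
        = ennreal ((C\<^sub>1 + C\<^sub>2) * (LINT s:{0..S}|lborel. w\<^sub>0 s ^ q))"
      unfolding set_lebesgue_integral_def[symmetric] by simp
  qed
  have "ennreal (C\<^sub>2 * S) = (\<integral>\<^sup>+s. ennreal C\<^sub>2 * indicator {0..S} s \<partial>lborel)"
    using S C by (simp add: nn_integral_cmult_indicator ennreal_mult)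
  also have "\<dots> \<le> (\<integral>\<^sup>+s. ennreal (L (\<xi> x w\<^sub>0 w s) (w\<^sub>0 s) (w s)) * indicator {0..S} s
      + ennreal (indicat_real {0..S} s *\<^sub>R ((C\<^sub>1 + C\<^sub>2) * w\<^sub>0 s ^ q)) \<partial>lborel)"
  proof (rule nn_integral_mono)
    fix s :: real
    show "ennreal C\<^sub>2 * indicator {0..S} s \<le> ennreal (L (\<xi> x w\<^sub>0 w s) (w\<^sub>0 s) (w s)) * indicator {0..S} s
      + ennreal (indicat_real {0..S} s *\<^sub>R ((C\<^sub>1 + C\<^sub>2) * w\<^sub>0 s ^ q))"
    proof (cases "s \<in> {0..S}")
      case True
      then have s: "0 \<le> s" by simp
      have "ennreal C\<^sub>2 \<le> ennreal (L (\<xi> x w\<^sub>0 w s) (w\<^sub>0 s) (w s) + (C\<^sub>1 + C\<^sub>2) * w\<^sub>0 s ^ q)"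
        by (rule ennreal_leI[OF L_coercive[OF ws[OF s]]])
      also have "\<dots> = ennreal (L (\<xi> x w\<^sub>0 w s) (w\<^sub>0 s) (w s)) + ennreal ((C\<^sub>1 + C\<^sub>2) * w\<^sub>0 s ^ q)"
        using L_nonneg[OF ws[OF s]] control_setD(1)[OF ws[OF s]] C by (intro ennreal_plus) auto
      finally show ?thesis using True by simp
    qed simp
  qed
  also have "\<dots> = J (ereal S) x w\<^sub>0 w + ennreal ((C\<^sub>1 + C\<^sub>2) * (LINT s:{0..S}|lborel. w\<^sub>0 s ^ q))"
    unfolding J_fin eq[symmetric]
  proof (rule nn_integral_add)
    have "(\<lambda>s. (ennreal (L (\<xi> x w\<^sub>0 w s) (w\<^sub>0 s) (w s)) * indicator {0..} s) * indicator {..S} s) \<in> borel_measurable borel"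
      using Jm by measurable
    also have "(\<lambda>s. (ennreal (L (\<xi> x w\<^sub>0 w s) (w\<^sub>0 s) (w s)) * indicator {0..} s) * indicator {..S} s)
       = (\<lambda>s. ennreal (L (\<xi> x w\<^sub>0 w s) (w\<^sub>0 s) (w s)) * indicator {0..S} s)"
      by (auto simp: fun_eq_iff split: split_indicator)
    finally show "(\<lambda>s. ennreal (L (\<xi> x w\<^sub>0 w s) (w\<^sub>0 s) (w s)) * indicator {0..S} s) \<in> borel_measurable lborel"
      by simp
    show "(\<lambda>s. ennreal (indicat_real {0..S} s *\<^sub>R ((C\<^sub>1 + C\<^sub>2) * w\<^sub>0 s ^ q))) \<in> borel_measurable lborel"
      by (rule measurable_compose[OF borel_measurable_integrable[OF int]]) auto
  qed
  finally show ?thesis .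
qed

lemma ext_value_T_le:
  assumes "(w\<^sub>0, w) \<in> \<Gamma>" "0 < S" "(LINT s:{0..S}|lborel. w\<^sub>0 s ^ q) = t"
  shows "ext_value_T t x \<le> J (ereal S) x w\<^sub>0 w"
  unfolding ext_value_fin_def by (rule INF_lower2[of "(w\<^sub>0, w, S)"]) (use assms in auto)

text \<open>The ordinary control 0 in extended form: along it extended and ordinary time
  coincide.\<close>

lemma rest_control: "((\<lambda>_. 1), (\<lambda>_. 0)) \<in> \<Gamma>"
  using A(3) q_pos by (auto simp: ext_controls_iff ext_control_set_def)

text \<open>The horizon must be positive although no ordinary time may elapse, so one uses a pure
  impulse in a fixed unit direction \<open>e\<close> of the nontrivial cone and lets its duration
  tend to 0.\<close>

lemma ext_value_T_0: "ext_value_T 0 x = 0"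
proof -
  obtain a where a: "a \<in> A" "a \<noteq> 0" using A(3,4) by blast
  define e where "e = inverse (norm a) *\<^sub>R a"
  have e: "e \<in> A" "norm e = 1" using a by (auto simp: e_def intro: scale_in_A)
  have w: "((\<lambda>_. 0), (\<lambda>_. e)) \<in> \<Gamma>"
    using e q_pos by (auto simp: ext_controls_iff ext_control_set_def zero_power)
  define B where "B = Bnd (2 * (1 + norm x) * exp (4 * M * 1))"
  have B: "0 < B" unfolding B_def using norm_ge_zero[of x] by (intro pos(3) mult_pos_pos) (auto intro: add_pos_nonneg)
  have "ext_value_T 0 x \<le> 0"
  proof (rule ennreal_le_epsilon)
    fix \<epsilon> :: real assume "0 < \<epsilon>"
    define S where "S = min 1 (\<epsilon> / B)"
    have S: "0 < S" "S \<le> 1" "S * B \<le> \<epsilon>" using B \<open>0 < \<epsilon>\<close> by (auto simp: S_def min_def field_simps)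
    have "ext_value_T 0 x \<le> J (ereal S) x (\<lambda>_. 0) (\<lambda>_. e)"
      using q_pos by (intro ext_value_T_le[OF w S(1)]) (simp add: zero_power)
    also have "\<dots> \<le> ennreal (S * B)"
      unfolding B_def using S by (intro J_bound[OF w]) auto
    also have "\<dots> \<le> ennreal \<epsilon>" by (rule ennreal_leI[OF S(3)])
    finally show "ext_value_T 0 x \<le> 0 + ennreal \<epsilon>" by simp
  qed
  then show ?thesis by simp
qed

lemma ext_value_T_le_value_T:
  assumes "0 \<le> t"
  shows "ext_value_T t x \<le> value_T t x"
proof (cases "t = 0")
  \<comment> \<open>The graph completion is known to have positive length only for
    \<open>t > 0\<close>, whereas extended horizons must be positive.\<close>
  case True
  then show ?thesis by (simp add: ext_value_T_0)
next
  case False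
  show ?thesis unfolding value_fin_def
  proof (rule INF_greatest)
    fix \<alpha> assume \<alpha>: "\<alpha> \<in> controls q A"
    obtain w\<^sub>0 w S where w: "(w\<^sub>0, w) \<in> \<Gamma>" "\<And>s. 0 < w\<^sub>0 s" "J \<infinity> x w\<^sub>0 w = cost f l \<infinity> x \<alpha>"
      "\<And>t. 0 \<le> t \<Longrightarrow> t \<le> S t" "\<And>t. 0 \<le> t \<Longrightarrow> (LINT s:{0..S t}|lborel. w\<^sub>0 s ^ q) = t"
      "\<And>t. 0 \<le> t \<Longrightarrow> J (ereal (S t)) x w\<^sub>0 w = cost f l (ereal t) x \<alpha>"
      by (rule ext_control_of_control[OF \<alpha>, of x]) (rule that)
    have "0 < S t" using w(4)[OF assms] assms False by simp
    from ext_value_T_le[OF w(1) this w(5)[OF assms], of x]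
    show "ext_value_T t x \<le> cost f l (ereal t) x \<alpha>" by (simp only: w(6)[OF assms])
  qed
qed

lemma unbounded_clock_of_lower_bound:
  assumes w: "(w\<^sub>0, w) \<in> \<Gamma>" and "0 < \<rho>" "\<And>s. 0 \<le> s \<Longrightarrow> \<rho> \<le> w\<^sub>0 s"
  shows "\<exists>s\<ge>0. B \<le> (LINT u:{0..s}|lborel. w\<^sub>0 u ^ q)"
proof (intro exI conjI)
  define s where "s = max 0 (B / \<rho> ^ q)"
  show s: "0 \<le> s" by (simp add: s_def)
  have "B \<le> s * \<rho> ^ q" using \<open>0 < \<rho>\<close> by (simp add: s_def max_def field_simps)
  also have "\<dots> = (LINT u:{0..s}|lborel. \<rho> ^ q)" using s by (simp add: set_lebesgue_integral_def)
  also have "\<dots> \<le> (LINT u:{0..s}|lborel. w\<^sub>0 u ^ q)"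
    using assms by (intro set_integral_mono set_integrable_pow_w0[OF w] power_mono)
      (auto intro: borel_integrable_atLeastAtMost')
  finally show "B \<le> (LINT u:{0..s}|lborel. w\<^sub>0 u ^ q)" .
qed

lemma value_T_le_ext_value_T: "value_T t x \<le> ext_value_T t x"
  unfolding ext_value_fin_def
proof (rule INF_greatest, clarsimp)
  fix w\<^sub>0 w S
  assume w: "(w\<^sub>0, w) \<in> \<Gamma>" and S: "0 < S" and t: "t = (LINT s:{0..S}|lborel. w\<^sub>0 s ^ q)"
  have ws: "\<And>s. 0 \<le> s \<Longrightarrow> (w\<^sub>0 s, w s) \<in> ext_control_set q A"
    using w by (auto simp: ext_controls_iff)
  have S0: "0 \<le> S" using S by simp
  show "value_T (LINT s:{0..S}|lborel. w\<^sub>0 s ^ q) x \<le> J (ereal S) x w\<^sub>0 w"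
  proof (rule ennreal_le_epsilon)
    fix \<epsilon> :: real assume \<epsilon>: "0 < \<epsilon>"
    obtain v\<^sub>0 v \<rho> where v: "(v\<^sub>0, v) \<in> \<Gamma>" "0 < \<rho>" "\<And>s. 0 \<le> s \<Longrightarrow> \<rho> \<le> v\<^sub>0 s" "\<And>s. 0 \<le> s \<Longrightarrow> w\<^sub>0 s \<le> v\<^sub>0 s"
      "norm (\<xi> x v\<^sub>0 v S - \<xi> x w\<^sub>0 w S) \<le> \<epsilon>" "J (ereal S) x v\<^sub>0 v \<le> J (ereal S) x w\<^sub>0 w + ennreal \<epsilon>"
      by (rule approx_by_positive[OF w S0 \<epsilon>, of x]) (rule that)
    have imp: "F z 0 (v s) = 0" if "0 \<le> s" "v\<^sub>0 s = 0" for s z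
      using v(2) v(3)[OF that(1)] that(2) by simp
    obtain \<alpha> where \<alpha>: "\<alpha> \<in> controls q A" "cost f l \<infinity> x \<alpha> \<le> J \<infinity> x v\<^sub>0 v"
      "\<And>S. 0 \<le> S \<Longrightarrow> cost f l (ereal (LINT u:{0..S}|lborel. v\<^sub>0 u ^ q)) x \<alpha> \<le> J (ereal S) x v\<^sub>0 v"
    proof (rule control_of_ext_control[OF v(1), of x])
      show "F z 0 (v s) = 0" if "0 \<le> s" "v\<^sub>0 s = 0" for s z by (rule imp[OF that])
      show "\<exists>s\<ge>0. B \<le> (LINT u:{0..s}|lborel. v\<^sub>0 u ^ q)" for B
        by (rule unbounded_clock_of_lower_bound[OF v(1,2)]) (rule v(3))
    qed (rule that)
    \<comment> \<open>The perturbed control need not have elapsed time \<open>t\<close>, but it errs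
      only upwards, where monotonicity of the value in time repairs the mismatch.\<close>
    have "(LINT s:{0..S}|lborel. w\<^sub>0 s ^ q) \<le> (LINT u:{0..S}|lborel. v\<^sub>0 u ^ q)"
      using v(4) control_setD(1)[OF ws]
      by (intro set_integral_mono set_integrable_pow_w0[OF w] set_integrable_pow_w0[OF v(1)] power_mono) auto
    then have "value_T (LINT s:{0..S}|lborel. w\<^sub>0 s ^ q) x \<le> value_T (LINT u:{0..S}|lborel. v\<^sub>0 u ^ q) x"
      by (rule value_T_mono)
    also have "\<dots> \<le> cost f l (ereal (LINT u:{0..S}|lborel. v\<^sub>0 u ^ q)) x \<alpha>"
      unfolding value_fin_def by (rule INF_lower[OF \<alpha>(1)])
    also note \<alpha>(3)[OF S0]
    also note v(6)
    finally show "value_T (LINT s:{0..S}|lborel. w\<^sub>0 s ^ q) x \<le> J (ereal S) x w\<^sub>0 w + ennreal \<epsilon>" .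
  qed
qed

lemma value_T_eq: "0 \<le> t \<Longrightarrow> value_T t x = ext_value_T t x"
  using ext_value_T_le_value_T value_T_le_ext_value_T by (rule antisym[rotated])

lemma value_T_bound:
  assumes "0 \<le> t" "t \<le> T" "norm x \<le> r"
  shows "value_T t x \<le> ennreal (t * Bnd (2 * (1 + r) * exp (4 * M * T)))"
proof (cases "t = 0")
  case True
  then show ?thesis using value_T_le_ext_value_T[of 0 x] by (simp add: ext_value_T_0)
next
  case False
  have "ext_value_T t x \<le> J (ereal t) x (\<lambda>_. 1) (\<lambda>_. 0)"
    using assms False LINT_const_1[of t] by (intro ext_value_T_le[OF rest_control]) auto
  also have "\<dots> \<le> ennreal (t * Bnd (2 * (1 + r) * exp (4 * M * T)))"
    using assms by (intro J_bound[OF rest_control])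
  finally show ?thesis using value_T_le_ext_value_T[of t x] by (rule order_trans[rotated])
qed

text \<open>Coercivity bounds the horizon by cost plus elapsed time, and the cost of near-optimal
  controls is bounded through \<open>value_T_bound\<close>. The tolerance is capped at 1 inside the
  proof, so that \<open>S'\<close> does not depend on \<open>\<epsilon>\<close>.\<close>

lemma near_optimal_ext_control:
  assumes r: "0 \<le> r" and T: "0 \<le> T"
  obtains S' where "0 \<le> S'"
    "\<And>t x \<epsilon>. \<lbrakk>0 \<le> t; t \<le> T; norm x \<le> r; 0 < \<epsilon>\<rbrakk> \<Longrightarrow> \<exists>w\<^sub>0 w S. (w\<^sub>0, w) \<in> \<Gamma> \<and> 0 < S \<and> S \<le> S' \<and>
       (LINT s:{0..S}|lborel. w\<^sub>0 s ^ q) = t \<and> J (ereal S) x w\<^sub>0 w \<le> value_T t x + ennreal \<epsilon>"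
proof -
  define K where "K = Bnd (2 * (1 + r) * exp (4 * M * T))"
  have K: "0 < K" unfolding K_def using r by (intro pos(3) mult_pos_pos) auto
  \<comment> \<open>Cost at most \<open>T * K + 1\<close> and elapsed time at most \<open>T\<close>,
    inserted into \<open>J_coercive\<close> and divided by \<open>C\<^sub>2\<close>.\<close>
  define S' where "S' = ((T * K + 1) + (C\<^sub>1 + C\<^sub>2) * T) / C\<^sub>2"
  show thesis
  proof (rule that[of S'])
    show "0 \<le> S'" unfolding S'_def using K T C by (intro divide_nonneg_pos add_nonneg_nonneg mult_nonneg_nonneg) auto
    fix t \<epsilon> :: real and x :: 'x
    assume t: "0 \<le> t" "t \<le> T" and x: "norm x \<le> r" and \<epsilon>: "0 < \<epsilon>"
    define e where "e = min \<epsilon> 1"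
    have e: "0 < e" "e \<le> \<epsilon>" "e \<le> 1" using \<epsilon> by (auto simp: e_def)
    have Vb: "value_T t x \<le> ennreal (t * K)" unfolding K_def by (rule value_T_bound[OF t x])
    then have fin: "ext_value_T t x \<noteq> \<infinity>" using value_T_eq[OF t(1), of x] by (auto simp: top_unique)
    have "\<exists>i\<in>{(w\<^sub>0, w, S). (w\<^sub>0, w) \<in> \<Gamma> \<and> 0 < S \<and> (LINT s:{0..S}|lborel. w\<^sub>0 s ^ q) = t}.
        (case i of (w\<^sub>0, w, S) \<Rightarrow> J (ereal S) x w\<^sub>0 w) < ext_value_T t x + ennreal e"
      by (rule INF_approx_ennreal[OF e(1) ext_value_fin_def fin])
    then obtain w\<^sub>0 w S where w: "(w\<^sub>0, w) \<in> \<Gamma>" and S: "0 < S" and tS: "(LINT s:{0..S}|lborel. w\<^sub>0 s ^ q) = t"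
      and J: "J (ereal S) x w\<^sub>0 w < value_T t x + ennreal e"
      using value_T_eq[OF t(1), of x] by auto
    have "value_T t x + ennreal e \<le> ennreal (t * K) + ennreal e"
      using Vb by (rule add_right_mono)
    also have "\<dots> = ennreal (t * K + e)"
      using t K e by (intro ennreal_plus[symmetric]) auto
    finally have "value_T t x + ennreal e \<le> ennreal (t * K + e)" .
    with J have "J (ereal S) x w\<^sub>0 w \<le> ennreal (t * K + e)" by (meson less_imp_le order_trans)
    then have "J (ereal S) x w\<^sub>0 w + ennreal ((C\<^sub>1 + C\<^sub>2) * t) \<le> ennreal (t * K + e) + ennreal ((C\<^sub>1 + C\<^sub>2) * t)"
      by (rule add_right_mono)
    also have "\<dots> = ennreal ((t * K + e) + (C\<^sub>1 + C\<^sub>2) * t)"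
      using t K e C by (intro ennreal_plus[symmetric]) auto
    finally have "ennreal (C\<^sub>2 * S) \<le> ennreal ((t * K + e) + (C\<^sub>1 + C\<^sub>2) * t)"
      using J_coercive[OF w, of S x] S tS by (meson less_imp_le order_trans)
    moreover have "0 \<le> (t * K + e) + (C\<^sub>1 + C\<^sub>2) * t" using t K e C by simp
    ultimately have "C\<^sub>2 * S \<le> (t * K + e) + (C\<^sub>1 + C\<^sub>2) * t" by (simp only: ennreal_le_iff)
    also have "\<dots> \<le> (T * K + 1) + (C\<^sub>1 + C\<^sub>2) * T"
      using t K e C by (intro add_mono mult_right_mono mult_left_mono) auto
    finally have "S \<le> S'" using C by (simp add: S'_def pos_le_divide_eq mult.commute)
    moreover have "J (ereal S) x w\<^sub>0 w \<le> value_T t x + ennreal \<epsilon>"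
      using less_imp_le[OF J] add_left_mono[OF ennreal_leI[OF e(2)], of "value_T t x"] by (rule order_trans)
    ultimately show "\<exists>w\<^sub>0 w S. (w\<^sub>0, w) \<in> \<Gamma> \<and> 0 < S \<and> S \<le> S' \<and>
       (LINT s:{0..S}|lborel. w\<^sub>0 s ^ q) = t \<and> J (ereal S) x w\<^sub>0 w \<le> value_T t x + ennreal \<epsilon>"
      using w S tS by blast
  qed
qed

text \<open>The time constraint involves the control only, so a near-optimal control for
  \<open>x\<^sub>2\<close> is admissible for \<open>x\<^sub>1\<close>; the common bound on horizons
  makes \<open>stability\<close> uniform.\<close>

lemma value_T_space:
  assumes r: "0 \<le> r" and T: "0 \<le> T" and \<epsilon>: "0 < \<epsilon>"
  obtains \<delta> where "0 < \<delta>" "\<And>t x\<^sub>1 x\<^sub>2. \<lbrakk>0 \<le> t; t \<le> T; norm x\<^sub>1 \<le> r; norm x\<^sub>2 \<le> r; norm (x\<^sub>1 - x\<^sub>2) \<le> \<delta>\<rbrakk> \<Longrightarrow>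
      value_T t x\<^sub>1 \<le> value_T t x\<^sub>2 + ennreal \<epsilon>"
proof -
  have half: "0 < \<epsilon> / 2" using \<epsilon> by simp
  obtain S' where S': "0 \<le> S'"
    "\<And>t x \<epsilon>. \<lbrakk>0 \<le> t; t \<le> T; norm x \<le> r; 0 < \<epsilon>\<rbrakk> \<Longrightarrow> \<exists>w\<^sub>0 w S. (w\<^sub>0, w) \<in> \<Gamma> \<and> 0 < S \<and> S \<le> S' \<and>
       (LINT s:{0..S}|lborel. w\<^sub>0 s ^ q) = t \<and> J (ereal S) x w\<^sub>0 w \<le> value_T t x + ennreal \<epsilon>"
    using near_optimal_ext_control[OF r T] by blast
  obtain \<delta> R where \<delta>: "0 < \<delta>" "0 < R" and stab:
    "\<And>x\<^sub>1 x\<^sub>2 u\<^sub>0 u v\<^sub>0 v S. \<lbrakk>norm x\<^sub>1 \<le> r; norm x\<^sub>2 \<le> r; (u\<^sub>0, u) \<in> \<Gamma>; (v\<^sub>0, v) \<in> \<Gamma>; 0 \<le> S; S \<le> S';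
        norm (x\<^sub>1 - x\<^sub>2) \<le> \<delta>;
        \<And>s z. 0 \<le> s \<Longrightarrow> s \<le> S \<Longrightarrow> norm z \<le> R \<Longrightarrow> norm (F z (u\<^sub>0 s) (u s) - F z (v\<^sub>0 s) (v s)) \<le> \<delta>;
        \<And>s z. 0 \<le> s \<Longrightarrow> s \<le> S \<Longrightarrow> norm z \<le> R \<Longrightarrow> \<bar>L z (u\<^sub>0 s) (u s) - L z (v\<^sub>0 s) (v s)\<bar> \<le> \<delta>\<rbrakk> \<Longrightarrow>
      (\<forall>s\<in>{0..S}. norm (\<xi> x\<^sub>1 u\<^sub>0 u s - \<xi> x\<^sub>2 v\<^sub>0 v s) \<le> \<epsilon> / 2) \<and> J (ereal S) x\<^sub>1 u\<^sub>0 u \<le> J (ereal S) x\<^sub>2 v\<^sub>0 v + ennreal (\<epsilon> / 2)"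
    using stability[OF r S'(1) half] by blast
  show thesis
  proof (rule that[OF \<delta>(1)])
    fix t :: real and x\<^sub>1 x\<^sub>2 :: 'x
    assume t: "0 \<le> t" "t \<le> T" and x: "norm x\<^sub>1 \<le> r" "norm x\<^sub>2 \<le> r" "norm (x\<^sub>1 - x\<^sub>2) \<le> \<delta>"
    obtain w\<^sub>0 w S where w: "(w\<^sub>0, w) \<in> \<Gamma>" "0 < S" "S \<le> S'" "(LINT s:{0..S}|lborel. w\<^sub>0 s ^ q) = t"
      "J (ereal S) x\<^sub>2 w\<^sub>0 w \<le> value_T t x\<^sub>2 + ennreal (\<epsilon> / 2)"
      using S'(2)[OF t x(2) half] by blast
    have "value_T t x\<^sub>1 \<le> ext_value_T t x\<^sub>1" by (rule value_T_le_ext_value_T)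
    also have "\<dots> \<le> J (ereal S) x\<^sub>1 w\<^sub>0 w" by (rule ext_value_T_le[OF w(1,2,4)])
    also have "\<dots> \<le> J (ereal S) x\<^sub>2 w\<^sub>0 w + ennreal (\<epsilon> / 2)"
      by (rule stab[THEN conjunct2, OF x(1,2) w(1) w(1) less_imp_le[OF w(2)] w(3) x(3)])
        (use \<delta>(1) in simp_all)
    also have "\<dots> \<le> (value_T t x\<^sub>2 + ennreal (\<epsilon> / 2)) + ennreal (\<epsilon> / 2)"
      by (rule add_right_mono[OF w(5)])
    also have "\<dots> = value_T t x\<^sub>2 + (ennreal (\<epsilon> / 2) + ennreal (\<epsilon> / 2))" by (simp only: add.assoc)
    also have "ennreal (\<epsilon> / 2) + ennreal (\<epsilon> / 2) = ennreal \<epsilon>"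
      using half by (subst ennreal_plus[symmetric]) auto
    finally show "value_T t x\<^sub>1 \<le> value_T t x\<^sub>2 + ennreal \<epsilon>" .
  qed
qed

text \<open>A near-optimal control for \<open>t\<close> is prolonged by resting for the missing time
  \<open>t' - t\<close>, whose cost is linear in its length. The reverse inequality is
  monotonicity.\<close>

lemma value_T_time:
  assumes r: "0 \<le> r" and T: "0 \<le> T"
  obtains B where "0 \<le> B" "\<And>t t' x. \<lbrakk>0 \<le> t; t \<le> t'; t' \<le> T; norm x \<le> r\<rbrakk> \<Longrightarrow>
      value_T t' x \<le> value_T t x + ennreal ((t' - t) * B)"
proof -
  obtain S' where S': "0 \<le> S'"
    "\<And>t x \<epsilon>. \<lbrakk>0 \<le> t; t \<le> T; norm x \<le> r; 0 < \<epsilon>\<rbrakk> \<Longrightarrow> \<exists>w\<^sub>0 w S. (w\<^sub>0, w) \<in> \<Gamma> \<and> 0 < S \<and> S \<le> S' \<and>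
       (LINT s:{0..S}|lborel. w\<^sub>0 s ^ q) = t \<and> J (ereal S) x w\<^sub>0 w \<le> value_T t x + ennreal \<epsilon>"
    using near_optimal_ext_control[OF r T] by blast
  \<comment> \<open>Bounds the state reached at the end of the near-optimal phase, whose extended
    horizon is at most \<open>S'\<close>; the resting phase starts in this ball.\<close>
  define R where "R = 2 * (1 + r) * exp (4 * M * S')"
  have R: "0 < R" using r by (simp add: R_def)
  define B where "B = Bnd (2 * (1 + R) * exp (4 * M * T))"
  have B: "0 < B" unfolding B_def using R by (intro pos(3) mult_pos_pos) auto
  show thesis
  proof (rule that[of B])
    show "0 \<le> B" using B by simp
    fix t t' :: real and x :: 'x
    assume t: "0 \<le> t" "t \<le> t'" "t' \<le> T" and x: "norm x \<le> r"
    have tT: "t \<le> T" using t by simp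
    show "value_T t' x \<le> value_T t x + ennreal ((t' - t) * B)"
    proof (rule ennreal_le_epsilon)
      fix \<epsilon> :: real assume \<epsilon>: "0 < \<epsilon>"
      obtain w\<^sub>0 w S where w: "(w\<^sub>0, w) \<in> \<Gamma>" "0 < S" "S \<le> S'" "(LINT s:{0..S}|lborel. w\<^sub>0 s ^ q) = t"
        "J (ereal S) x w\<^sub>0 w \<le> value_T t x + ennreal \<epsilon>"
        using S'(2)[OF t(1) tT x \<epsilon>] by blast
      define c\<^sub>0 where "c\<^sub>0 = (\<lambda>s. if s \<le> S then w\<^sub>0 s else (\<lambda>_. 1) (s - S))"
      define c where "c = (\<lambda>s. if s \<le> S then w s else (\<lambda>_. 0) (s - S))"
      have S0: "0 \<le> S" using w(2) by simp
      note conc = ext_control_concat[OF w(1) rest_control S0 c\<^sub>0_def c_def]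
      have h: "0 \<le> t' - t" using t by simp
      interpret one: time_change "\<lambda>_. 1" by (rule time_change_1)
      have "(LINT s:{0..S + (t' - t)}|lborel. c\<^sub>0 s ^ q)
          = (LINT s:{0..S + (t' - t)}|lborel. if s \<le> S then w\<^sub>0 s ^ q else (\<lambda>_. 1) (s - S))"
        by (rule set_lebesgue_integral_cong) (auto simp: c\<^sub>0_def)
      also have "\<dots> = (LINT s:{0..S}|lborel. w\<^sub>0 s ^ q) + (LINT s:{0..t' - t}|lborel. 1)"
        by (rule LINT_concat(2)[OF set_integrable_pow_w0[OF w(1)] one.loc_integrable[OF h] S0 h])
      also have "\<dots> = t'" using w(4) LINT_const_1[OF h] by simp
      finally have ct: "(LINT s:{0..S + (t' - t)}|lborel. c\<^sub>0 s ^ q) = t'" .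
      have z: "norm (\<xi> x w\<^sub>0 w S) \<le> R"
      proof -
        have "norm (\<xi> x w\<^sub>0 w S) \<le> 2 * (1 + norm x) * exp (4 * M * S)"
          by (rule ext_traj_bound[OF w(1) S0])
        also have "\<dots> \<le> R" unfolding R_def using x r w(3) pos(1) by (intro mult_mono) auto
        finally show ?thesis .
      qed
      have "value_T t' x \<le> ext_value_T t' x" by (rule value_T_le_ext_value_T)
      also have "\<dots> \<le> J (ereal (S + (t' - t))) x c\<^sub>0 c"
        using w(2) h by (intro ext_value_T_le[OF conc(1) _ ct]) auto
      also have "\<dots> = J (ereal S) x w\<^sub>0 w + J (ereal (t' - t)) (\<xi> x w\<^sub>0 w S) (\<lambda>_. 1) (\<lambda>_. 0)"
        using conc(2)[of "ereal (t' - t)" x] h by simp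
      also have "\<dots> \<le> (value_T t x + ennreal \<epsilon>) + ennreal ((t' - t) * B)"
        unfolding B_def using t z by (intro add_mono w(5) J_bound[OF rest_control]) auto
      finally show "value_T t' x \<le> value_T t x + ennreal ((t' - t) * B) + ennreal \<epsilon>"
        by (simp only: ac_simps)
    qed
  qed
qed

lemma value_T_finite: "0 \<le> t \<Longrightarrow> value_T t x < \<infinity>"
  using value_T_bound[of t t x "norm x"] by (auto simp: less_top[symmetric] top_unique)

text \<open>Going from \<open>(s, z)\<close> to \<open>(t, x)\<close> through \<open>(s, x)\<close>,
  the first step uses the spatial modulus, uniform in bounded times, and the second the Lipschitz
  bound in time at the fixed point \<open>x\<close>. The argument is carried out for real values,
  where differences make sense.\<close>

lemma continuous_on_value_T: "continuous_on ({0..} \<times> UNIV) (\<lambda>(t, x). value_T t x)"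
proof -
  define v where "v t x = enn2real (value_T t x)" for t x
  have v: "value_T t x = ennreal (v t x)" if "0 \<le> t" for t x
    using value_T_finite[OF that, of x] by (simp add: v_def)
  have v0: "0 \<le> v t x" for t x by (simp add: v_def)
  have "continuous_on ({0..} \<times> UNIV) (\<lambda>(t, x). v t x)"
    unfolding continuous_on_iff
  proof (intro ballI allI impI)
    fix tx :: "real \<times> 'x" and \<epsilon> :: real
    assume tx: "tx \<in> {0..} \<times> UNIV" and \<epsilon>: "0 < \<epsilon>"
    from tx obtain t x where t: "0 \<le> t" and px: "tx = (t, x)" by auto
    define r where "r = norm x + 1"
    have r: "0 \<le> r" by (simp add: r_def)
    have T: "0 \<le> t + 1" and e2: "0 < \<epsilon> / 2" using t \<epsilon> by auto
    obtain \<delta> where \<delta>: "0 < \<delta>" "\<And>s x\<^sub>1 x\<^sub>2. \<lbrakk>0 \<le> s; s \<le> t + 1; norm x\<^sub>1 \<le> r; norm x\<^sub>2 \<le> r; norm (x\<^sub>1 - x\<^sub>2) \<le> \<delta>\<rbrakk> \<Longrightarrow>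
      value_T s x\<^sub>1 \<le> value_T s x\<^sub>2 + ennreal (\<epsilon> / 2)"
      using value_T_space[OF r T e2] by blast
    obtain B where B: "0 \<le> B" "\<And>s s' x. \<lbrakk>0 \<le> s; s \<le> s'; s' \<le> t + 1; norm x \<le> r\<rbrakk> \<Longrightarrow>
      value_T s' x \<le> value_T s x + ennreal ((s' - s) * B)"
      using value_T_time[OF r T] by blast
    have real_le: "a \<le> b + e" if "ennreal a \<le> ennreal b + ennreal e" "0 \<le> b" "0 \<le> e" for a b e :: real
      using that by (simp flip: ennreal_plus)
    have sp: "v s x\<^sub>1 \<le> v s x\<^sub>2 + \<epsilon> / 2"
      if "0 \<le> s" "s \<le> t + 1" "norm x\<^sub>1 \<le> r" "norm x\<^sub>2 \<le> r" "norm (x\<^sub>1 - x\<^sub>2) \<le> \<delta>" for s x\<^sub>1 x\<^sub>2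
      using \<delta>(2)[OF that] that(1) \<epsilon> by (intro real_le) (simp_all add: v v0)
    have tm: "\<bar>v s' x - v s x\<bar> \<le> (s' - s) * B"
      if "0 \<le> s" "s \<le> s'" "s' \<le> t + 1" for s s'
    proof -
      have "v s' x \<le> v s x + (s' - s) * B"
        using B(2)[OF that, of x] that B(1) by (intro real_le) (simp_all add: v v0 r_def)
      moreover have "v s x \<le> v s' x"
        using value_T_mono[OF that(2), of x] that v0 by (simp add: v)
      ultimately show ?thesis by simp
    qed
    \<comment> \<open>The bound 1 keeps times below \<open>t + 1\<close> and points in the ball of
      radius \<open>r\<close>; the last one leaves a strict margin in
      \<open>d * B < \<epsilon> / 2\<close>, and \<open>B + 1\<close> covers
      \<open>B = 0\<close>.\<close>
    define d where "d = min 1 (min \<delta> (\<epsilon> / (4 * (B + 1))))"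
    have d: "0 < d" "d \<le> 1" "d \<le> \<delta>" "d \<le> \<epsilon> / (4 * (B + 1))"
      using \<delta>(1) \<epsilon> B(1) by (auto simp: d_def)
    have dB: "d * B < \<epsilon> / 2"
    proof -
      have "d * B \<le> \<epsilon> / (4 * (B + 1)) * (B + 1)"
        using d B(1) \<epsilon> by (intro mult_mono) auto
      also have "\<dots> = \<epsilon> / 4"
      proof -
        have "B + 1 \<noteq> 0" using B(1) by simp
        then show ?thesis
          unfolding divide_divide_eq_left[symmetric]
          by (rule nonzero_eq_divide_eq[THEN iffD1, OF _ refl])
      qed
      also have "\<dots> < \<epsilon> / 2" using \<epsilon> by simp
      finally show ?thesis .
    qed
    have near: "dist (v s z) (v t x) < \<epsilon>" if s: "0 \<le> s" and dist: "dist (s, z) (t, x) < d" for s z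
    proof -
      have ds: "\<bar>s - t\<bar> < d" and dz: "norm (z - x) < d"
        using dist dist_fst_le[of "(s, z)" "(t, x)"] dist_snd_le[of "(s, z)" "(t, x)"]
        by (auto simp: dist_real_def dist_norm)
      have st: "s \<le> t + 1" using ds d by linarith
      have "norm z \<le> norm x + norm (z - x)" using norm_triangle_ineq[of x "z - x"] by simp
      then have nz: "norm z \<le> r" using dz d(2) by (simp add: r_def)
      have nx: "norm x \<le> r" by (simp add: r_def)
      have "norm (z - x) \<le> \<delta>" "norm (x - z) \<le> \<delta>" using dz d(3) by (auto simp: norm_minus_commute)
      then have 1: "\<bar>v s z - v s x\<bar> \<le> \<epsilon> / 2"
        using sp[OF s st nz nx] sp[OF s st nx nz] by linarith
      have "\<bar>v s x - v t x\<bar> \<le> \<bar>s - t\<bar> * B"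
        using tm[OF s _ , of t] tm[OF t _ st] by (cases "s \<le> t") (auto simp: abs_minus_commute)
      also have "\<dots> \<le> d * B" using ds B(1) by (intro mult_right_mono) auto
      finally show ?thesis
        unfolding dist_real_def using 1 dB by linarith
    qed
    show "\<exists>d>0. \<forall>tx'\<in>{0..} \<times> UNIV. dist tx' tx < d \<longrightarrow>
        dist (case tx' of (t, x) \<Rightarrow> v t x) (case tx of (t, x) \<Rightarrow> v t x) < \<epsilon>"
      using near d(1) unfolding px by (intro exI[of _ d]) auto
  qed
  then have "continuous_on ({0..} \<times> UNIV) (\<lambda>p. ennreal (case p of (t, x) \<Rightarrow> v t x))"
    by (rule continuous_on_ennreal)
  then show ?thesis
    by (rule continuous_on_eq) (auto simp: v)
qed

section \<open>The infinite-horizon value\<close>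

lemma ext_value_oo_le_value_oo: "ext_value_oo x \<le> value_oo x"
  unfolding value_inf_def
proof (rule INF_greatest)
  fix \<alpha> assume \<alpha>: "\<alpha> \<in> controls q A"
  obtain w\<^sub>0 w S where w: "(w\<^sub>0, w) \<in> \<Gamma>" "\<And>s. 0 < w\<^sub>0 s" "J \<infinity> x w\<^sub>0 w = cost f l \<infinity> x \<alpha>"
      "\<And>t. 0 \<le> t \<Longrightarrow> t \<le> S t" "\<And>t. 0 \<le> t \<Longrightarrow> (LINT s:{0..S t}|lborel. w\<^sub>0 s ^ q) = t"
      "\<And>t. 0 \<le> t \<Longrightarrow> J (ereal (S t)) x w\<^sub>0 w = cost f l (ereal t) x \<alpha>"
    by (rule ext_control_of_control[OF \<alpha>, of x]) (rule that)
  have "ext_value_oo x \<le> J \<infinity> x w\<^sub>0 w"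
    unfolding ext_value_inf_def by (rule INF_lower2[OF w(1)]) simp
  then show "ext_value_oo x \<le> cost f l \<infinity> x \<alpha>" by (simp only: w(3))
qed

lemma unbounded_clock_of_finite_cost:
  assumes w: "(w\<^sub>0, w) \<in> \<Gamma>" and fin: "J \<infinity> x w\<^sub>0 w < \<infinity>"
  shows "\<exists>s\<ge>0. B \<le> (LINT u:{0..s}|lborel. w\<^sub>0 u ^ q)"
proof -
  define j where "j = enn2real (J \<infinity> x w\<^sub>0 w)"
  have j: "J \<infinity> x w\<^sub>0 w = ennreal j" "0 \<le> j" using fin by (auto simp: j_def)
  have ws: "\<And>s. 0 \<le> s \<Longrightarrow> (w\<^sub>0 s, w s) \<in> ext_control_set q A"
    using w by (auto simp: ext_controls_iff)
  \<comment> \<open>Chosen so that \<open>C\<^sub>2 * s\<close> equals the total cost plus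
    \<open>(C\<^sub>1 + C\<^sub>2) * \<bar>B\<bar>\<close>; coercivity then leaves at least
    \<open>\<bar>B\<bar>\<close> for the elapsed time.\<close>
  define s where "s = (j + (C\<^sub>1 + C\<^sub>2) * \<bar>B\<bar>) / C\<^sub>2"
  have s: "0 \<le> s" unfolding s_def using j C by (intro divide_nonneg_pos add_nonneg_nonneg mult_nonneg_nonneg) auto
  define t where "t = (LINT u:{0..s}|lborel. w\<^sub>0 u ^ q)"
  have t: "0 \<le> t" unfolding t_def set_lebesgue_integral_def
    using control_setD(1)[OF ws] by (intro Bochner_Integration.integral_nonneg) (auto split: split_indicator)
  have Ct: "0 \<le> (C\<^sub>1 + C\<^sub>2) * t" using t C by simp
  have "ennreal (C\<^sub>2 * s) \<le> J (ereal s) x w\<^sub>0 w + ennreal ((C\<^sub>1 + C\<^sub>2) * t)"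
    unfolding t_def by (rule J_coercive[OF w s])
  also have "\<dots> \<le> ennreal j + ennreal ((C\<^sub>1 + C\<^sub>2) * t)"
    unfolding j(1)[symmetric] by (rule add_right_mono[OF J_mono])
  also have "\<dots> = ennreal (j + (C\<^sub>1 + C\<^sub>2) * t)" using j(2) Ct by (rule ennreal_plus[symmetric])
  finally have "C\<^sub>2 * s \<le> j + (C\<^sub>1 + C\<^sub>2) * t"
    by (rule ennreal_le_iff[OF add_nonneg_nonneg[OF j(2) Ct], THEN iffD1])
  moreover have "C\<^sub>2 * s = j + (C\<^sub>1 + C\<^sub>2) * \<bar>B\<bar>" using C by (simp add: s_def)
  ultimately have "(C\<^sub>1 + C\<^sub>2) * \<bar>B\<bar> \<le> (C\<^sub>1 + C\<^sub>2) * t" by simp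
  then have "\<bar>B\<bar> \<le> t" using C by simp
  then show ?thesis using s unfolding t_def by (intro exI[of _ s]) auto
qed

text \<open>A finite cost already supplies the unbounded clock, so only the condition at
  \<open>w\<^sub>0 = 0\<close> remains; it is vacuous for positive \<open>w\<^sub>0\<close>.\<close>

lemma value_oo_le:
  assumes w: "(w\<^sub>0, w) \<in> \<Gamma>" and impulse: "\<And>s z. 0 \<le> s \<Longrightarrow> w\<^sub>0 s = 0 \<Longrightarrow> F z 0 (w s) = 0"
  shows "value_oo x \<le> J \<infinity> x w\<^sub>0 w"
proof (cases "J \<infinity> x w\<^sub>0 w < \<infinity>")
  case True
  obtain \<alpha> where \<alpha>: "\<alpha> \<in> controls q A" "cost f l \<infinity> x \<alpha> \<le> J \<infinity> x w\<^sub>0 w"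
    "\<And>S. 0 \<le> S \<Longrightarrow> cost f l (ereal (LINT u:{0..S}|lborel. w\<^sub>0 u ^ q)) x \<alpha> \<le> J (ereal S) x w\<^sub>0 w"
  proof (rule control_of_ext_control[OF w, of x])
    show "F z 0 (w s) = 0" if "0 \<le> s" "w\<^sub>0 s = 0" for s z by (rule impulse[OF that])
    show "\<exists>s\<ge>0. B \<le> (LINT u:{0..s}|lborel. w\<^sub>0 u ^ q)" for B
      by (rule unbounded_clock_of_finite_cost[OF w True])
  qed (rule that)
  show ?thesis unfolding value_inf_def by (rule INF_lower2[where f="cost f l \<infinity> x", OF \<alpha>(1,2)])
qed (simp add: less_top[symmetric])

text \<open>After rescaling, the growth bound contributes \<open>r ^ q\<close> and
  \<open>r ^ (q - p) * norm a ^ p\<close>; with \<open>p < q\<close> both vanish as \<open>r\<close>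
  tends to 0.\<close>

lemma F_impulse_eq_0:
  assumes "p < q" "a \<in> A"
  shows "F z 0 a = 0"
proof -
  have "(\<lambda>n. level_seq 0 n ^ q *\<^sub>R f z (inverse (level_seq 0 n) *\<^sub>R a)) \<longlonglongrightarrow> 0"
  proof (rule Lim_null_comparison)
    have "(\<lambda>n. M * (level_seq 0 n ^ q + level_seq 0 n ^ (q - p) * norm a ^ p) * (1 + norm z))
        \<longlonglongrightarrow> M * (0 ^ q + 0 ^ (q - p) * norm a ^ p) * (1 + norm z)"
      by (intro tendsto_intros level_seq_LIMSEQ)
    then show "(\<lambda>n. M * (level_seq 0 n ^ q + level_seq 0 n ^ (q - p) * norm a ^ p) * (1 + norm z)) \<longlonglongrightarrow> 0"
      using assms(1) q_pos by (simp add: zero_power)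
    have bound: "norm (r ^ q *\<^sub>R f z (inverse r *\<^sub>R a)) \<le> M * (r ^ q + r ^ (q - p) * norm a ^ p) * (1 + norm z)"
      if r: "0 < r" for r
    proof -
      have "norm (r ^ q *\<^sub>R f z (inverse r *\<^sub>R a)) = r ^ q * norm (f z (inverse r *\<^sub>R a))" using r by simp
      also have "\<dots> \<le> r ^ q * (M * (1 + norm (inverse r *\<^sub>R a) ^ p) * (1 + norm z))"
        using r assms(2) by (intro mult_left_mono f_growth scale_in_A) auto
      also have "\<dots> = M * (r ^ q + r ^ q * norm (inverse r *\<^sub>R a) ^ p) * (1 + norm z)"
        by (simp add: algebra_simps)
      also have "r ^ q * norm (inverse r *\<^sub>R a) ^ p = r ^ (q - p) * norm a ^ p"
        using r pq by (simp add: power_mult_distrib power_diff field_simps)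
      finally show ?thesis .
    qed
    show "\<forall>\<^sub>F n in sequentially. norm (level_seq 0 n ^ q *\<^sub>R f z (inverse (level_seq 0 n) *\<^sub>R a))
        \<le> M * (level_seq 0 n ^ q + level_seq 0 n ^ (q - p) * norm a ^ p) * (1 + norm z)"
      by (intro always_eventually allI bound level_seq_pos order_refl)
  qed
  with F_LIMSEQ[OF assms(2), of 0 z] show ?thesis by (rule LIMSEQ_unique)
qed

lemma value_oo_eq_of_lt:
  assumes "p < q"
  shows "value_oo x = ext_value_oo x"
proof (rule antisym[OF _ ext_value_oo_le_value_oo])
  show "value_oo x \<le> ext_value_oo x"
    unfolding ext_value_inf_def
  proof (rule INF_greatest, clarsimp)
    fix w\<^sub>0 w assume w: "(w\<^sub>0, w) \<in> \<Gamma>"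
    have ws: "\<And>s. 0 \<le> s \<Longrightarrow> (w\<^sub>0 s, w s) \<in> ext_control_set q A"
      using w by (auto simp: ext_controls_iff)
    show "value_oo x \<le> J \<infinity> x w\<^sub>0 w"
      by (rule value_oo_le[OF w]) (rule F_impulse_eq_0[OF assms control_setD(2)[OF ws]])
  qed
qed

text \<open>Follow a near-optimal extended control until it is close to the target, replace it up to that
  time by a control with \<open>w\<^sub>0 > 0\<close>, and finish with a cheap ordinary control.\<close>

lemma value_oo_eq_of_target:
  assumes T: "vanishing_target T value_oo" and approach: "near_optimal_approach q A F L T"
  shows "value_oo x = ext_value_oo x"
proof (rule antisym[OF _ ext_value_oo_le_value_oo])
  show "value_oo x \<le> ext_value_oo x"
  proof (rule ennreal_le_epsilon)
    fix \<epsilon> :: real assume fin: "ext_value_oo x < top" and "0 < \<epsilon>"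
    have "ext_value_oo x < \<infinity>" using fin by simp
    from approach[unfolded near_optimal_approach_def, THEN spec, THEN mp, OF this]
    obtain \<epsilon>\<^sub>0 :: real where \<epsilon>\<^sub>0: "0 < \<epsilon>\<^sub>0" "\<forall>(w\<^sub>0, w)\<in>\<Gamma>.
        J \<infinity> x w\<^sub>0 w \<le> ext_value_oo x + ennreal \<epsilon>\<^sub>0 \<longrightarrow>
        Liminf at_top (\<lambda>s. ereal (infdist (\<xi> x w\<^sub>0 w s) T)) = 0"
      by blast
    \<comment> \<open>Three errors have to fit into \<open>\<epsilon>\<close>: near-optimality,
      perturbation and the final piece. The bound \<open>\<epsilon>\<^sub>0\<close> makes the
      approach hypothesis applicable to the chosen control.\<close>
    define e where "e = min \<epsilon>\<^sub>0 (\<epsilon> / 3)"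
    have e: "0 < e" "e \<le> \<epsilon>\<^sub>0" "e \<le> \<epsilon> / 3" using \<epsilon>\<^sub>0(1) \<open>0 < \<epsilon>\<close> by (auto simp: e_def)
    obtain \<delta> where \<delta>: "0 < \<delta>" "\<And>z. infdist z T < \<delta> \<Longrightarrow> value_oo z < ennreal e"
      using vanishing_target_uniform[OF T e(1)] by blast
    have "\<exists>i\<in>\<Gamma>. (case i of (w\<^sub>0, w) \<Rightarrow> J \<infinity> x w\<^sub>0 w) < ext_value_oo x + ennreal e"
      by (rule INF_approx_ennreal[OF e(1) ext_value_inf_def]) (use fin in auto)
    then obtain w\<^sub>0 w where w: "(w\<^sub>0, w) \<in> \<Gamma>" and Jw: "J \<infinity> x w\<^sub>0 w \<le> ext_value_oo x + ennreal e"
      by (auto intro: less_imp_le)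
    have "J \<infinity> x w\<^sub>0 w \<le> ext_value_oo x + ennreal \<epsilon>\<^sub>0"
      using Jw add_left_mono[OF ennreal_leI[OF e(2)]] by (rule order_trans)
    with bspec[OF \<epsilon>\<^sub>0(2) w] have lim: "Liminf at_top (\<lambda>s. ereal (infdist (\<xi> x w\<^sub>0 w s) T)) = 0"
      by simp
    obtain S where S: "0 \<le> S" "infdist (\<xi> x w\<^sub>0 w S) T < \<delta> / 2"
    proof (rule ccontr)
      assume "\<not> thesis"
      then have "\<forall>s\<ge>0. \<delta> / 2 \<le> infdist (\<xi> x w\<^sub>0 w s) T" using that by (meson not_less)
      then have "\<forall>\<^sub>F s in at_top. ereal (\<delta> / 2) \<le> ereal (infdist (\<xi> x w\<^sub>0 w s) T)"
        unfolding eventually_at_top_linorder by (intro exI[of _ 0]) simp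
      from Liminf_bounded[OF this] lim \<delta>(1) show False by simp
    qed
    \<comment> \<open>One tolerance for two purposes: \<open>e\<close> for the cost, and
      \<open>\<delta> / 2\<close> so that the perturbed end point is still within
      \<open>\<delta>\<close> of the target.\<close>
    have "0 < min e (\<delta> / 2)" using e \<delta> by simp
    obtain v\<^sub>0 v \<rho> where v: "(v\<^sub>0, v) \<in> \<Gamma>" "0 < \<rho>" "\<And>s. 0 \<le> s \<Longrightarrow> \<rho> \<le> v\<^sub>0 s"
      "\<And>s. 0 \<le> s \<Longrightarrow> w\<^sub>0 s \<le> v\<^sub>0 s" "norm (\<xi> x v\<^sub>0 v S - \<xi> x w\<^sub>0 w S) \<le> min e (\<delta> / 2)"
      "J (ereal S) x v\<^sub>0 v \<le> J (ereal S) x w\<^sub>0 w + ennreal (min e (\<delta> / 2))"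
      by (rule approx_by_positive[OF w S(1) \<open>0 < min e (\<delta> / 2)\<close>, of x]) (rule that)
    define z where "z = \<xi> x v\<^sub>0 v S"
    have "infdist z T < \<delta>"
      using infdist_triangle[of z T "\<xi> x w\<^sub>0 w S"] S(2) v(5) by (simp add: dist_norm z_def)
    then have "value_oo z < ennreal e" by (rule \<delta>(2))
    then obtain \<beta> where \<beta>: "\<beta> \<in> controls q A" "cost f l \<infinity> z \<beta> < ennreal e"
      unfolding value_inf_def by (auto simp: INF_less_iff)
    \<comment> \<open>The cheap ordinary control is moved to the extended problem, where both pieces
      can be concatenated; as \<open>w\<^sub>0\<close> is positive throughout, the result is
      converted back as a whole.\<close>
    obtain u\<^sub>0 u S' where u: "(u\<^sub>0, u) \<in> \<Gamma>" "\<And>s. 0 < u\<^sub>0 s" "J \<infinity> z u\<^sub>0 u = cost f l \<infinity> z \<beta>"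
      "\<And>t. 0 \<le> t \<Longrightarrow> t \<le> S' t" "\<And>t. 0 \<le> t \<Longrightarrow> (LINT s:{0..S' t}|lborel. u\<^sub>0 s ^ q) = t"
      "\<And>t. 0 \<le> t \<Longrightarrow> J (ereal (S' t)) z u\<^sub>0 u = cost f l (ereal t) z \<beta>"
      by (rule ext_control_of_control[OF \<beta>(1), of z]) (rule that)
    define c\<^sub>0 where "c\<^sub>0 = (\<lambda>s. if s \<le> S then v\<^sub>0 s else u\<^sub>0 (s - S))"
    define c where "c = (\<lambda>s. if s \<le> S then v s else u (s - S))"
    note conc = ext_control_concat[OF v(1) u(1) S(1) c\<^sub>0_def c_def]
    have pos: "0 < c\<^sub>0 s" if "0 \<le> s" for s
      using u(2)[of "s - S"] less_le_trans[OF v(2) v(3)[OF that]] by (simp add: c\<^sub>0_def)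
    have "value_oo x \<le> J \<infinity> x c\<^sub>0 c"
    proof (rule value_oo_le[OF conc(1)])
      show "F y 0 (c s) = 0" if "0 \<le> s" "c\<^sub>0 s = 0" for s y
        using pos[OF that(1)] that(2) by simp
    qed
    also have "\<dots> = J (ereal S) x v\<^sub>0 v + J \<infinity> z u\<^sub>0 u"
      using conc(2)[of \<infinity> x] by (simp add: z_def)
    also have "\<dots> \<le> (J (ereal S) x w\<^sub>0 w + ennreal (min e (\<delta> / 2))) + ennreal e"
      using v(6) \<beta>(2) u(3) by (intro add_mono) auto
    also have "\<dots> \<le> ((ext_value_oo x + ennreal e) + ennreal e) + ennreal e"
      using order_trans[OF J_mono Jw] by (intro add_mono ennreal_leI) auto
    also have "\<dots> = ext_value_oo x + (ennreal e + ennreal e + ennreal e)" by (simp only: ac_simps)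
    also have "ennreal e + ennreal e + ennreal e = ennreal (e + e + e)"
      using e(1) by (simp flip: ennreal_plus)
    also have "ext_value_oo x + \<dots> \<le> ext_value_oo x + ennreal \<epsilon>"
      using e(3) by (intro add_left_mono ennreal_leI) simp
    finally show "value_oo x \<le> ext_value_oo x + ennreal \<epsilon>" .
  qed
qed

end

theorem theorem3p1:
  fixes A :: "(real ^ 'm) set"
    and f finf :: "real ^ 'n \<Rightarrow> real ^ 'm \<Rightarrow> real ^ 'n"
    and l linf :: "real ^ 'n \<Rightarrow> real ^ 'm \<Rightarrow> real"
    and p q :: nat
    and M C\<^sub>1 C\<^sub>2 :: real
    and Lip Bnd :: "real \<Rightarrow> real"
    and \<omega> :: "real \<Rightarrow> real \<Rightarrow> real"
  assumes A: "convex A" "closed A" "cone A" "0 \<in> A" "A \<noteq> {0}"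
    and A_unbounded: "\<not> bounded A"
    and f_cont: "continuous_on (UNIV \<times> A) (\<lambda>(x, a). f x a)"
    and l_cont: "continuous_on (UNIV \<times> A) (\<lambda>(x, a). l x a)"
    and pq: "1 \<le> p" "p \<le> q"
    and pos: "0 < M" "\<And>R. 0 < R \<Longrightarrow> 0 < Lip R" "\<And>R. 0 < R \<Longrightarrow> 0 < Bnd R"
    and \<omega>: "modulus \<omega>"
    and f_lip: "\<And>R a x\<^sub>1 x\<^sub>2. 0 < R \<Longrightarrow> a \<in> A \<Longrightarrow> norm x\<^sub>1 \<le> R \<Longrightarrow> norm x\<^sub>2 \<le> R \<Longrightarrow>
      norm (f x\<^sub>1 a - f x\<^sub>2 a) \<le> Lip R * (1 + norm a ^ p) * norm (x\<^sub>1 - x\<^sub>2)"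
    and l_mod: "\<And>R a x\<^sub>1 x\<^sub>2. 0 < R \<Longrightarrow> a \<in> A \<Longrightarrow> norm x\<^sub>1 \<le> R \<Longrightarrow> norm x\<^sub>2 \<le> R \<Longrightarrow>
      \<bar>l x\<^sub>1 a - l x\<^sub>2 a\<bar> \<le> (1 + norm a ^ q) * \<omega> (norm (x\<^sub>1 - x\<^sub>2)) R"
    and l_bnd: "\<And>R a x. 0 < R \<Longrightarrow> a \<in> A \<Longrightarrow> norm x \<le> R \<Longrightarrow>
      0 \<le> l x a \<and> l x a \<le> Bnd R * (1 + norm a ^ q)"
    and f_growth: "\<And>x a. a \<in> A \<Longrightarrow> norm (f x a) \<le> M * (1 + norm a ^ p) * (1 + norm x)"
    and C: "0 \<le> C\<^sub>1" "0 < C\<^sub>2"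
    and l_coercive: "\<And>x a. a \<in> A \<Longrightarrow> C\<^sub>2 * norm a ^ q - C\<^sub>1 \<le> l x a"
    and finf: "recession_limit q A f finf"
    and linf: "recession_limit q A l linf"
  shows "(\<forall>t\<ge>0. \<forall>x.
           value_fin q A f l t x = ext_value_fin q A (extend q f finf) (extend q l linf) t x \<and>
           value_fin q A f l t x < \<infinity>) \<and>
         continuous_on ({0..} \<times> UNIV) (\<lambda>(t, x). value_fin q A f l t x) \<and>
         (p < q \<or>
          (\<exists>T. vanishing_target T (value_inf q A f l) \<and>
               near_optimal_approach q A (extend q f finf) (extend q l linf) T) \<longrightarrow>
          (\<forall>x. value_inf q A f l x =
               ext_value_inf q A (extend q f finf) (extend q l linf) x))"
proof -
  interpret control_data A f finf l linf p q M C\<^sub>1 C\<^sub>2 Lip Bnd \<omega>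
    by (rule control_data.intro) fact+
  show ?thesis
    using value_T_eq value_T_finite continuous_on_value_T value_oo_eq_of_lt value_oo_eq_of_target
    by blast
qed

end
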